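(* Let $n\ge 1$ be an integer and $s\in(0,1)$. Let $k,m\in\mathbb{N}$ and let $u:\mathbb{R}^n\to\mathbb{R}$ be such that $u\in C^{2m}(\overline{B_1})$ and $$\int_{B_1^c}\frac{|u(x)|}{|x|^{n+2s+k}}\,dx<+\infty.$$ Let $$N(m):=n+\sum_{j=0}^m n^j$$ and let $F\in C^m(\mathbb{R}^{N(m)})$. Then, for any $\varepsilon>0$ there exist functions $u_\varepsilon,\eta_\varepsilon:\mathbb{R}^n\to\mathbb{R}$ and $R_\varepsilon>1$ such that $$(-\Delta)^s u_\varepsilon(x)\stackrel{k}{=}F\big(x,u_\varepsilon(x),\nabla u_\varepsilon(x),\dots,D^m u_\varepsilon(x)\big)+\eta_\varepsilon(x)\quad\text{for all } x\in B_1,$$ $$\|\eta_\varepsilon\|_{L^\infty(B_1)}\le\varepsilon,$$ $$\|u_\varepsilon-u\|_{C^m(B_1)}\le\varepsilon,$$ $$\text{and}\quad u_\varepsilon=u\quad\text{in } B_{R_\varepsilon}^c.$$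
   Context: Notation: $\mathbb{N}=\{0,1,2,\dots\}$; $B_r(x)$ is the open ball of radius $r$ centered at $x$ in $\mathbb{R}^n$, $B_r=B_r(0)$, and $B_r^c=\mathbb{R}^n\setminus B_r$. Functions are Lebesgue measurable. $D^j u(x)$ denotes the collection of all $j$-th order partial derivatives of $u$ at $x$, viewed as a vector in $\mathbb{R}^{n^j}$, so that $(x,u(x),\nabla u(x),\dots,D^m u(x))\in\mathbb{R}^{N(m)}$. For $s\in(0,1)$ the fractional Laplacian is $$(-\Delta)^s w(x):=\lim_{\rho\searrow0}\int_{\mathbb{R}^n\setminus B_\rho(x)}\frac{w(x)-w(y)}{|x-y|^{n+2s}}\,dy,$$ and equations $(-\Delta)^s w=g$ in $B_1$ may be understood in the usual viscosity sense. For $k\in\mathbb{N}$ let $\mathcal{U}_k$ be the set of functions $u:\mathbb{R}^n\to\mathbb{R}$ that are continuous in $B_1$ and satisfy $\int_{\mathbb{R}^n}\frac{|u(x)|}{1+|x|^{n+2s+k}}\,dx<+\infty$. Let $\chi_R(x)=1$ if $x\in B_R$ and $\chi_R(x)=0$ if $x\in\mathbb{R}^n\setminus B_R$. Definition (divergent fractional Laplacian). For $u\in\mathcal{U}_k$ and $f:B_1\to\mathbb{R}$, one writes $(-\Delta)^s u\stackrel{k}{=}f$ in $B_1$ (also $(-\Delta)^s u(x)\stackrel{k}{=}f(x)$ for all $x\in B_1$) if there exist a family of polynomials $P_R$ of degree at most $k-1$ (with $P_R=0$ when $k=0$) and functions $f_R:B_1\to\mathbb{R}$, indexed by (large) $R$,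 such that $(-\Delta)^s(\chi_R u)=f_R+P_R$ in $B_1$ in the viscosity sense, and $\lim_{R\to+\infty}f_R(x)=f(x)$ for every $x\in B_1$. *)

theory Defs
  imports "HOL-Probability.Probability"
begin

section \<open>Partial derivatives and classes of differentiable functions\<close>

definition partial :: "'n::finite \<Rightarrow> (real^'n \<Rightarrow> real) \<Rightarrow> real^'n \<Rightarrow> real" where
  "partial i f x = deriv (\<lambda>t. f (x + t *\<^sub>R axis i 1)) 0"

text \<open>A \<open>j\<close>-th order partial derivative is indexed by a list of \<open>j\<close> directions, so that the
  derivatives of order \<open>j\<close> form a vector with \<open>n ^ j\<close> entries.\<close>

definition partials :: "'n::finite list \<Rightarrow> (real^'n \<Rightarrow> real) \<Rightarrow> real^'n \<Rightarrow> real" where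
  "partials \<alpha> f = foldr partial \<alpha> f"

definition Ck_on :: "nat \<Rightarrow> (real^'n::finite) set \<Rightarrow> (real^'n \<Rightarrow> real) \<Rightarrow> bool" where
  "Ck_on k \<Omega> f \<longleftrightarrow>
     (\<forall>\<alpha> i. \<forall>x\<in>\<Omega>. length \<alpha> < k \<longrightarrow>
        (\<lambda>t. partials \<alpha> f (x + t *\<^sub>R axis i 1)) field_differentiable (at 0)) \<and>
     (\<forall>\<alpha>. length \<alpha> \<le> k \<longrightarrow> continuous_on \<Omega> (partials \<alpha> f))"

text \<open>\<open>C\<^sup>k\<close> up to the boundary of the open set \<open>\<Omega>\<close>: all derivatives of order at most \<open>k\<close> extend
  continuously to the closure, and \<open>f\<close> itself is its own extension.\<close>

definition Ck_closure :: "nat \<Rightarrow> (real^'n::finite) set \<Rightarrow> (real^'n \<Rightarrow> real) \<Rightarrow> bool" where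
  "Ck_closure k \<Omega> f \<longleftrightarrow>
     Ck_on k \<Omega> f \<and> continuous_on (closure \<Omega>) f \<and>
     (\<forall>\<alpha>. length \<alpha> \<le> k \<longrightarrow>
        (\<exists>g. continuous_on (closure \<Omega>) g \<and> (\<forall>x\<in>\<Omega>. g x = partials \<alpha> f x)))"

definition Ck_norm :: "nat \<Rightarrow> (real^'n::finite) set \<Rightarrow> (real^'n \<Rightarrow> real) \<Rightarrow> ennreal" where
  "Ck_norm k \<Omega> f = (\<Sum>\<alpha> | length \<alpha> \<le> k. SUP x\<in>\<Omega>. ennreal \<bar>partials \<alpha> f x\<bar>)"

definition Linf_norm :: "(real^'n::finite) set \<Rightarrow> (real^'n \<Rightarrow> real) \<Rightarrow> ennreal" where
  "Linf_norm \<Omega> f = esssup (lebesgue_on \<Omega>) (\<lambda>x. ennreal \<bar>f x\<bar>)"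

section \<open>Functions of the jet\<close>

text \<open>The dimension \<open>N(m)\<close> depends on \<open>m\<close>, so \<open>\<real>\<close> to the power \<open>N(m)\<close> is rendered as the
  extensional functions on a finite set with \<open>N(m)\<close> elements: \<open>Inl i\<close> stands for the coordinate
  \<open>x $ i\<close>, and \<open>Inr \<alpha>\<close> for the derivative \<open>partials \<alpha> u x\<close>.\<close>

definition jet_coords :: "nat \<Rightarrow> ('n::finite + 'n list) set" where
  "jet_coords m = UNIV <+> {\<alpha>. length \<alpha> \<le> m}"

lemma finite_lists_le: "finite {\<alpha> :: 'n::finite list. length \<alpha> \<le> m}"
  using finite_lists_length_le[of "UNIV :: 'n set" m] by simp

lemma finite_jet_coords: "finite (jet_coords m :: ('n::finite + 'n list) set)"
  by (simp add: jet_coords_def finite_lists_le)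

lemma card_jet_coords:
  "card (jet_coords m :: ('n::finite + 'n list) set) = CARD('n) + (\<Sum>j=0..m. CARD('n) ^ j)"
  using card_lists_length_le[of "UNIV :: 'n set" m]
  by (simp add: jet_coords_def card_Plus finite_lists_le atMost_atLeast0)

definition jet :: "nat \<Rightarrow> (real^'n::finite \<Rightarrow> real) \<Rightarrow> real^'n \<Rightarrow> 'n + 'n list \<Rightarrow> real" where
  "jet m u x = restrict (case_sum (\<lambda>i. x $ i) (\<lambda>\<alpha>. partials \<alpha> u x)) (jet_coords m)"

definition coord_partial :: "'i \<Rightarrow> (('i \<Rightarrow> real) \<Rightarrow> real) \<Rightarrow> ('i \<Rightarrow> real) \<Rightarrow> real" where
  "coord_partial i F z = deriv (\<lambda>t. F (z(i := t))) (z i)"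

text \<open>\<open>C\<^sup>k\<close> functions on the whole of \<open>I \<rightarrow>\<^sub>E UNIV\<close>. Continuity refers to the product topology on the
  function type; for finite \<open>I\<close> it induces the Euclidean topology on \<open>I \<rightarrow>\<^sub>E UNIV\<close>.\<close>

definition Ck_coord :: "nat \<Rightarrow> 'i set \<Rightarrow> (('i \<Rightarrow> real) \<Rightarrow> real) \<Rightarrow> bool" where
  "Ck_coord k I F \<longleftrightarrow>
     (\<forall>\<beta>\<in>lists I. \<forall>i\<in>I. \<forall>z\<in>I \<rightarrow>\<^sub>E UNIV. length \<beta> < k \<longrightarrow>
        (\<lambda>t. foldr coord_partial \<beta> F (z(i := t))) field_differentiable (at (z i))) \<and>
     (\<forall>\<beta>\<in>lists I. length \<beta> \<le> k \<longrightarrow>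
        continuous_on (I \<rightarrow>\<^sub>E UNIV) (foldr coord_partial \<beta> F))"

section \<open>The fractional Laplacian and viscosity solutions\<close>

definition has_frac_laplacian ::
    "real \<Rightarrow> (real^'n::finite \<Rightarrow> real) \<Rightarrow> real^'n \<Rightarrow> real \<Rightarrow> bool" where
  "has_frac_laplacian s w x L \<longleftrightarrow>
     (\<forall>\<rho>>0. set_integrable lebesgue (- ball x \<rho>)
        (\<lambda>y. (w x - w y) / norm (x - y) powr (real CARD('n) + 2 * s))) \<and>
     ((\<lambda>\<rho>. LINT y:- ball x \<rho>|lebesgue. (w x - w y) / norm (x - y) powr (real CARD('n) + 2 * s))
        \<longlongrightarrow> L) (at_right 0)"

text \<open>Viscosity sense: whenever \<open>\<phi>\<close> touches \<open>w\<close> from above (below) at \<open>x\<close> on a neighbourhood \<open>N\<close>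
  inside \<open>\<Omega>\<close>, the function equal to \<open>\<phi>\<close> on \<open>N\<close> and to \<open>w\<close> elsewhere has fractional Laplacian at
  most (at least) \<open>g x\<close> at \<open>x\<close>.\<close>

definition visc_subsolution ::
    "real \<Rightarrow> (real^'n::finite) set \<Rightarrow> (real^'n \<Rightarrow> real) \<Rightarrow> (real^'n \<Rightarrow> real) \<Rightarrow> bool" where
  "visc_subsolution s \<Omega> w g \<longleftrightarrow>
     (\<forall>x N \<phi>. open N \<and> x \<in> N \<and> N \<subseteq> \<Omega> \<and> Ck_closure 2 N \<phi> \<and> \<phi> x = w x \<and> (\<forall>y\<in>N. w y \<le> \<phi> y) \<longrightarrow>
        (\<exists>L. has_frac_laplacian s (\<lambda>y. if y \<in> N then \<phi> y else w y) x L \<and> L \<le> g x))"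

definition visc_supersolution ::
    "real \<Rightarrow> (real^'n::finite) set \<Rightarrow> (real^'n \<Rightarrow> real) \<Rightarrow> (real^'n \<Rightarrow> real) \<Rightarrow> bool" where
  "visc_supersolution s \<Omega> w g \<longleftrightarrow>
     (\<forall>x N \<phi>. open N \<and> x \<in> N \<and> N \<subseteq> \<Omega> \<and> Ck_closure 2 N \<phi> \<and> \<phi> x = w x \<and> (\<forall>y\<in>N. \<phi> y \<le> w y) \<longrightarrow>
        (\<exists>L. has_frac_laplacian s (\<lambda>y. if y \<in> N then \<phi> y else w y) x L \<and> g x \<le> L))"

definition visc_solution ::
    "real \<Rightarrow> (real^'n::finite) set \<Rightarrow> (real^'n \<Rightarrow> real) \<Rightarrow> (real^'n \<Rightarrow> real) \<Rightarrow> bool" where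
  "visc_solution s \<Omega> w g \<longleftrightarrow>
     continuous_on \<Omega> w \<and> visc_subsolution s \<Omega> w g \<and> visc_supersolution s \<Omega> w g"

section \<open>The divergent fractional Laplacian\<close>

definition growth_class :: "real \<Rightarrow> nat \<Rightarrow> (real^'n::finite \<Rightarrow> real) set" where
  "growth_class s k =
     {u. u \<in> borel_measurable lebesgue \<and> continuous_on (ball 0 1) u \<and>
         integrable lebesgue (\<lambda>x. \<bar>u x\<bar> / (1 + norm x powr (real CARD('n) + 2 * s + real k)))}"

text \<open>Polynomials of degree at most \<open>k - 1\<close>; for \<open>k = 0\<close> the sum is empty, hence only the zero
  polynomial.\<close>

definition poly_deg_less :: "nat \<Rightarrow> (real^'n::finite \<Rightarrow> real) \<Rightarrow> bool" where
  "poly_deg_less k P \<longleftrightarrow>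
     (\<exists>c. \<forall>x. P x = (\<Sum>\<alpha> | sum \<alpha> (UNIV :: 'n set) < k. c \<alpha> * (\<Prod>i\<in>UNIV. (x $ i) ^ \<alpha> i)))"

lemma finite_exponents: "finite {\<alpha> :: 'n::finite \<Rightarrow> nat. sum \<alpha> UNIV < k}"
proof (rule finite_subset)
  show "{\<alpha> :: 'n \<Rightarrow> nat. sum \<alpha> UNIV < k} \<subseteq> (UNIV :: 'n set) \<rightarrow>\<^sub>E {..<k}"
  proof
    fix \<alpha> :: "'n \<Rightarrow> nat" assume "\<alpha> \<in> {\<alpha>. sum \<alpha> UNIV < k}"
    moreover have "\<alpha> i \<le> sum \<alpha> UNIV" for i
      by (rule member_le_sum) simp_all
    ultimately have "\<alpha> i < k" for i
      using le_less_trans by blast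
    then show "\<alpha> \<in> (UNIV :: 'n set) \<rightarrow>\<^sub>E {..<k}"
      by (simp add: PiE_UNIV_domain)
  qed
  show "finite ((UNIV :: 'n set) \<rightarrow>\<^sub>E {..<k})"
    by (rule finite_PiE) auto
qed

text \<open>\<open>div_frac_laplacian s k u f\<close>: the equation with divergent fractional Laplacian of \<open>u\<close> and
  right-hand side \<open>f\<close>, modulo polynomials of degree less than \<open>k\<close>, holds in the unit ball.\<close>

definition div_frac_laplacian ::
    "real \<Rightarrow> nat \<Rightarrow> (real^'n::finite \<Rightarrow> real) \<Rightarrow> (real^'n \<Rightarrow> real) \<Rightarrow> bool" where
  "div_frac_laplacian s k u f \<longleftrightarrow>
     u \<in> growth_class s k \<and>
     (\<exists>P fR :: real \<Rightarrow> real^'n \<Rightarrow> real.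
        (\<forall>\<^sub>F R in at_top.
           poly_deg_less k (P R) \<and> fR R \<in> borel_measurable (lebesgue_on (ball 0 1)) \<and>
           visc_solution s (ball 0 1) (\<lambda>x. indicator (ball 0 R) x * u x) (\<lambda>x. fR R x + P R x)) \<and>
        (\<forall>x\<in>ball 0 1. ((\<lambda>R. fR R x) \<longlongrightarrow> f x) at_top))"

end

theory Submission
  imports Defs
begin

text \<open>
  All the freedom lies in the values of \<open>u\<^sub>\<epsilon>\<close> away from \<open>B\<^sub>1\<close>. Write \<open>p = n + 2 * s\<close>. The function is
  built as \<open>u\<^sub>\<epsilon> = w + v + U\<close> from three pieces.

  \<^item> \<open>w\<close> is continuous with compact support, \<open>C\<^sup>2\<close> and \<open>C\<^sup>m\<close> in a neighbourhood of the closed unit ball,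
    and \<open>\<epsilon>\<close>-close to \<open>u\<close> in \<open>C\<^sup>m(B\<^sub>1)\<close> (\<open>C2_approximation_up_to_boundary\<close>,
    \<open>compactly_supported_extension\<close>). The other two pieces vanish in \<open>B\<^sub>2\<close>, so \<open>u\<^sub>\<epsilon> = w\<close> there. Hence
    the right-hand side \<open>F(x, w, \<dots>, D\<^sup>m w)\<close> is settled once \<open>w\<close> is chosen, and both it and the fractional
    Laplacian of \<open>w\<close> are continuous on the closed unit ball.
  \<^item> \<open>v\<close> is integrable, supported in a spherical shell outside \<open>B\<^sub>2\<close>. It leaves \<open>u\<^sub>\<epsilon>\<close> unchanged in \<open>B\<^sub>1\<close> and
    subtracts the potential of \<open>v\<close> with kernel \<open>1 / |x - y|\<^sup>p\<close> from the fractional Laplacian. These potentials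
    are uniformly dense in the continuous functions on the closed unit ball (\<open>far_potentials_dense\<close>), so
    \<open>v\<close> can be chosen to make the equation hold up to \<open>\<epsilon> / 2\<close>.
  \<^item> \<open>U\<close> is \<open>u\<close> outside a ball of large radius \<open>R\<^sub>\<epsilon>\<close>. Expanding the kernel in powers of \<open>x\<close>, the part of degree
    less than \<open>k\<close> contributes polynomials, which the divergent fractional Laplacian disregards, while the
    remainder is of size \<open>1 / |y|\<^sup>p\<^sup>+\<^sup>k\<close>, hence integrable against \<open>u\<close> (\<open>far_field_convergence\<close>).
    Its contribution is at most \<open>\<epsilon> / 2\<close> if \<open>R\<^sub>\<epsilon>\<close> is large.

  So \<open>\<eta>\<^sub>\<epsilon>\<close>, defined as the defect of the equation, is at most \<open>\<epsilon>\<close>.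

  The density rests on the identity \<open>\<Delta> |x - y|\<^sup>-\<^sup>q = q (q + 2 - n) |x - y|\<^sup>-\<^sup>q\<^sup>-\<^sup>2\<close> for the Laplacian in \<open>y\<close>, whose
  factor does not vanish when \<open>q \<ge> p > n\<close>. A closed subspace that contains the kernels with poles outside
  a ball therefore contains all powers \<open>|x - y|\<^sup>-\<^sup>p\<^sup>-\<^sup>2\<^sup>j\<close> (\<open>riesz_lower_mem\<close>), hence by Weierstrass the Gaussians
  centred outside the ball (\<open>gaussian_mem\<close>). Centred at \<open>y0 + y\<close>, they are multiples of one fixed positive
  function times the exponentials \<open>exp (2 * (x \<bullet> y))\<close>, and the exponentials with \<open>y\<close> in the positive
  orthant span an algebra, so Stone--Weierstrass applies (\<open>riesz_kernels_dense\<close>).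

  Since \<open>u\<^sub>\<epsilon>\<close> is \<open>C\<^sup>2\<close> in \<open>B\<^sub>1\<close>, the truncated equations hold classically. They hold in the viscosity sense
  because a test function that touches from one side differs from the solution by a function of one
  sign which is \<open>O(|x - y|\<^sup>2)\<close>, thus integrable against the kernel (\<open>visc_solution_of_classical\<close>).
\<close>

section \<open>Integration of radial weights\<close>

text \<open>
  A layered majorant: a function is integrable if it is bounded by \<open>a j\<close> on balls of
  radius \<open>r j\<close> that exhaust its support and the sum of bound times volume converges.
  With dyadic radii it handles both ends of a power weight.
\<close>
lemma integrable_dyadic_bound:
  fixes h :: "'a::euclidean_space \<Rightarrow> real" and a r :: "nat \<Rightarrow> real"
  assumes h: "h \<in> borel_measurable borel" "\<And>z. 0 \<le> h z"
    and r: "\<And>j. 0 \<le> r j" and a: "\<And>j. 0 \<le> a j"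
    and le: "\<And>z. h z \<noteq> 0 \<Longrightarrow> \<exists>j. z \<in> ball 0 (r j) \<and> h z \<le> a j"
    and sm: "summable (\<lambda>j. a j * r j ^ DIM('a))"
  shows "integrable lborel h"
proof (rule integrableI_bounded)
  show "h \<in> borel_measurable lborel" using h by simp
  have [measurable]: "ball (0::'a) \<rho> \<in> sets borel" for \<rho> by simp
  have dom: "ennreal (a j) * indicator (ball 0 (r j)) z \<le> (\<Sum>j. ennreal (a j) * indicator (ball 0 (r j)) z)"
    for j and z :: 'a
  proof -
    define f where "f j = ennreal (a j) * indicator (ball 0 (r j)) z" for j
    have "sum f {j} \<le> suminf f" by (rule sum_le_suminf) auto
    then have "f j \<le> suminf f" by simp
    then show ?thesis unfolding f_def[abs_def] .
  qed
  have "(\<integral>\<^sup>+ z. ennreal (norm (h z)) \<partial>lborel) \<le> (\<integral>\<^sup>+ (z::'a). (\<Sum>j. ennreal (a j) * indicator (ball 0 (r j)) z) \<partial>lborel)"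
  proof (rule nn_integral_mono)
    fix z :: 'a
    show "ennreal (norm (h z)) \<le> (\<Sum>j. ennreal (a j) * indicator (ball 0 (r j)) z)"
    proof (cases "h z = 0")
      case False
      then obtain j where "z \<in> ball 0 (r j)" "h z \<le> a j" using le by blast
      then have "ennreal (norm (h z)) \<le> ennreal (a j) * indicator (ball 0 (r j)) z"
        using h(2)[of z] by (simp add: ennreal_leI)
      then show ?thesis using dom order_trans by blast
    qed simp
  qed
  also have "\<dots> = (\<Sum>j. (\<integral>\<^sup>+ z. ennreal (a j) * indicator (ball 0 (r j)) z \<partial>(lborel::'a measure)))"
    by (rule nn_integral_suminf) measurable
  also have "\<dots> = (\<Sum>j. ennreal (unit_ball_vol (DIM('a)) * (a j * r j ^ DIM('a))))"
    by (simp add: nn_integral_cmult emeasure_ball r a ennreal_mult'[symmetric] mult_ac)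
  also have "\<dots> = ennreal (\<Sum>j. unit_ball_vol (DIM('a)) * (a j * r j ^ DIM('a)))"
    using sm by (intro suminf_ennreal2 summable_mult) (auto simp: a r)
  also have "\<dots> < \<infinity>" by simp
  finally show "(\<integral>\<^sup>+ z. ennreal (norm (h z)) \<partial>lborel) < \<infinity>" .
qed

lemma dyadic_shell:
  fixes t :: real assumes "1 \<le> t" shows "\<exists>j. 2 ^ j \<le> t \<and> t < 2 ^ Suc j"
proof -
  obtain n where "t < 2 ^ n" using real_arch_pow[of 2 t] by auto
  then have ex: "t < 2 ^ (LEAST n. t < 2 ^ n)" by (rule LeastI)
  have "(LEAST n. t < 2 ^ n) \<noteq> 0" using ex assms by (metis not_le power_0)
  then obtain j where j: "(LEAST n. t < 2 ^ n) = Suc j" using not0_implies_Suc by blast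
  have "\<not> t < 2 ^ j" using not_less_Least[of j "\<lambda>n. t < 2 ^ n"] j by simp
  then have "2 ^ j \<le> t \<and> t < 2 ^ Suc j" using ex j by (metis not_le)
  then show ?thesis by blast
qed

lemma integrable_power_outside:
  fixes p :: real
  assumes p: "real DIM('a) < p"
  shows "integrable lborel (\<lambda>z::'a::euclidean_space. indicator (- ball 0 1) z / norm z powr p)"
proof (rule integrable_dyadic_bound[where a = "\<lambda>j. 2 powr (- p * j)" and r = "\<lambda>j. 2 ^ Suc j"])
  fix z :: 'a assume "indicator (- ball 0 1) z / norm z powr p \<noteq> 0"
  then have z: "1 \<le> norm z" by (auto simp: indicator_def split: if_splits)
  then obtain j where j: "2 ^ j \<le> norm z" "norm z < 2 ^ Suc j" using dyadic_shell by blast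
  have "norm z powr (- p) \<le> (2 ^ j) powr (- p)"
    using j p by (intro powr_mono2') auto
  also have "\<dots> = 2 powr (- p * j)" by (simp add: powr_realpow[symmetric] powr_powr mult.commute)
  finally show "\<exists>j. z \<in> ball 0 (2 ^ Suc j) \<and> indicator (- ball 0 1) z / norm z powr p \<le> 2 powr (- p * j)"
    using j z by (intro exI[of _ j]) (simp add: powr_minus divide_simps)
next
  have "2 powr (- p * j) * (2 ^ Suc j) ^ DIM('a) = 2 ^ DIM('a) * (2 powr (DIM('a) - p)) ^ j" for j :: nat
  proof -
    have "(2::real) powr (- p * j) * (2 ^ Suc j) ^ DIM('a)
        = 2 powr (- p * j) * 2 powr (DIM('a) * (j + 1))"
      by (simp add: powr_realpow[symmetric] powr_powr powr_add algebra_simps)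
    also have "\<dots> = 2 powr (DIM('a) + (DIM('a) - p) * j)"
      by (simp add: powr_add[symmetric] algebra_simps)
    also have "\<dots> = 2 ^ DIM('a) * (2 powr (DIM('a) - p)) ^ j"
      by (simp add: powr_add powr_powr[symmetric] powr_realpow)
    finally show ?thesis .
  qed
  moreover have "summable (\<lambda>j. (2 powr (DIM('a) - p)) ^ j :: real)"
    using p by (intro summable_geometric) (simp add: powr_less_one)
  ultimately show "summable (\<lambda>j. 2 powr (- p * j) * (2 ^ Suc j) ^ DIM('a))"
    by (simp only: summable_mult)
next
  have [measurable]: "ball (0::'a) \<rho> \<in> sets borel" "- ball (0::'a) \<rho> \<in> sets borel" for \<rho> by simp_all
  show "(\<lambda>z::'a. indicator (- ball 0 1) z / norm z powr p) \<in> borel_measurable borel" by measurable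
qed auto

lemma integrable_power_inside:
  fixes p :: real
  assumes p: "0 < p" "p < real DIM('a) + 2"
  shows "integrable lborel (\<lambda>z::'a::euclidean_space. indicator (ball 0 1) z * (norm z)\<^sup>2 / norm z powr p)"
proof (rule integrable_dyadic_bound[where a = "\<lambda>j. 2 powr (p * (real j + 1) - 2 * real j)" and r = "\<lambda>j. 2 / 2 ^ j"])
  fix z :: 'a assume "indicator (ball 0 1) z * (norm z)\<^sup>2 / norm z powr p \<noteq> 0"
  then have z: "0 < norm z" "norm z < 1" by (auto simp: indicator_def split: if_splits)
  then obtain j where j: "2 ^ j \<le> 1 / norm z" "1 / norm z < 2 ^ Suc j" using dyadic_shell[of "1 / norm z"] by auto
  have j': "norm z \<le> 1 / 2 ^ j" "1 / 2 ^ Suc j \<le> norm z"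
    using j z by (auto simp: field_simps)
  have "norm z powr (- p) \<le> (1 / 2 ^ Suc j) powr (- p)"
    using j' p by (intro powr_mono2') auto
  also have "\<dots> = 2 powr (p * (real j + 1))"
    by (simp add: powr_divide powr_minus_divide powr_realpow[symmetric] powr_powr algebra_simps del: power_Suc)
  finally have 1: "norm z powr (- p) \<le> 2 powr (p * (real j + 1))" .
  have "(norm z)\<^sup>2 \<le> (1 / 2 ^ j)\<^sup>2" using j' by (intro power_mono) auto
  also have "\<dots> = 2 powr (- 2 * real j)"
    by (simp add: power_divide powr_minus_divide powr_realpow[symmetric] powr_powr algebra_simps
          flip: powr_numeral)
  finally have 2: "(norm z)\<^sup>2 \<le> 2 powr (- 2 * real j)" .
  have "(norm z)\<^sup>2 * norm z powr (- p) \<le> 2 powr (- 2 * real j) * 2 powr (p * (real j + 1))"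
    using 1 2 by (intro mult_mono) auto
  also have "\<dots> = 2 powr (p * (real j + 1) - 2 * real j)" by (simp add: powr_add[symmetric])
  finally have 3: "(norm z)\<^sup>2 * norm z powr (- p) \<le> 2 powr (p * (real j + 1) - 2 * real j)" .
  have "norm z < 2 / 2 ^ j" using j' by (smt (verit) divide_strict_right_mono zero_less_power)
  then show "\<exists>j. z \<in> ball 0 (2 / 2 ^ j) \<and> indicator (ball 0 1) z * (norm z)\<^sup>2 / norm z powr p \<le> 2 powr (p * (real j + 1) - 2 * real j)"
    using 3 z by (intro exI[of _ j]) (simp add: powr_minus divide_simps)
next
  have "2 powr (p * (real j + 1) - 2 * real j) * (2 / 2 ^ j) ^ DIM('a) = 2 powr (p + DIM('a)) * (2 powr (p - 2 - DIM('a))) ^ j" for j :: nat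
  proof -
    have "((2::real) / 2 ^ j) ^ DIM('a) = 2 powr (DIM('a) * (1 - real j))"
      by (simp add: power_divide powr_realpow[symmetric] powr_powr powr_diff right_diff_distrib mult.commute)
    then have "2 powr (p * (real j + 1) - 2 * real j) * (2 / 2 ^ j) ^ DIM('a)
        = 2 powr (p + DIM('a) + (p - 2 - DIM('a)) * j)"
      by (simp add: powr_add[symmetric] algebra_simps)
    also have "\<dots> = 2 powr (p + DIM('a)) * (2 powr (p - 2 - DIM('a))) ^ j"
      by (simp add: powr_add powr_powr[symmetric] powr_realpow)
    finally show ?thesis .
  qed
  moreover have "summable (\<lambda>j. (2 powr (p - 2 - DIM('a))) ^ j :: real)"
    using p by (intro summable_geometric) (simp add: powr_less_one)
  ultimately show "summable (\<lambda>j. 2 powr (p * (real j + 1) - 2 * real j) * (2 / 2 ^ j) ^ DIM('a))"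
    by (simp only: summable_mult)
next
  have [measurable]: "ball (0::'a) \<rho> \<in> sets borel" "- ball (0::'a) \<rho> \<in> sets borel" for \<rho> by simp_all
  show "(\<lambda>z::'a. indicator (ball 0 1) z * (norm z)\<^sup>2 / norm z powr p) \<in> borel_measurable borel" by measurable
qed auto

definition levy_weight :: "real \<Rightarrow> 'a::euclidean_space \<Rightarrow> real" where
  "levy_weight p z = min 1 ((norm z)\<^sup>2) / norm z powr p"

lemma levy_weight_measurable [measurable]: "levy_weight p \<in> borel_measurable borel"
  unfolding levy_weight_def[abs_def] by measurable

text \<open>
  The factor \<open>|z|\<^sup>2\<close> tames the singularity at the origin since \<open>p < n +
  2\<close>; at infinity \<open>p > n\<close> suffices. All integrands of this development that are
  singular at a point are dominated by this weight.
\<close>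
lemma integrable_levy_weight:
  fixes p :: real
  assumes p: "real DIM('a) < p" "p < real DIM('a) + 2"
  shows "integrable lborel (levy_weight p :: 'a::euclidean_space \<Rightarrow> real)"
proof -
  have "integrable lborel (\<lambda>z::'a. indicator (ball 0 1) z * (norm z)\<^sup>2 / norm z powr p + indicator (- ball 0 1) z / norm z powr p)"
    using p integrable_power_inside[where 'a='a, of p] integrable_power_outside[where 'a='a, of p]
    by (intro Bochner_Integration.integrable_add) auto
  then show ?thesis
  proof (rule back_subst[of "integrable lborel"], intro ext)
    fix z :: 'a
    have "(norm z)\<^sup>2 \<le> 1 \<longleftrightarrow> norm z \<le> 1" by (simp add: power_le_one_iff)
    then show "indicator (ball 0 1) z * (norm z)\<^sup>2 / norm z powr p + indicator (- ball 0 1) z / norm z powr p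
        = levy_weight p z"
      by (cases "norm z < 1") (auto simp: min_def levy_weight_def)
  qed
qed

lemma continuous_on_parametric_integral:
  fixes f :: "'a::metric_space \<Rightarrow> 'b \<Rightarrow> real"
  assumes "\<And>x. x \<in> K \<Longrightarrow> f x \<in> borel_measurable M" "integrable M g"
    and "\<And>x y. x \<in> K \<Longrightarrow> y \<in> space M \<Longrightarrow> \<bar>f x y\<bar> \<le> g y"
    and "\<And>y. y \<in> space M \<Longrightarrow> continuous_on K (\<lambda>x. f x y)"
  shows "continuous_on K (\<lambda>x. LINT y|M. f x y)"
  unfolding continuous_on_sequentially
proof (intro allI impI ballI)
  fix X a assume a: "a \<in> K" and X: "(\<forall>n. X n \<in> K) \<and> X \<longlonglongrightarrow> a"
  show "((\<lambda>x. LINT y|M. f x y) \<circ> X) \<longlonglongrightarrow> (LINT y|M. f a y)"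
    unfolding comp_def
  proof (rule integral_dominated_convergence[where w = g])
    have "(\<lambda>i. f (X i) y) \<longlonglongrightarrow> f a y" if "y \<in> space M" for y
      using assms(4)[OF that] X a unfolding continuous_on_sequentially comp_def by blast
    then show "AE y in M. (\<lambda>i. f (X i) y) \<longlonglongrightarrow> f a y" by (intro AE_I2)
  qed (use assms X a in auto)
qed

section \<open>Partial derivatives and second differences\<close>

lemma partial_cong_open:
  assumes "open S" "x \<in> S" "\<And>y. y \<in> S \<Longrightarrow> f y = g y"
  shows "partial i f x = partial i g x"
proof -
  have "((\<lambda>t. x + t *\<^sub>R axis i 1) \<longlongrightarrow> x + 0 *\<^sub>R axis i (1::real)) (nhds 0)"
    by (intro tendsto_intros filterlim_ident)
  then have "\<forall>\<^sub>F t in nhds 0. x + t *\<^sub>R axis i (1::real) \<in> S"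
    using assms(1,2) by (intro topological_tendstoD[where S=S]) auto
  then have "\<forall>\<^sub>F t in nhds 0. f (x + t *\<^sub>R axis i 1) = g (x + t *\<^sub>R axis i 1)"
    by eventually_elim (rule assms(3))
  then show ?thesis unfolding partial_def by (intro deriv_cong_ev) auto
qed

lemma partials_Nil [simp]: "partials [] f = f" by (simp add: partials_def)
lemma partials_Cons [simp]: "partials (i # \<alpha>) f = partial i (partials \<alpha> f)" by (simp add: partials_def)

lemma partials_cong_open:
  assumes "open S" "\<And>y. y \<in> S \<Longrightarrow> f y = g y"
  shows "x \<in> S \<Longrightarrow> partials \<alpha> f x = partials \<alpha> g x"
proof (induction \<alpha> arbitrary: x)
  case (Cons i \<alpha>)
  then show ?case using partial_cong_open[OF assms(1), of x "partials \<alpha> f" "partials \<alpha> g"] by simp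
qed (use assms in simp)

lemma line_field_differentiable_cong:
  assumes "open S" "x \<in> S" "\<And>y. y \<in> S \<Longrightarrow> f y = g y"
  shows "(\<lambda>t. f (x + t *\<^sub>R axis i 1)) field_differentiable at 0 \<longleftrightarrow>
         (\<lambda>t. g (x + t *\<^sub>R axis i (1::real))) field_differentiable at 0"
proof -
  have "((\<lambda>t. x + t *\<^sub>R axis i 1) \<longlongrightarrow> x + 0 *\<^sub>R axis i (1::real)) (nhds 0)"
    by (intro tendsto_intros filterlim_ident)
  then have "\<forall>\<^sub>F t in nhds 0. x + t *\<^sub>R axis i (1::real) \<in> S"
    using assms(1,2) by (intro topological_tendstoD[where S=S]) auto
  then have "\<forall>\<^sub>F t in nhds 0. f (x + t *\<^sub>R axis i 1) = g (x + t *\<^sub>R axis i 1)"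
    by eventually_elim (rule assms(3))
  then have "((\<lambda>t. f (x + t *\<^sub>R axis i 1)) has_field_derivative D) (at 0) \<longleftrightarrow>
      ((\<lambda>t. g (x + t *\<^sub>R axis i 1)) has_field_derivative D) (at 0)" for D
    by (intro DERIV_cong_ev refl)
  then show ?thesis unfolding field_differentiable_def by simp
qed

lemma Ck_on_cong_open:
  fixes f g :: "real^'n::finite \<Rightarrow> real"
  assumes S: "open S" and eq: "\<And>y. y \<in> S \<Longrightarrow> f y = g y" and f: "Ck_on k S f"
  shows "Ck_on k S g"
proof -
  have *: "partials \<alpha> f y = partials \<alpha> g y" if "y \<in> S" for \<alpha> y
    by (rule partials_cong_open[of S f g]) (simp_all add: S eq that)
  have **: "(\<lambda>t. partials \<alpha> g (x + t *\<^sub>R axis i 1)) field_differentiable at 0"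
    if "x \<in> S" "length \<alpha> < k" for \<alpha> i x
  proof -
    have "(\<lambda>t. partials \<alpha> f (x + t *\<^sub>R axis i 1)) field_differentiable at 0"
      using f that by (simp add: Ck_on_def)
    then show ?thesis
      using line_field_differentiable_cong[of S x "partials \<alpha> f" "partials \<alpha> g" i] S that(1) * by blast
  qed
  have ***: "continuous_on S (partials \<alpha> g)" if "length \<alpha> \<le> k" for \<alpha>
  proof -
    have "continuous_on S (partials \<alpha> f)" using f that by (simp add: Ck_on_def)
    then show ?thesis using continuous_on_cong[of S S "partials \<alpha> f" "partials \<alpha> g"] * by blast
  qed
  show ?thesis unfolding Ck_on_def using ** *** by blast
qed

lemma Ck_on_mono:
  fixes f :: "real^'a::finite \<Rightarrow> real"
  assumes "Ck_on k S f" "k' \<le> k" "S' \<subseteq> S"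
  shows "Ck_on k' S' f"
  unfolding Ck_on_def
proof (intro conjI allI impI ballI)
  fix \<alpha> :: "'a list" assume "length \<alpha> \<le> k'"
  then have "continuous_on S (partials \<alpha> f)" using assms by (simp add: Ck_on_def)
  then show "continuous_on S' (partials \<alpha> f)" using assms(3) by (rule continuous_on_subset)
qed (use assms in \<open>auto simp: Ck_on_def\<close>)

lemma Ck_on_partial_has_derivative:
  assumes "Ck_on k S f" "length \<alpha> < k" "y \<in> S"
  shows "((\<lambda>t. partials \<alpha> f (y + t *\<^sub>R axis i 1)) has_real_derivative partials (i # \<alpha>) f y) (at 0)"
  using assms by (simp add: Ck_on_def partial_def field_differentiable_derivI)

text \<open>
  The increment is telescoped along the coordinate directions: changing one coordinate at a time,
  the mean value inequality compares each step with the partial derivative at \<open>x\<close>.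
\<close>
lemma has_derivative_of_continuous_partials:
  fixes f :: "real^'n::finite \<Rightarrow> real"
  assumes S: "open S" "x \<in> S"
    and D: "\<And>i y. y \<in> S \<Longrightarrow> ((\<lambda>t. f (y + t *\<^sub>R axis i 1)) has_real_derivative D i y) (at 0)"
    and cont: "\<And>i. continuous_on S (D i)"
  shows "(f has_derivative (\<lambda>h. \<Sum>i\<in>UNIV. h $ i * D i x)) (at x)"
  unfolding has_derivative_at_alt
proof (intro conjI allI impI)
  show "bounded_linear (\<lambda>h. \<Sum>i\<in>UNIV. h $ i * D i x)"
    by (intro bounded_linear_sum bounded_linear_mult_const bounded_linear_vec_nth)
next
  fix e :: real assume e: "e > 0"
  define e' where "e' = e / CARD('n)"
  have e': "e' > 0" using e by (simp add: e'_def)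
  have "\<forall>i. \<exists>d>0. \<forall>y\<in>ball x d. y \<in> S \<and> \<bar>D i y - D i x\<bar> \<le> e'"
  proof
    fix i
    have "continuous (at x) (D i)" using cont S by (simp add: continuous_on_eq_continuous_at)
    then have "\<forall>\<^sub>F y in nhds x. dist (D i y) (D i x) < e'"
      using e' by (simp add: continuous_at tendstoD tendsto_at_iff_tendsto_nhds)
    moreover have "\<forall>\<^sub>F y in nhds x. y \<in> S" using S by (simp add: eventually_nhds_in_open)
    ultimately have "\<forall>\<^sub>F y in nhds x. y \<in> S \<and> \<bar>D i y - D i x\<bar> \<le> e'"
      by eventually_elim (auto simp: dist_real_def)
    then show "\<exists>d>0. \<forall>y\<in>ball x d. y \<in> S \<and> \<bar>D i y - D i x\<bar> \<le> e'"
      by (auto simp: eventually_nhds_metric dist_commute)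
  qed
  then obtain d where d: "\<And>i. d i > 0" "\<And>i y. y \<in> ball x (d i) \<Longrightarrow> y \<in> S \<and> \<bar>D i y - D i x\<bar> \<le> e'"
    by metis
  define \<delta> where "\<delta> = Min (range d)"
  have \<delta>: "\<delta> > 0" "\<And>i. \<delta> \<le> d i" using d by (auto simp: \<delta>_def)
  have \<delta>D: "y \<in> S" "\<bar>D i y - D i x\<bar> \<le> e'" if "dist x y < \<delta>" for i y
    using that d(2)[of y i] \<delta>(2)[of i] by auto
  show "\<exists>d>0. \<forall>y. norm (y - x) < d \<longrightarrow>
      norm (f y - f x - (\<Sum>i\<in>UNIV. (y - x) $ i * D i x)) \<le> e * norm (y - x)"
  proof (intro exI conjI allI impI)
    show "\<delta> > 0" by fact
    fix y assume y: "norm (y - x) < \<delta>"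
    define h where "h = y - x"
    \<comment> \<open>\<open>x\<close> with the coordinates in \<open>A\<close> moved by \<open>h\<close>\<close>
    define q where "q A = x + (\<chi> i. if i \<in> A then h $ i else 0)" for A
    have "\<bar>f (q A) - f x - (\<Sum>i\<in>A. h $ i * D i x)\<bar> \<le> e' * (\<Sum>i\<in>A. \<bar>h $ i\<bar>)" if "finite A" for A
      using that
    proof (induction A rule: finite_induct)
      case empty
      have "q {} = x" by (simp add: q_def vec_eq_iff)
      then show ?case by simp
    next
      case (insert i A)
      define g where "g t = f (q A + t *\<^sub>R axis i 1) - t * D i x" for t
      have qi: "q (insert i A) = q A + (h $ i) *\<^sub>R axis i 1"
        using insert by (auto simp: q_def vec_eq_iff axis_def)
      have near: "dist x (q A + t *\<^sub>R axis i 1) < \<delta>" if "t \<in> closed_segment 0 (h $ i)" for t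
      proof -
        have t: "\<bar>t\<bar> \<le> \<bar>h $ i\<bar>" using that by (auto simp: closed_segment_eq_real_ivl split: if_splits)
        have "norm (q A + t *\<^sub>R axis i 1 - x) \<le> norm h"
        proof (rule norm_le_componentwise_cart)
          fix j show "norm ((q A + t *\<^sub>R axis i 1 - x) $ j) \<le> norm (h $ j)"
            using t insert(2) by (auto simp: q_def axis_def)
        qed
        then show ?thesis using y by (simp add: h_def dist_norm norm_minus_commute)
      qed
      have der: "(g has_field_derivative D i (q A + t *\<^sub>R axis i 1) - D i x) (at t within closed_segment 0 (h $ i))"
        if "t \<in> closed_segment 0 (h $ i)" for t
      proof -
        have "((\<lambda>r. f ((q A + t *\<^sub>R axis i 1) + r *\<^sub>R axis i 1)) has_real_derivative D i (q A + t *\<^sub>R axis i 1)) (at 0)"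
          using D \<delta>D(1)[OF near[OF that]] by blast
        then have "((\<lambda>r. f (q A + (r + t) *\<^sub>R axis i 1)) has_real_derivative D i (q A + t *\<^sub>R axis i 1)) (at 0)"
          by (simp add: algebra_simps)
        then have "((\<lambda>r. f (q A + r *\<^sub>R axis i 1)) has_real_derivative D i (q A + t *\<^sub>R axis i 1)) (at t)"
          using DERIV_shift[of "\<lambda>r. f (q A + r *\<^sub>R axis i 1)" _ 0 t] by simp
        from DERIV_diff[OF this DERIV_cmult_right[OF DERIV_ident, of "D i x"]]
        show ?thesis unfolding g_def by (simp add: has_field_derivative_at_within)
      qed
      have "norm (g (h $ i) - g 0) \<le> e' * norm (h $ i - 0)"
        by (rule field_differentiable_bound[OF _ der]) (use \<delta>D(2)[OF near] in auto)
      then have "\<bar>f (q (insert i A)) - f (q A) - h $ i * D i x\<bar> \<le> e' * \<bar>h $ i\<bar>"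
        by (simp add: g_def qi algebra_simps)
      then show ?case using insert by (simp add: algebra_simps)
    qed
    moreover have "q UNIV = y" by (simp add: q_def h_def vec_eq_iff)
    ultimately have "\<bar>f y - f x - (\<Sum>i\<in>UNIV. h $ i * D i x)\<bar> \<le> e' * (\<Sum>i\<in>UNIV. \<bar>h $ i\<bar>)"
      by (metis finite)
    also have "\<dots> \<le> e' * (CARD('n) * norm h)"
      using sum_bounded_above[of UNIV "\<lambda>i. \<bar>h $ i\<bar>" "norm h"] e'
      by (intro mult_left_mono) (auto simp: component_le_norm_cart)
    finally show "norm (f y - f x - (\<Sum>i\<in>UNIV. (y - x) $ i * D i x)) \<le> e * norm (y - x)"
      by (simp add: h_def e'_def)
  qed
qed

lemma Ck_on_directional_derivative:
  assumes S: "open S" and C: "Ck_on k S f" "length \<alpha> < k" and z: "x + t *\<^sub>R z \<in> S"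
  shows "((\<lambda>t. partials \<alpha> f (x + t *\<^sub>R z)) has_real_derivative
           (\<Sum>i\<in>UNIV. z $ i * partials (i # \<alpha>) f (x + t *\<^sub>R z))) (at t)"
proof -
  have "(partials \<alpha> f has_derivative (\<lambda>h. \<Sum>i\<in>UNIV. h $ i * partials (i # \<alpha>) f (x + t *\<^sub>R z))) (at (x + t *\<^sub>R z))"
  proof (rule has_derivative_of_continuous_partials[OF S z])
    show "continuous_on S (partials (i # \<alpha>) f)" for i
      using C unfolding Ck_on_def by (metis Suc_leI length_Cons)
  qed (rule Ck_on_partial_has_derivative[OF C])
  moreover have "((\<lambda>t. x + t *\<^sub>R z) has_derivative (\<lambda>t. t *\<^sub>R z)) (at t)"
    by (auto intro!: derivative_eq_intros)
  ultimately have "((\<lambda>t. partials \<alpha> f (x + t *\<^sub>R z)) has_derivative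
      (\<lambda>r. \<Sum>i\<in>UNIV. (r *\<^sub>R z) $ i * partials (i # \<alpha>) f (x + t *\<^sub>R z))) (at t)"
    by (rule has_derivative_compose[rotated])
  then show ?thesis
    unfolding has_field_derivative_def
    by (rule has_derivative_eq_rhs) (simp add: fun_eq_iff sum_distrib_left sum_distrib_right mult_ac)
qed

abbreviation second_difference :: "('a::real_vector \<Rightarrow> real) \<Rightarrow> 'a \<Rightarrow> 'a \<Rightarrow> real" where
  "second_difference w x z \<equiv> 2 * w x - w (x + z) - w (x - z)"

text \<open>
  Along the line through \<open>x\<close> in direction \<open>z\<close>, the symmetric second
  difference has a derivative that is itself a difference of first derivatives, so the mean value
  inequality applies twice.
\<close>
lemma second_difference_bound:
  fixes \<phi> :: "real^'n::finite \<Rightarrow> real"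
  assumes S: "open S" "convex S" and C: "Ck_on 2 S \<phi>"
    and M: "\<And>i j y. y \<in> S \<Longrightarrow> \<bar>partials [j, i] \<phi> y\<bar> \<le> M"
    and x: "x + z \<in> S" "x - z \<in> S"
  shows "\<bar>second_difference \<phi> x z\<bar> \<le> 2 * (real CARD('n))\<^sup>2 * M * (norm z)\<^sup>2"
proof -
  have seg: "x + t *\<^sub>R z \<in> S" if "\<bar>t\<bar> \<le> 1" for t
  proof -
    have "x + t *\<^sub>R z = ((1 + t) / 2) *\<^sub>R (x + z) + ((1 - t) / 2) *\<^sub>R (x - z)"
      by (simp add: vec_eq_iff field_simps)
    also have "\<dots> \<in> S" by (rule convexD[OF S(2) x]) (use that in \<open>auto simp: field_simps\<close>)
    finally show ?thesis .
  qed
  have M0: "0 \<le> M" using M[OF x(1)] by (meson abs_ge_zero order_trans)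
  have comp: "\<bar>\<Sum>i\<in>UNIV. z $ i * b i\<bar> \<le> CARD('n) * (norm z * B)" if "\<And>i. \<bar>b i\<bar> \<le> B" for b :: "'n \<Rightarrow> real" and B
  proof -
    have "\<bar>\<Sum>i\<in>UNIV. z $ i * b i\<bar> \<le> (\<Sum>i\<in>UNIV. \<bar>z $ i * b i\<bar>)" by (rule sum_abs)
    also have "\<dots> \<le> (\<Sum>i\<in>(UNIV::'n set). norm z * B)"
      using that by (intro sum_mono) (auto simp: abs_mult intro!: mult_mono component_le_norm_cart)
    finally show ?thesis by simp
  qed
  have grad: "\<bar>partials [i] \<phi> (x + t *\<^sub>R z) - partials [i] \<phi> (x - t *\<^sub>R z)\<bar> \<le> CARD('n) * (norm z * M) * 2"
    if t: "0 \<le> t" "t \<le> 1" for t i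
  proof -
    have "norm (partials [i] \<phi> (x + t *\<^sub>R z) - partials [i] \<phi> (x + (- t) *\<^sub>R z)) \<le> CARD('n) * (norm z * M) * norm (t - (- t))"
    proof (rule field_differentiable_bound[where S = "{-1..1}"
          and f' = "\<lambda>t. \<Sum>j\<in>UNIV. z $ j * partials [j, i] \<phi> (x + t *\<^sub>R z)" and f = "\<lambda>t. partials [i] \<phi> (x + t *\<^sub>R z)"])
      fix r :: real assume "r \<in> {-1..1}"
      then have r: "x + r *\<^sub>R z \<in> S" by (intro seg) auto
      show "((\<lambda>t. partials [i] \<phi> (x + t *\<^sub>R z)) has_real_derivative
           (\<Sum>j\<in>UNIV. z $ j * partials [j, i] \<phi> (x + r *\<^sub>R z))) (at r within {-1..1})"
        by (rule DERIV_subset[OF Ck_on_directional_derivative[OF S(1) C _ r]]) auto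
      show "norm (\<Sum>j\<in>UNIV. z $ j * partials [j, i] \<phi> (x + r *\<^sub>R z)) \<le> CARD('n) * (norm z * M)"
        unfolding real_norm_def by (rule comp) (rule M[OF r])
    qed (use t in auto)
    also have "\<dots> \<le> CARD('n) * (norm z * M) * 2" using t M0 by (intro mult_left_mono) auto
    finally show ?thesis by simp
  qed
  have "norm ((\<phi> (x + 1 *\<^sub>R z) + \<phi> (x + 1 *\<^sub>R (- z))) - (\<phi> (x + 0 *\<^sub>R z) + \<phi> (x + 0 *\<^sub>R (- z))))
      \<le> CARD('n) * (norm z * (CARD('n) * (norm z * M) * 2)) * norm (1 - 0 :: real)"
  proof (rule field_differentiable_bound[where S = "{0..1}"
        and f' = "\<lambda>t. \<Sum>i\<in>UNIV. z $ i * (partials [i] \<phi> (x + t *\<^sub>R z) - partials [i] \<phi> (x - t *\<^sub>R z))"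
        and f = "\<lambda>t. \<phi> (x + t *\<^sub>R z) + \<phi> (x + t *\<^sub>R (- z))"])
    fix r :: real assume r: "r \<in> {0..1}"
    then have "x + r *\<^sub>R z \<in> S" "x + r *\<^sub>R (- z) \<in> S" using seg[of r] seg[of "- r"] by auto
    note * = this[THEN Ck_on_directional_derivative[OF S(1) C, of "[]", simplified]]
    have "((\<lambda>t. \<phi> (x + t *\<^sub>R z) + \<phi> (x + t *\<^sub>R (- z))) has_real_derivative
         (\<Sum>i\<in>UNIV. z $ i * (partials [i] \<phi> (x + r *\<^sub>R z) - partials [i] \<phi> (x - r *\<^sub>R z)))) (at r)"
      using DERIV_add[OF *] by (simp add: sum.distrib[symmetric] right_diff_distrib)
    then show "((\<lambda>t. \<phi> (x + t *\<^sub>R z) + \<phi> (x + t *\<^sub>R (- z))) has_real_derivative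
         (\<Sum>i\<in>UNIV. z $ i * (partials [i] \<phi> (x + r *\<^sub>R z) - partials [i] \<phi> (x - r *\<^sub>R z)))) (at r within {0..1})"
      by (rule DERIV_subset) auto
    show "norm (\<Sum>i\<in>UNIV. z $ i * (partials [i] \<phi> (x + r *\<^sub>R z) - partials [i] \<phi> (x - r *\<^sub>R z)))
        \<le> CARD('n) * (norm z * (CARD('n) * (norm z * M) * 2))"
      unfolding real_norm_def by (rule comp) (use r grad in auto)
  qed auto
  then show ?thesis by (simp add: power2_eq_square mult_ac abs_minus_commute algebra_simps)
qed

lemma Ck_on_second_difference_compact:
  fixes \<phi> :: "real^'n::finite \<Rightarrow> real"
  assumes C: "Ck_on 2 S \<phi>" and K: "cball a r \<subseteq> S"
  obtains M where "0 \<le> M"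
    "\<And>x z. x + z \<in> ball a r \<Longrightarrow> x - z \<in> ball a r \<Longrightarrow> \<bar>second_difference \<phi> x z\<bar> \<le> M * (norm z)\<^sup>2"
proof -
  have "\<exists>B. \<forall>y\<in>cball a r. \<bar>partials [j, i] \<phi> y\<bar> \<le> B" for i j
  proof -
    have "continuous_on (cball a r) (partials [j, i] \<phi>)"
      using C K unfolding Ck_on_def by (metis (no_types) One_nat_def Suc_1 continuous_on_subset length_Cons list.size(3) order_refl)
    then have "bounded (partials [j, i] \<phi> ` cball a r)"
      by (intro compact_imp_bounded compact_continuous_image) auto
    then show ?thesis by (auto simp: bounded_iff)
  qed
  then have "\<exists>B. \<forall>i j. \<forall>y\<in>cball a r. \<bar>partials [j, i] \<phi> y\<bar> \<le> B i j"
    by (intro choice allI)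
  then obtain B where B: "\<And>i j y. y \<in> cball a r \<Longrightarrow> \<bar>partials [j, i] \<phi> y\<bar> \<le> B i j" by blast
  define M where "M = (\<Sum>i\<in>UNIV. \<Sum>j\<in>UNIV. \<bar>B i j\<bar>)"
  have BM: "B i j \<le> M" for i j
  proof -
    have "B i j \<le> (\<Sum>j\<in>UNIV. \<bar>B i j\<bar>)"
      using member_le_sum[of j UNIV "\<lambda>j. \<bar>B i j\<bar>"] by simp
    also have "\<dots> \<le> M" unfolding M_def
      using member_le_sum[of i UNIV "\<lambda>i. \<Sum>j\<in>UNIV. \<bar>B i j\<bar>"] by (simp add: sum_nonneg)
    finally show ?thesis .
  qed
  show ?thesis
  proof (rule that[of "2 * (real CARD('n))\<^sup>2 * M"])
    show "0 \<le> 2 * (real CARD('n))\<^sup>2 * M" by (simp add: M_def sum_nonneg)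
    fix x z assume xz: "x + z \<in> ball a r" "x - z \<in> ball a r"
    have C': "Ck_on 2 (ball a r) \<phi>" by (rule Ck_on_mono[OF C]) (use K ball_subset_cball in auto)
    show "\<bar>second_difference \<phi> x z\<bar> \<le> 2 * (real CARD('n))\<^sup>2 * M * (norm z)\<^sup>2"
    proof (rule second_difference_bound[OF _ _ C' _ xz])
      fix i j y assume "y \<in> ball a r"
      then show "\<bar>partials [j, i] \<phi> y\<bar> \<le> M" using B[of y j i] BM[of i j] by auto
    qed auto
  qed
qed

section \<open>The pointwise fractional Laplacian and viscosity solutions\<close>

text \<open>
  For an integrable function the principal value is the integral, since a single point is a null
  set.
\<close>
lemma tendsto_integral_compl_ball:
  fixes H :: "'a::euclidean_space \<Rightarrow> real"
  assumes H: "integrable lebesgue H"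
  shows "((\<lambda>\<rho>. LINT y:- ball x \<rho>|lebesgue. H y) \<longlongrightarrow> (LINT y|lebesgue. H y)) (at_right 0)"
  unfolding tendsto_at_iff_sequentially
proof (intro allI impI)
  fix X :: "nat \<Rightarrow> real" assume X: "\<forall>i. X i \<in> {0<..} - {0}" "X \<longlonglongrightarrow> 0"
  show "((\<lambda>\<rho>. LINT y:- ball x \<rho>|lebesgue. H y) \<circ> X) \<longlonglongrightarrow> (LINT y|lebesgue. H y)"
    unfolding comp_def set_lebesgue_integral_def
  proof (rule integral_dominated_convergence[where w = "\<lambda>y. norm (H y)"])
    have "AE y in lborel. y \<noteq> x" by (rule AE_lborel_singleton)
    then have "AE y in lebesgue. y \<noteq> x" by (rule AE_completion)
    then show "AE y in lebesgue. (\<lambda>i. indicator (- ball x (X i)) y *\<^sub>R H y) \<longlonglongrightarrow> H y"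
    proof eventually_elim
      case (elim y)
      then have "\<forall>\<^sub>F i in sequentially. X i < dist x y"
        using order_tendstoD(2)[OF X(2), of "dist x y"] by simp
      then have "\<forall>\<^sub>F i in sequentially. indicator (- ball x (X i)) y *\<^sub>R H y = H y"
        by eventually_elim simp
      then show ?case by (rule tendsto_eventually)
    qed
    show "(\<lambda>y. indicator (- ball x (X i)) y *\<^sub>R H y) \<in> borel_measurable lebesgue" for i
      using H by (intro borel_measurable_scaleR borel_measurable_indicator) auto
  qed (use H in \<open>auto simp: indicator_def\<close>)
qed

text \<open>
  For translations (\<open>c = 1\<close>) and reflections (\<open>c = -1\<close>).
\<close>
lemma lborel_distr_isometry:
  assumes "\<bar>c\<bar> = 1"
  shows "distr lborel borel (\<lambda>z::'a::euclidean_space. t + c *\<^sub>R z) = lborel"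
proof -
  have "c \<noteq> 0" using assms by auto
  from lborel_affine[OF this, of t] assms show ?thesis by (simp add: density_1)
qed

lemma
  fixes f :: "'a::euclidean_space \<Rightarrow> real"
  assumes c: "\<bar>c\<bar> = 1" and f: "f \<in> borel_measurable borel"
  shows lborel_integral_isometry: "(LINT z|lborel. f (t + c *\<^sub>R z)) = (LINT z|lborel. f z)"
    and lborel_integrable_isometry: "integrable lborel (\<lambda>z. f (t + c *\<^sub>R z)) \<longleftrightarrow> integrable lborel f"
proof -
  have m: "(\<lambda>z::'a. t + c *\<^sub>R z) \<in> borel_measurable lborel" by simp
  show "(LINT z|lborel. f (t + c *\<^sub>R z)) = (LINT z|lborel. f z)"
    using integral_distr[OF m f] by (simp add: lborel_distr_isometry[OF c])
  show "integrable lborel (\<lambda>z. f (t + c *\<^sub>R z)) \<longleftrightarrow> integrable lborel f"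
    using integrable_distr_eq[OF m f] by (simp add: lborel_distr_isometry[OF c])
qed

lemma integrable_levy_weight_shift:
  assumes "real DIM('a) < p" "p < real DIM('a) + 2"
  shows "integrable lborel (\<lambda>y::'a::euclidean_space. levy_weight p (x - y))"
  using lborel_integrable_isometry[of "-1" "levy_weight p :: 'a \<Rightarrow> real" x] integrable_levy_weight[OF assms]
  by simp

text \<open>
  A bounded function that is quadratically small near the origin is dominated, after division by the
  kernel, by the weight above. The cases inside and outside the ball of radius \<open>d\<close>
  share one constant.
\<close>
lemma le_levy_weight:
  fixes a B M d :: real
  assumes "0 < d" "0 \<le> M" "a \<le> B" "norm z < d \<Longrightarrow> a \<le> M * (norm z)\<^sup>2" "0 \<le> B"
  shows "a / norm z powr p \<le> (M + B) / min 1 (d\<^sup>2) * levy_weight p z"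
proof -
  have "a \<le> (M + B) / min 1 (d\<^sup>2) * min 1 ((norm z)\<^sup>2)"
  proof (cases "norm z < d")
    case True
    have "a \<le> (M + B) * min 1 ((norm z)\<^sup>2)"
    proof (cases "(norm z)\<^sup>2 \<le> 1")
      case True
      have "M * (norm z)\<^sup>2 \<le> (M + B) * (norm z)\<^sup>2" using assms by (intro mult_right_mono) auto
      then show ?thesis using assms \<open>norm z < d\<close> True by (simp add: min_def)
    qed (use assms in \<open>auto simp: min_def\<close>)
    also have "\<dots> \<le> (M + B) * min 1 ((norm z)\<^sup>2) / min 1 (d\<^sup>2)"
      using assms by (simp add: le_divide_eq mult_left_le)
    finally show ?thesis by simp
  next
    case False
    then have "d\<^sup>2 \<le> (norm z)\<^sup>2" using assms by (intro power_mono) auto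
    then have "min 1 (d\<^sup>2) \<le> min 1 ((norm z)\<^sup>2)" by auto
    moreover have "0 < min 1 (d\<^sup>2)" using assms by simp
    ultimately have "1 \<le> min 1 ((norm z)\<^sup>2) / min 1 (d\<^sup>2)" by simp
    then have "(M + B) * 1 \<le> (M + B) * (min 1 ((norm z)\<^sup>2) / min 1 (d\<^sup>2))"
      using assms by (intro mult_left_mono) auto
    then show ?thesis using assms by simp
  qed
  then show ?thesis unfolding levy_weight_def times_divide_eq_right
    by (rule divide_right_mono) simp
qed

text \<open>
  A perturbation that vanishes at \<open>x\<close> and is integrable against the kernel shifts the
  fractional Laplacian by an absolutely convergent integral. This serves both the exterior pieces of
  the solution and the test functions of the viscosity definition.
\<close>
lemma has_frac_laplacian_add_integrable:
  fixes w :: "real^'n::finite \<Rightarrow> real"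
  assumes w: "has_frac_laplacian s w x L" and "\<psi> x = 0"
    and int: "integrable lebesgue (\<lambda>y. \<psi> y / norm (x - y) powr (real CARD('n) + 2 * s))"
  shows "has_frac_laplacian s (\<lambda>y. w y + \<psi> y) x
           (L - (LINT y|lebesgue. \<psi> y / norm (x - y) powr (real CARD('n) + 2 * s)))"
proof -
  let ?K = "\<lambda>y. norm (x - y) powr (real CARD('n) + 2 * s)"
  have eq: "(w x + \<psi> x - (w y + \<psi> y)) / ?K y = (w x - w y) / ?K y - \<psi> y / ?K y" for y
    using \<open>\<psi> x = 0\<close> by (simp add: diff_divide_distrib add_divide_distrib)
  have 1: "set_integrable lebesgue (- ball x \<rho>) (\<lambda>y. (w x - w y) / ?K y)" if "\<rho> > 0" for \<rho>
    using w that by (simp add: has_frac_laplacian_def)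
  have 2: "set_integrable lebesgue (- ball x \<rho>) (\<lambda>y. \<psi> y / ?K y)" for \<rho>
    using int unfolding set_integrable_def
    by (intro integrable_mult_indicator) auto
  show ?thesis
    unfolding has_frac_laplacian_def eq
  proof (intro conjI allI impI)
    fix \<rho> :: real assume "\<rho> > 0"
    then show "set_integrable lebesgue (- ball x \<rho>) (\<lambda>y. (w x - w y) / ?K y - \<psi> y / ?K y)"
      by (intro set_integral_diff 1 2)
  next
    have "((\<lambda>\<rho>. (LINT y:- ball x \<rho>|lebesgue. (w x - w y) / ?K y) - (LINT y:- ball x \<rho>|lebesgue. \<psi> y / ?K y))
        \<longlongrightarrow> L - (LINT y|lebesgue. \<psi> y / ?K y)) (at_right 0)"
      using w by (intro tendsto_diff tendsto_integral_compl_ball int) (simp add: has_frac_laplacian_def)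
    then show "((\<lambda>\<rho>. LINT y:- ball x \<rho>|lebesgue. (w x - w y) / ?K y - \<psi> y / ?K y)
        \<longlongrightarrow> L - (LINT y|lebesgue. \<psi> y / ?K y)) (at_right 0)"
    proof (rule Lim_transform_eventually)
      show "\<forall>\<^sub>F \<rho> in at_right 0. (LINT y:- ball x \<rho>|lebesgue. (w x - w y) / ?K y) - (LINT y:- ball x \<rho>|lebesgue. \<psi> y / ?K y)
          = (LINT y:- ball x \<rho>|lebesgue. (w x - w y) / ?K y - \<psi> y / ?K y)"
        using eventually_at_right_less[of 0] by eventually_elim (rule set_integral_diff(2)[OF 1 2, symmetric])
    qed
  qed
qed

text \<open>
  Off a ball around \<open>x\<close> the integrals of \<open>w x - w (x + z)\<close> and \<open>w x
  - w (x - z)\<close> against the kernel agree by reflection. Averaging them produces a second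
  difference, which is integrable up to the origin, so the principal value exists as an ordinary
  integral.
\<close>
lemma has_frac_laplacian_second_difference:
  fixes w :: "real^'n::finite \<Rightarrow> real" and s :: real
  defines "p \<equiv> real CARD('n) + 2 * s"
  assumes s: "0 < s" "s < 1"
    and w: "w \<in> borel_measurable borel" "\<And>y. \<bar>w y\<bar> \<le> B"
    and d: "0 < d" "0 \<le> M" "\<And>z. norm z < d \<Longrightarrow> \<bar>second_difference w x z\<bar> \<le> M * (norm z)\<^sup>2"
  shows "has_frac_laplacian s w x (LINT z|lborel. second_difference w x z / (2 * norm z powr p))"
proof -
  have p: "real DIM(real^'n) < p" "p < real DIM(real^'n) + 2" using s by (auto simp: p_def)
  have B: "0 \<le> B" using w(2)[of x] by simp
  note [measurable] = w(1)
  have [measurable]: "ball (a::real^'n) \<rho> \<in> sets borel" "- ball (a::real^'n) \<rho> \<in> sets borel" for \<rho> a by simp_all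
  define g where "g z = (w x - w (x + z)) / norm z powr p" for z
  have g [measurable]: "g \<in> borel_measurable borel" unfolding g_def[abs_def] by measurable
  have gint: "integrable lborel (\<lambda>z. indicator (- ball 0 \<rho>) z * g z)" if "\<rho> > 0" for \<rho>
  proof (rule Bochner_Integration.integrable_bound)
    show "integrable lborel (\<lambda>z::real^'n. (0 + 2 * B) / min 1 (\<rho>\<^sup>2) * levy_weight p z)"
      by (intro integrable_mult_right integrable_levy_weight p)
    show "AE z in lborel. norm (indicator (- ball 0 \<rho>) z * g z) \<le> norm ((0 + 2 * B) / min 1 (\<rho>\<^sup>2) * levy_weight p z)"
    proof (rule AE_I2)
      fix z :: "real^'n"
      have "\<bar>w x - w (x + z)\<bar> \<le> 2 * B" using w(2)[of x] w(2)[of "x + z"] by linarith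
      then have "\<bar>indicator (- ball 0 \<rho>) z * (w x - w (x + z))\<bar> / norm z powr p \<le> (0 + 2 * B) / min 1 (\<rho>\<^sup>2) * levy_weight p z"
        by (intro le_levy_weight) (use that B in \<open>auto simp: indicator_def\<close>)
      then have "norm (indicator (- ball 0 \<rho>) z * g z) \<le> (0 + 2 * B) / min 1 (\<rho>\<^sup>2) * levy_weight p z"
        by (simp add: g_def abs_mult)
      also have "\<dots> \<le> norm ((0 + 2 * B) / min 1 (\<rho>\<^sup>2) * levy_weight p z)"
        by (simp only: real_norm_def abs_ge_self)
      finally show "norm (indicator (- ball 0 \<rho>) z * g z) \<le> norm ((0 + 2 * B) / min 1 (\<rho>\<^sup>2) * levy_weight p z)" .
    qed
  qed measurable
  define H where "H z = second_difference w x z / (2 * norm z powr p)" for z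
  have H [measurable]: "H \<in> borel_measurable borel" unfolding H_def[abs_def] by measurable
  have Hint: "integrable lborel H"
  proof (rule Bochner_Integration.integrable_bound)
    show "integrable lborel (\<lambda>z::real^'n. (M + 4 * B) / min 1 (d\<^sup>2) * levy_weight p z)"
      by (intro integrable_mult_right integrable_levy_weight p)
    show "AE z in lborel. norm (H z) \<le> norm ((M + 4 * B) / min 1 (d\<^sup>2) * levy_weight p z)"
    proof (rule AE_I2)
      fix z :: "real^'n"
      have "\<bar>second_difference w x z\<bar> \<le> 4 * B" using w(2)[of x] w(2)[of "x + z"] w(2)[of "x - z"] by linarith
      then have "\<bar>second_difference w x z\<bar> / norm z powr p \<le> (M + 4 * B) / min 1 (d\<^sup>2) * levy_weight p z"
        by (intro le_levy_weight) (use d B in auto)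
      moreover have "norm (H z) \<le> \<bar>second_difference w x z\<bar> / norm z powr p"
        by (simp add: H_def abs_mult divide_simps)
      ultimately show "norm (H z) \<le> norm ((M + 4 * B) / min 1 (d\<^sup>2) * levy_weight p z)"
        by (smt (verit) real_norm_def)
    qed
  qed measurable
  define F where "F y = (w x - w y) / norm (x - y) powr p" for y
  have F [measurable]: "F \<in> borel_measurable borel" unfolding F_def[abs_def] by measurable
  have Fg: "indicator (- ball x \<rho>) (x + 1 *\<^sub>R z) * F (x + 1 *\<^sub>R z) = indicator (- ball 0 \<rho>) z * g z" for \<rho> z
    by (simp add: F_def g_def indicator_def dist_norm)
  have Fm: "(\<lambda>y. indicator (- ball x \<rho>) y * F y) \<in> borel_measurable borel" for \<rho> by measurable
  have FI: "integrable lborel (\<lambda>y. indicator (- ball x \<rho>) y * F y)" if "\<rho> > 0" for \<rho>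
    using gint[OF that] lborel_integrable_isometry[OF _ Fm, of 1 \<rho> x] by (simp only: Fg abs_one)
  have Feq: "(LINT y:- ball x \<rho>|lebesgue. F y) = (LINT z:- ball 0 \<rho>|lebesgue. H z)" if "\<rho> > 0" for \<rho>
  proof -
    have "(LINT y:- ball x \<rho>|lebesgue. F y) = (LINT y|lborel. indicator (- ball x \<rho>) y * F y)"
      unfolding set_lebesgue_integral_def real_scaleR_def by (rule integral_completion) measurable
    also have "\<dots> = (LINT z|lborel. indicator (- ball 0 \<rho>) z * g z)"
      using lborel_integral_isometry[OF _ Fm, of 1 \<rho> x] by (simp only: Fg abs_one)
    finally have 1: "(LINT y:- ball x \<rho>|lebesgue. F y) = (LINT z|lborel. indicator (- ball 0 \<rho>) z * g z)" .
    have gm: "(\<lambda>z. indicator (- ball 0 \<rho>) z * g z) \<in> borel_measurable borel" by measurable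
    have neg: "indicator (- ball 0 \<rho>) (0 + (-1) *\<^sub>R z) * g (0 + (-1) *\<^sub>R z) = indicator (- ball 0 \<rho>) z * g (- z)" for z
      by (simp add: indicator_def)
    have 2: "(LINT z|lborel. indicator (- ball 0 \<rho>) z * g (- z)) = (LINT z|lborel. indicator (- ball 0 \<rho>) z * g z)"
      using lborel_integral_isometry[OF _ gm, of "-1" 0] by (simp only: neg abs_minus abs_one)
    have 3: "integrable lborel (\<lambda>z. indicator (- ball 0 \<rho>) z * g (- z))"
      using gint[OF that] lborel_integrable_isometry[OF _ gm, of "-1" 0] by (simp only: neg abs_minus abs_one)
    have "(LINT z:- ball 0 \<rho>|lebesgue. H z) = (LINT z|lborel. indicator (- ball 0 \<rho>) z * H z)"
      unfolding set_lebesgue_integral_def real_scaleR_def by (rule integral_completion) measurable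
    also have "\<dots> = (LINT z|lborel. (indicator (- ball 0 \<rho>) z * g z + indicator (- ball 0 \<rho>) z * g (- z)) / 2)"
    proof (intro Bochner_Integration.integral_cong refl)
      fix z
      have "H z = (g z + g (- z)) / 2"
        unfolding H_def g_def by (simp add: add_divide_distrib[symmetric] mult.commute)
      then show "indicator (- ball 0 \<rho>) z * H z = (indicator (- ball 0 \<rho>) z * g z + indicator (- ball 0 \<rho>) z * g (- z)) / 2"
        by (simp add: distrib_left[symmetric])
    qed
    also have "\<dots> = (LINT z|lborel. indicator (- ball 0 \<rho>) z * g z)"
      using gint[OF that] 3 2 by simp
    finally show ?thesis using 1 by simp
  qed
  show ?thesis
    unfolding has_frac_laplacian_def p_def[symmetric]
  proof (intro conjI allI impI)
    fix \<rho> :: real assume "\<rho> > 0"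
    show "set_integrable lebesgue (- ball x \<rho>) (\<lambda>y. (w x - w y) / norm (x - y) powr p)"
      unfolding set_integrable_def F_def[symmetric] real_scaleR_def
      by (subst integrable_completion) (use FI[OF \<open>\<rho> > 0\<close>] Fm in auto)
  next
    have Hleb: "integrable lebesgue H" by (subst integrable_completion) (use Hint in auto)
    have "((\<lambda>\<rho>. LINT z:- ball 0 \<rho>|lebesgue. H z) \<longlongrightarrow> (LINT z|lebesgue. H z)) (at_right 0)"
      by (rule tendsto_integral_compl_ball[OF Hleb])
    moreover have "(LINT z|lebesgue. H z) = (LINT z|lborel. H z)" by (rule integral_completion) measurable
    ultimately have lim: "((\<lambda>\<rho>. LINT z:- ball 0 \<rho>|lebesgue. H z) \<longlongrightarrow> (LINT z|lborel. H z)) (at_right 0)"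
      by simp
    have "\<forall>\<^sub>F \<rho> in at_right 0. (LINT z:- ball 0 \<rho>|lebesgue. H z) = (LINT y:- ball x \<rho>|lebesgue. F y)"
      using eventually_at_right_less[of "0::real"] by eventually_elim (simp add: Feq)
    from Lim_transform_eventually[OF lim this]
    show "((\<lambda>\<rho>. LINT y:- ball x \<rho>|lebesgue. (w x - w y) / norm (x - y) powr p) \<longlongrightarrow>
        (LINT z|lborel. second_difference w x z / (2 * norm z powr p))) (at_right 0)"
      unfolding F_def[symmetric] H_def[symmetric] .
  qed
qed

lemma continuous_on_second_difference_integral:
  fixes w :: "real^'n::finite \<Rightarrow> real" and s :: real
  defines "p \<equiv> real CARD('n) + 2 * s"
  assumes s: "0 < s" "s < 1"
    and w: "continuous_on UNIV w" "\<And>y. \<bar>w y\<bar> \<le> B"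
    and d: "0 < d" "0 \<le> M"
      "\<And>x z. x \<in> K \<Longrightarrow> norm z < d \<Longrightarrow> \<bar>second_difference w x z\<bar> \<le> M * (norm z)\<^sup>2"
  shows "continuous_on K (\<lambda>x. LINT z|lborel. second_difference w x z / (2 * norm z powr p))"
proof (rule continuous_on_parametric_integral[where g = "\<lambda>z. (M + 4 * B) / min 1 (d\<^sup>2) * levy_weight p z"])
  have p: "real DIM(real^'n) < p" "p < real DIM(real^'n) + 2" using s by (auto simp: p_def)
  show "integrable lborel (\<lambda>z::real^'n. (M + 4 * B) / min 1 (d\<^sup>2) * levy_weight p z)"
    by (intro integrable_mult_right integrable_levy_weight p)
  have [measurable]: "w \<in> borel_measurable borel" using w(1) by (rule borel_measurable_continuous_onI)
  show "(\<lambda>z. second_difference w x z / (2 * norm z powr p)) \<in> borel_measurable lborel" for x by measurable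
  have B: "0 \<le> B" using w(2)[of 0] by simp
  show "\<bar>second_difference w x z / (2 * norm z powr p)\<bar> \<le> (M + 4 * B) / min 1 (d\<^sup>2) * levy_weight p z"
    if "x \<in> K" for x z
  proof -
    have "\<bar>second_difference w x z\<bar> \<le> 4 * B" using w(2)[of x] w(2)[of "x + z"] w(2)[of "x - z"] by linarith
    then have "\<bar>second_difference w x z\<bar> / norm z powr p \<le> (M + 4 * B) / min 1 (d\<^sup>2) * levy_weight p z"
      by (intro le_levy_weight) (use d that B in auto)
    moreover have "\<bar>second_difference w x z / (2 * norm z powr p)\<bar> \<le> \<bar>second_difference w x z\<bar> / norm z powr p"
      by (simp add: abs_mult divide_simps)
    ultimately show ?thesis by linarith
  qed
  show "continuous_on K (\<lambda>x. second_difference w x z / (2 * norm z powr p))" for z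
    using w(1) unfolding divide_inverse by (auto intro!: continuous_intros elim: continuous_on_compose2)
qed

text \<open>
  For the difference \<open>\<psi> = \<phi> - w\<close>, which vanishes at \<open>x\<close>, the
  second difference at \<open>x\<close> is \<open>\<psi> (x + z) + \<psi> (x - z)\<close>. As
  \<open>\<psi>\<close> keeps its sign, the quadratic bound on this sum bounds each summand.
\<close>
lemma integrable_touching_kernel:
  fixes w :: "real^'n::finite \<Rightarrow> real" and s :: real
  defines "p \<equiv> real CARD('n) + 2 * s"
  assumes s: "0 < s" "s < 1"
    and \<Omega>: "bounded \<Omega>" "continuous_on \<Omega> w" "bounded (w ` \<Omega>)"
    and d: "0 < d" "\<And>z. norm z < d \<Longrightarrow> \<bar>second_difference w x z\<bar> \<le> M * (norm z)\<^sup>2"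
    and N: "open N" "x \<in> N" "N \<subseteq> \<Omega>" and \<phi>: "Ck_closure 2 N \<phi>" "\<phi> x = w x"
    and sgn: "(\<forall>y\<in>N. w y \<le> \<phi> y) \<or> (\<forall>y\<in>N. \<phi> y \<le> w y)"
  shows "integrable lebesgue (\<lambda>y. indicator N y * (\<phi> y - w y) / norm (x - y) powr p)"
proof -
  have p: "real DIM(real^'n) < p" "p < real DIM(real^'n) + 2" using s by (auto simp: p_def)
  have C2: "Ck_on 2 N \<phi>" using \<phi> by (simp add: Ck_closure_def)
  have cN: "continuous_on N w" "continuous_on N \<phi>"
    using \<Omega> N \<phi> by (auto simp: Ck_closure_def intro: continuous_on_subset[OF _ closure_subset] continuous_on_subset[of \<Omega>])
  define \<psi> where "\<psi> y = indicator N y * (\<phi> y - w y)" for y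
  have m [measurable]: "\<psi> \<in> borel_measurable borel"
    unfolding \<psi>_def[abs_def] real_scaleR_def[symmetric]
    using N(1) cN by (intro borel_measurable_continuous_on_indicator continuous_on_diff) auto
  have "bounded (\<phi> ` closure N)"
    using \<phi> \<Omega> N by (intro compact_imp_bounded compact_continuous_image)
      (auto simp: Ck_closure_def compact_closure intro: bounded_subset)
  then obtain B1 where B1: "\<And>y. y \<in> N \<Longrightarrow> \<bar>\<phi> y\<bar> \<le> B1"
    using closure_subset[of N] by (auto simp: bounded_iff)
  obtain B2 where B2: "\<And>y. y \<in> N \<Longrightarrow> \<bar>w y\<bar> \<le> B2" using \<Omega>(3) N(3) by (auto simp: bounded_iff)
  define B where "B = B1 + B2"
  have B: "\<bar>\<psi> y\<bar> \<le> B" "0 \<le> B" for y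
    using B1[of y] B2[of y] B1[OF N(2)] B2[OF N(2)] by (auto simp: \<psi>_def B_def indicator_def)
  obtain r where r: "r > 0" "cball x r \<subseteq> N" using N open_contains_cball by blast
  obtain M' where M': "0 \<le> M'" "\<And>y z. y + z \<in> ball x r \<Longrightarrow> y - z \<in> ball x r \<Longrightarrow> \<bar>second_difference \<phi> y z\<bar> \<le> M' * (norm z)\<^sup>2"
    using Ck_on_second_difference_compact[OF C2 r(2)] by blast
  have near: "\<bar>\<psi> y\<bar> \<le> (M' + \<bar>M\<bar>) * (norm (x - y))\<^sup>2" if "norm (x - y) < min d r" for y
  proof -
    define z where "z = y - x"
    have z: "norm z < d" "norm z < r" using that by (auto simp: z_def norm_minus_commute)
    have "x + z \<in> ball x r" "x - z \<in> ball x r" using z by (auto simp: dist_norm)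
    moreover from this have "x + z \<in> N" "x - z \<in> N" using r(2) by auto
    ultimately have "\<bar>second_difference \<phi> x z\<bar> \<le> M' * (norm z)\<^sup>2" and in_N: "x + z \<in> N" "x - z \<in> N"
      using M' by auto
    moreover have "\<bar>second_difference w x z\<bar> \<le> M * (norm z)\<^sup>2" using d(2) z by blast
    moreover have "M * (norm z)\<^sup>2 \<le> \<bar>M\<bar> * (norm z)\<^sup>2" by (intro mult_right_mono) auto
    ultimately have "\<bar>\<psi> (x + z) + \<psi> (x - z)\<bar> \<le> (M' + \<bar>M\<bar>) * (norm z)\<^sup>2"
      using \<phi>(2) by (simp add: \<psi>_def distrib_right)
    \<comment> \<open>both values have the same sign, so nothing cancels\<close>
    moreover have "0 \<le> \<psi> (x + z) \<and> 0 \<le> \<psi> (x - z) \<or> \<psi> (x + z) \<le> 0 \<and> \<psi> (x - z) \<le> 0"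
      using sgn in_N by (auto simp: \<psi>_def)
    then have "\<bar>\<psi> (x + z)\<bar> \<le> \<bar>\<psi> (x + z) + \<psi> (x - z)\<bar>" by linarith
    ultimately show ?thesis by (simp add: z_def norm_minus_commute)
  qed
  have "integrable lborel (\<lambda>y. \<psi> y / norm (x - y) powr p)"
  proof (rule Bochner_Integration.integrable_bound)
    show "integrable lborel (\<lambda>y. (M' + \<bar>M\<bar> + B) / min 1 ((min d r)\<^sup>2) * levy_weight p (x - y))"
      using integrable_levy_weight_shift[OF p] by simp
    show "AE y in lborel. norm (\<psi> y / norm (x - y) powr p) \<le> norm ((M' + \<bar>M\<bar> + B) / min 1 ((min d r)\<^sup>2) * levy_weight p (x - y))"
    proof (rule AE_I2)
      fix y
      have "\<bar>\<psi> y\<bar> / norm (x - y) powr p \<le> (M' + \<bar>M\<bar> + B) / min 1 ((min d r)\<^sup>2) * levy_weight p (x - y)"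
        by (rule le_levy_weight) (use B near d r M' in auto)
      then have "norm (\<psi> y / norm (x - y) powr p) \<le> (M' + \<bar>M\<bar> + B) / min 1 ((min d r)\<^sup>2) * levy_weight p (x - y)"
        by simp
      also have "\<dots> \<le> norm \<dots>" by (simp only: real_norm_def abs_ge_self)
      finally show "norm (\<psi> y / norm (x - y) powr p) \<le> norm ((M' + \<bar>M\<bar> + B) / min 1 ((min d r)\<^sup>2) * levy_weight p (x - y))" .
    qed
  qed measurable
  then have "integrable lebesgue (\<lambda>y. \<psi> y / norm (x - y) powr p)"
    by (subst integrable_completion) auto
  then show ?thesis by (simp add: \<psi>_def)
qed

text \<open>
  Replacing \<open>w\<close> by the touching function changes the fractional Laplacian by the
  integral of a function of one sign, in the direction that the definition asks for.
\<close>
lemma visc_solution_of_classical: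
  fixes w :: "real^'n::finite \<Rightarrow> real"
  assumes s: "0 < s" "s < 1"
    and \<Omega>: "bounded \<Omega>" "continuous_on \<Omega> w" "bounded (w ` \<Omega>)"
    and g: "\<And>x. x \<in> \<Omega> \<Longrightarrow> has_frac_laplacian s w x (g x)"
    and d: "\<And>x. x \<in> \<Omega> \<Longrightarrow> \<exists>M. \<exists>d>0. \<forall>z. norm z < d \<longrightarrow> \<bar>second_difference w x z\<bar> \<le> M * (norm z)\<^sup>2"
  shows "visc_solution s \<Omega> w g"
proof -
  let ?K = "\<lambda>x y. norm (x - y) powr (real CARD('n) + 2 * s)"
  have *: "has_frac_laplacian s (\<lambda>y. if y \<in> N then \<phi> y else w y) x
      (g x - (LINT y|lebesgue. indicator N y * (\<phi> y - w y) / ?K x y))"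
    if N: "open N" "x \<in> N" "N \<subseteq> \<Omega>" and \<phi>: "Ck_closure 2 N \<phi>" "\<phi> x = w x"
      and sgn: "(\<forall>y\<in>N. w y \<le> \<phi> y) \<or> (\<forall>y\<in>N. \<phi> y \<le> w y)" for x N \<phi>
  proof -
    have x: "x \<in> \<Omega>" using N by auto
    then obtain M e where "0 < e" "\<And>z. norm z < e \<Longrightarrow> \<bar>second_difference w x z\<bar> \<le> M * (norm z)\<^sup>2"
      using d[OF x] by blast
    from integrable_touching_kernel[OF s \<Omega> this N \<phi> sgn]
    have "has_frac_laplacian s (\<lambda>y. w y + indicator N y * (\<phi> y - w y)) x
      (g x - (LINT y|lebesgue. indicator N y * (\<phi> y - w y) / ?K x y))"
      by (intro has_frac_laplacian_add_integrable g x) (use \<phi> in auto)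
    also have "(\<lambda>y. w y + indicator N y * (\<phi> y - w y)) = (\<lambda>y. if y \<in> N then \<phi> y else w y)"
      by (auto simp: indicator_def)
    finally show ?thesis .
  qed
  show ?thesis
    unfolding visc_solution_def visc_subsolution_def visc_supersolution_def
  proof (intro conjI allI impI)
    fix x N \<phi> assume a: "open N \<and> x \<in> N \<and> N \<subseteq> \<Omega> \<and> Ck_closure 2 N \<phi> \<and> \<phi> x = w x \<and> (\<forall>y\<in>N. w y \<le> \<phi> y)"
    have "0 \<le> (LINT y|lebesgue. indicator N y * (\<phi> y - w y) / ?K x y)"
      by (rule Bochner_Integration.integral_nonneg) (use a in \<open>auto simp: indicator_def\<close>)
    then show "\<exists>L. has_frac_laplacian s (\<lambda>y. if y \<in> N then \<phi> y else w y) x L \<and> L \<le> g x"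
      using * a by (intro exI conjI, blast) simp
  next
    fix x N \<phi> assume a: "open N \<and> x \<in> N \<and> N \<subseteq> \<Omega> \<and> Ck_closure 2 N \<phi> \<and> \<phi> x = w x \<and> (\<forall>y\<in>N. \<phi> y \<le> w y)"
    have "0 \<le> (LINT y|lebesgue. - (indicator N y * (\<phi> y - w y) / ?K x y))"
      by (rule Bochner_Integration.integral_nonneg) (use a in \<open>auto simp: indicator_def divide_nonpos_nonneg\<close>)
    then show "\<exists>L. has_frac_laplacian s (\<lambda>y. if y \<in> N then \<phi> y else w y) x L \<and> g x \<le> L"
      using * a by (intro exI conjI, blast) simp
  qed (fact \<Omega>(2))
qed

section \<open>Density of the kernels with exterior poles\<close>

text \<open>
  A linear space of functions that is closed under uniform convergence on \<open>K\<close>.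
  Membership depends only on the values on \<open>K\<close>, which allows functions on the whole
  space.
\<close>
locale unif_closed_subspace =
  fixes K :: "'a::metric_space set" and V :: "('a \<Rightarrow> real) set"
  assumes compact_K: "compact K"
    and add_mem: "f \<in> V \<Longrightarrow> g \<in> V \<Longrightarrow> (\<lambda>x. f x + g x) \<in> V"
    and scale_mem: "f \<in> V \<Longrightarrow> (\<lambda>x. c * f x) \<in> V"
    and limit_mem: "(\<And>e. e > 0 \<Longrightarrow> \<exists>f\<in>V. \<forall>x\<in>K. \<bar>f x - g x\<bar> \<le> e) \<Longrightarrow> g \<in> V"
begin

lemma sum_mem: "finite I \<Longrightarrow> I \<noteq> {} \<Longrightarrow> (\<And>i. i \<in> I \<Longrightarrow> f i \<in> V) \<Longrightarrow> (\<lambda>x. \<Sum>i\<in>I. f i x) \<in> V"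
proof (induction I rule: finite_ne_induct)
  case (insert i I)
  then show ?case using add_mem[of "f i" "\<lambda>x. \<Sum>i\<in>I. f i x"] by simp
qed simp

text \<open>
  Difference quotients in the parameter converge uniformly on \<open>K\<close> to the derivative, by
  the mean value theorem and uniform continuity of the derivative on a compact set.
\<close>
lemma parameter_derivative_mem:
  assumes r: "r > 0" and V: "\<And>t. t \<in> {-r..r} \<Longrightarrow> (\<lambda>x. G x t) \<in> V"
    and D: "\<And>x t. x \<in> K \<Longrightarrow> t \<in> {-r..r} \<Longrightarrow> (G x has_real_derivative G' x t) (at t)"
    and cont: "continuous_on (K \<times> {-r..r}) (\<lambda>(x, t). G' x t)"
  shows "(\<lambda>x. G' x 0) \<in> V"
proof (rule limit_mem)
  fix e :: real assume e: "e > 0"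
  have "uniformly_continuous_on (K \<times> {-r..r}) (\<lambda>(x, t). G' x t)"
    by (intro compact_uniformly_continuous cont compact_Times compact_K) auto
  then obtain d where d: "d > 0"
    "\<And>u v. u \<in> K \<times> {-r..r} \<Longrightarrow> v \<in> K \<times> {-r..r} \<Longrightarrow> dist v u < d \<Longrightarrow>
      dist (case v of (x, t) \<Rightarrow> G' x t) (case u of (x, t) \<Rightarrow> G' x t) < e"
    unfolding uniformly_continuous_on_def using e by metis
  define h where "h = min (d / 2) r"
  have h: "0 < h" "h < d" "h \<le> r" using d r by (auto simp: h_def)
  show "\<exists>f\<in>V. \<forall>x\<in>K. \<bar>f x - G' x 0\<bar> \<le> e"
  proof (intro bexI ballI)
    have "(\<lambda>x. (1 / h) * G x h + (- 1 / h) * G x 0) \<in> V"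
      using r h by (intro add_mem scale_mem V) auto
    then show "(\<lambda>x. (G x h - G x 0) / h) \<in> V" by (simp add: diff_divide_distrib)
    fix x assume x: "x \<in> K"
    obtain \<xi> where \<xi>: "0 < \<xi>" "\<xi> < h" "G x h - G x 0 = (h - 0) * G' x \<xi>"
      using MVT2[of 0 h "G x" "G' x"] D[OF x] h by auto
    have "dist (G' x \<xi>) (G' x 0) < e"
      using d(2)[of "(x, 0)" "(x, \<xi>)"] x \<xi> h r by (simp add: dist_Pair_Pair dist_real_def)
    then show "\<bar>(G x h - G x 0) / h - G' x 0\<bar> \<le> e" using \<xi> h by (simp add: dist_real_def)
  qed
qed

end

text \<open>
  The kernel \<open>|x - y|\<close> to the power \<open>2 * c\<close>, written through the squared
  distance because that is differentiable in \<open>y\<close> without square roots. The pole comes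
  first, so that \<open>riesz c y\<close> is a function of \<open>x\<close>.
\<close>
definition riesz :: "real \<Rightarrow> real^'n::finite \<Rightarrow> real^'n \<Rightarrow> real" where
  "riesz c y x = ((x - y) \<bullet> (x - y)) powr c"

lemma riesz_line_derivative:
  fixes x y :: "real^'n::finite"
  assumes "x \<noteq> y + t *\<^sub>R axis i 1"
  shows "((\<lambda>t. riesz c (y + t *\<^sub>R axis i 1) x) has_real_derivative
    2 * c * ((y + t *\<^sub>R axis i 1) $ i - x $ i) * riesz (c - 1) (y + t *\<^sub>R axis i 1) x) (at t)"
proof -
  have pos: "0 < (x - (y + t *\<^sub>R axis i 1)) \<bullet> (x - (y + t *\<^sub>R axis i 1))" using assms by (simp add: inner_gt_zero_iff)
  have "((\<lambda>t. (x - (y + t *\<^sub>R axis i 1)) \<bullet> (x - (y + t *\<^sub>R axis i 1))) has_real_derivative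
     2 * ((y + t *\<^sub>R axis i 1) $ i - x $ i)) (at t)"
  proof -
    have "((\<lambda>t. (x - (y + t *\<^sub>R axis i 1)) \<bullet> (x - (y + t *\<^sub>R axis i 1))) has_derivative
       (\<lambda>r. 2 * ((x - (y + t *\<^sub>R axis i 1)) \<bullet> (- (r *\<^sub>R axis i 1))))) (at t)"
      by (auto intro!: derivative_eq_intros simp: inner_commute)
    then show ?thesis
      unfolding has_field_derivative_def
      by (rule has_derivative_eq_rhs) (simp add: fun_eq_iff inner_axis algebra_simps)
  qed
  from DERIV_chain2[OF has_real_derivative_powr[OF pos, of c] this]
  show ?thesis by (simp add: riesz_def mult_ac)
qed

lemma riesz_coordinate_derivative:
  fixes x y :: "real^'n::finite"
  assumes "x \<noteq> y + t *\<^sub>R axis i 1"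
  shows "((\<lambda>t. 2 * c * ((y + t *\<^sub>R axis i 1) $ i - x $ i) * riesz (c - 1) (y + t *\<^sub>R axis i 1) x) has_real_derivative
    2 * c * riesz (c - 1) (y + t *\<^sub>R axis i 1) x +
    4 * c * (c - 1) * ((y + t *\<^sub>R axis i 1) $ i - x $ i)\<^sup>2 * riesz (c - 2) (y + t *\<^sub>R axis i 1) x) (at t)"
proof -
  have "((\<lambda>t. 2 * c * ((y + t *\<^sub>R axis i 1) $ i - x $ i)) has_real_derivative 2 * c) (at t)"
    by (auto intro!: derivative_eq_intros)
  from DERIV_mult[OF this riesz_line_derivative[OF assms, of "c - 1"]]
  show ?thesis by (simp add: power2_eq_square algebra_simps)
qed

lemma continuous_on_riesz:
  fixes K :: "(real^'n::finite) set"
  assumes "\<And>x t. x \<in> K \<Longrightarrow> t \<in> T \<Longrightarrow> x \<noteq> y + t *\<^sub>R axis i 1"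
  shows "continuous_on (K \<times> T) (\<lambda>(x, t). riesz c (y + t *\<^sub>R axis i 1) x)"
  unfolding riesz_def split_def
  using assms by (intro continuous_intros) auto

text \<open>
  The second derivatives of \<open>riesz c y\<close> with respect to the coordinates of the pole
  \<open>y\<close> lie in \<open>V\<close>; their sum, the Laplacian, is \<open>2 * c * (2 * c - 2 +
  n)\<close> times the kernel with exponent \<open>c - 1\<close>.
\<close>
lemma riesz_laplacian_mem:
  fixes Y K :: "(real^'n::finite) set"
  assumes U: "unif_closed_subspace K V"
    and Y: "open Y" "K \<inter> Y = {}" and V: "\<And>y. y \<in> Y \<Longrightarrow> riesz c y \<in> V"
    and c: "2 * c * (2 * c - 2 + CARD('n)) \<noteq> 0" and y: "y \<in> Y"
  shows "riesz (c - 1) y \<in> V"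
proof -
  interpret unif_closed_subspace K V by (rule U)
  have line: "\<exists>r>0. \<forall>t\<in>{-r..r}. y + t *\<^sub>R axis i 1 \<in> Y" if yY: "y \<in> Y" for y i
  proof -
    obtain r where r: "r > 0" "cball y r \<subseteq> Y"
      using open_contains_cball_eq[OF Y(1)] yY by auto
    have "\<forall>t\<in>{-r..r}. y + t *\<^sub>R axis i 1 \<in> Y"
    proof
      fix t assume "t \<in> {-r..r}"
      then have "y + t *\<^sub>R axis i 1 \<in> cball y r" by (auto simp: dist_norm)
      then show "y + t *\<^sub>R axis i 1 \<in> Y" by (rule subsetD[OF r(2)])
    qed
    then show ?thesis using r(1) by (intro exI[of _ r] conjI)
  qed
  have ne: "x \<noteq> y" if "x \<in> K" "y \<in> Y" for x y using that Y(2) by auto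
  have first: "(\<lambda>x. 2 * c * (y $ i - x $ i) * riesz (c - 1) y x) \<in> V" if yY: "y \<in> Y" for y i
  proof -
    obtain r where r: "r > 0" and rY: "\<forall>t\<in>{-r..r}. y + t *\<^sub>R axis i 1 \<in> Y" using line[OF yY, of i] by (elim exE conjE)
    have "(\<lambda>x. 2 * c * ((y + 0 *\<^sub>R axis i 1) $ i - x $ i) * riesz (c - 1) (y + 0 *\<^sub>R axis i 1) x) \<in> V"
    proof (rule parameter_derivative_mem[OF r, where G = "\<lambda>x t. riesz c (y + t *\<^sub>R axis i 1) x"
        and G' = "\<lambda>x t. 2 * c * ((y + t *\<^sub>R axis i 1) $ i - x $ i) * riesz (c - 1) (y + t *\<^sub>R axis i 1) x"])
      show "(\<lambda>x. riesz c (y + t *\<^sub>R axis i 1) x) \<in> V" if "t \<in> {-r..r}" for t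
        by (rule V) (use rY that in blast)
      show "((\<lambda>t. riesz c (y + t *\<^sub>R axis i 1) x) has_real_derivative
          2 * c * ((y + t *\<^sub>R axis i 1) $ i - x $ i) * riesz (c - 1) (y + t *\<^sub>R axis i 1) x) (at t)"
        if "x \<in> K" "t \<in> {-r..r}" for x t
        by (rule riesz_line_derivative) (rule ne[OF that(1)], use rY that(2) in blast)
      show "continuous_on (K \<times> {-r..r}) (\<lambda>(x, t). 2 * c * ((y + t *\<^sub>R axis i 1) $ i - x $ i) * riesz (c - 1) (y + t *\<^sub>R axis i 1) x)"
        using continuous_on_riesz[of K "{-r..r}" y i "c - 1"] ne rY unfolding split_def
        by (intro continuous_intros) auto
    qed
    then show ?thesis by simp
  qed
  have second: "(\<lambda>x. 2 * c * riesz (c - 1) y x + 4 * c * (c - 1) * (y $ i - x $ i)\<^sup>2 * riesz (c - 2) y x) \<in> V" for i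
  proof -
    obtain r where r: "r > 0" and rY: "\<forall>t\<in>{-r..r}. y + t *\<^sub>R axis i 1 \<in> Y" using line[OF y, of i] by (elim exE conjE)
    have "(\<lambda>x. 2 * c * riesz (c - 1) (y + 0 *\<^sub>R axis i 1) x +
        4 * c * (c - 1) * ((y + 0 *\<^sub>R axis i 1) $ i - x $ i)\<^sup>2 * riesz (c - 2) (y + 0 *\<^sub>R axis i 1) x) \<in> V"
    proof (rule parameter_derivative_mem[OF r,
        where G = "\<lambda>x t. 2 * c * ((y + t *\<^sub>R axis i 1) $ i - x $ i) * riesz (c - 1) (y + t *\<^sub>R axis i 1) x"
        and G' = "\<lambda>x t. 2 * c * riesz (c - 1) (y + t *\<^sub>R axis i 1) x +
          4 * c * (c - 1) * ((y + t *\<^sub>R axis i 1) $ i - x $ i)\<^sup>2 * riesz (c - 2) (y + t *\<^sub>R axis i 1) x"])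
      show "(\<lambda>x. 2 * c * ((y + t *\<^sub>R axis i 1) $ i - x $ i) * riesz (c - 1) (y + t *\<^sub>R axis i 1) x) \<in> V"
        if "t \<in> {-r..r}" for t
        by (rule first) (use rY that in blast)
      show "((\<lambda>t. 2 * c * ((y + t *\<^sub>R axis i 1) $ i - x $ i) * riesz (c - 1) (y + t *\<^sub>R axis i 1) x) has_real_derivative
          2 * c * riesz (c - 1) (y + t *\<^sub>R axis i 1) x +
          4 * c * (c - 1) * ((y + t *\<^sub>R axis i 1) $ i - x $ i)\<^sup>2 * riesz (c - 2) (y + t *\<^sub>R axis i 1) x) (at t)"
        if "x \<in> K" "t \<in> {-r..r}" for x t
        by (rule riesz_coordinate_derivative) (rule ne[OF that(1)], use rY that(2) in blast)
      show "continuous_on (K \<times> {-r..r}) (\<lambda>(x, t). 2 * c * riesz (c - 1) (y + t *\<^sub>R axis i 1) x +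
          4 * c * (c - 1) * ((y + t *\<^sub>R axis i 1) $ i - x $ i)\<^sup>2 * riesz (c - 2) (y + t *\<^sub>R axis i 1) x)"
        using continuous_on_riesz[of K "{-r..r}" y i "c - 1"] continuous_on_riesz[of K "{-r..r}" y i "c - 2"] ne rY
        unfolding split_def by (intro continuous_intros) auto
    qed
    then show ?thesis by simp
  qed
  define \<kappa> where "\<kappa> = 2 * c * (2 * c - 2 + CARD('n))"
  have "(\<lambda>x. (1 / \<kappa>) * (\<Sum>i\<in>UNIV. 2 * c * riesz (c - 1) y x + 4 * c * (c - 1) * (y $ i - x $ i)\<^sup>2 * riesz (c - 2) y x)) \<in> V"
    by (intro scale_mem sum_mem second) auto
  moreover have "(\<Sum>i\<in>UNIV. 2 * c * riesz (c - 1) y x + 4 * c * (c - 1) * (y $ i - x $ i)\<^sup>2 * riesz (c - 2) y x)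
      = \<kappa> * riesz (c - 1) y x" for x
  proof -
    have sq: "(\<Sum>i\<in>UNIV. (y $ i - x $ i)\<^sup>2) = (x - y) \<bullet> (x - y)"
      by (simp add: inner_vec_def power2_eq_square algebra_simps)
    have "((x - y) \<bullet> (x - y)) * riesz (c - 2) y x = riesz (c - 1) y x"
      using powr_mult_base[of "(x - y) \<bullet> (x - y)" "c - 2"] by (simp add: riesz_def)
    then have "(\<Sum>i\<in>UNIV. (y $ i - x $ i)\<^sup>2) * riesz (c - 2) y x = riesz (c - 1) y x" by (simp only: sq)
    then have "4 * c * (c - 1) * (\<Sum>i\<in>UNIV. (y $ i - x $ i)\<^sup>2 * riesz (c - 2) y x) = 4 * c * (c - 1) * riesz (c - 1) y x"
      by (simp add: sum_distrib_right)
    then have "(\<Sum>i\<in>UNIV. 4 * c * (c - 1) * (y $ i - x $ i)\<^sup>2 * riesz (c - 2) y x) = 4 * c * (c - 1) * riesz (c - 1) y x"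
      by (simp add: sum_distrib_left mult.assoc)
    moreover have "(\<Sum>i\<in>(UNIV::'n set). 2 * c * riesz (c - 1) y x) = CARD('n) * (2 * c * riesz (c - 1) y x)"
      by simp
    ultimately show ?thesis unfolding sum.distrib \<kappa>_def by (simp add: algebra_simps)
  qed
  ultimately show ?thesis using c by (simp add: \<kappa>_def)
qed

text \<open>
  The factor in the previous lemma stays nonzero along the iteration because \<open>2 * c\<close>
  only decreases below \<open>- n\<close>.
\<close>
lemma riesz_lower_mem:
  fixes Y K :: "(real^'n::finite) set"
  assumes U: "unif_closed_subspace K V"
    and Y: "open Y" "K \<inter> Y = {}" and V: "\<And>y. y \<in> Y \<Longrightarrow> riesz c y \<in> V"
    and c: "2 * c < - real CARD('n)"
  shows "y \<in> Y \<Longrightarrow> riesz (c - real j) y \<in> V"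
proof (induction j arbitrary: y)
  case (Suc j)
  have neg: "2 * (c - real j) < - real CARD('n)" using c by (smt (verit) of_nat_0_le_iff)
  have "riesz ((c - real j) - 1) y \<in> V"
  proof (rule riesz_laplacian_mem[OF U Y])
    have "2 * (c - real j) \<noteq> 0" "2 * (c - real j) - 2 + real CARD('n) \<noteq> 0"
      using neg zero_less_card_finite[where 'a='n] by linarith+
    then show "2 * (c - real j) * (2 * (c - real j) - 2 + real CARD('n)) \<noteq> 0" by simp
  qed (use Suc in auto)
  then show ?case by (simp add: algebra_simps)
qed (simp add: V)

text \<open>
  With \<open>Q = |x - y|\<^sup>2\<close>, the combinations of the powers \<open>Q powr (c -
  j)\<close> are \<open>Q powr c\<close> times polynomials in \<open>1 / Q\<close>, and \<open>1 /
  Q\<close> ranges over a compact set of positive numbers.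
\<close>
lemma gaussian_mem:
  fixes Y K :: "(real^'n::finite) set"
  assumes U: "unif_closed_subspace K V"
    and Y: "open Y" "K \<inter> Y = {}" and V: "\<And>y. y \<in> Y \<Longrightarrow> riesz c y \<in> V"
    and c: "2 * c < - real CARD('n)" and y: "y \<in> Y"
  shows "(\<lambda>x. exp (- ((x - y) \<bullet> (x - y)))) \<in> V"
proof -
  interpret unif_closed_subspace K V by (rule U)
  define Q where "Q x = (x - y) \<bullet> (x - y)" for x
  have Q: "0 < Q x" if "x \<in> K" for x using that y Y(2) by (auto simp: Q_def inner_gt_zero_iff)
  have ne: "Q x \<noteq> 0" if "x \<in> K" for x using Q[OF that] by simp
  have cQ: "continuous_on K Q" unfolding Q_def by (intro continuous_intros)
  have "bounded ((\<lambda>x. Q x powr c) ` K)"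
    by (intro compact_imp_bounded compact_continuous_image continuous_on_powr continuous_on_const compact_K cQ ballI) (simp add: ne)
  then obtain B where B: "B > 0" "\<And>x. x \<in> K \<Longrightarrow> \<bar>Q x powr c\<bar> \<le> B"
    unfolding bounded_pos by auto
  have cT: "compact ((\<lambda>x. 1 / Q x) ` K)"
    by (intro compact_continuous_image continuous_on_divide continuous_on_const compact_K cQ ballI) (simp add: ne)
  have ne': "\<tau> \<noteq> 0" if "\<tau> \<in> (\<lambda>x. 1 / Q x) ` K" for \<tau> using that ne by auto
  show ?thesis
  proof (rule limit_mem)
    fix e :: real assume e: "e > 0"
    have eB: "0 < e / B" using e B by simp
    have cont: "continuous_on ((\<lambda>x. 1 / Q x) ` K) (\<lambda>\<tau>. exp (- (1 / \<tau>)) * \<tau> powr c)"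
      by (intro continuous_on_mult continuous_on_exp continuous_on_minus continuous_on_divide continuous_on_powr
          continuous_on_const continuous_on_id ballI ne')
    obtain P where P: "real_polynomial_function P"
      "\<And>\<tau>. \<tau> \<in> (\<lambda>x. 1 / Q x) ` K \<Longrightarrow> \<bar>exp (- (1 / \<tau>)) * \<tau> powr c - P \<tau>\<bar> < e / B"
      by (rule Stone_Weierstrass_real_polynomial_function[OF cT cont eB]) (rule that)
    obtain a N where aN: "P = (\<lambda>\<tau>. \<Sum>i\<le>N. a i * \<tau> ^ i)"
      using P(1) unfolding real_polynomial_function_iff_sum by blast
    show "\<exists>f\<in>V. \<forall>x\<in>K. \<bar>f x - exp (- ((x - y) \<bullet> (x - y)))\<bar> \<le> e"
    proof (intro bexI ballI)
      show "(\<lambda>x. \<Sum>i\<le>N. a i * riesz (c - real i) y x) \<in> V"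
        by (intro sum_mem scale_mem riesz_lower_mem[OF U Y V c y]) auto
      fix x assume x: "x \<in> K"
      have "(\<Sum>i\<le>N. a i * riesz (c - real i) y x) = Q x powr c * P (1 / Q x)"
        using Q[OF x] by (simp add: aN riesz_def Q_def[symmetric] sum_distrib_left powr_diff powr_realpow power_one_over
            divide_simps mult_ac)
      moreover have "exp (- Q x) = Q x powr c * (exp (- (1 / (1 / Q x))) * (1 / Q x) powr c)"
        using Q[OF x] by (simp add: powr_divide)
      ultimately have "(\<Sum>i\<le>N. a i * riesz (c - real i) y x) - exp (- Q x) =
         Q x powr c * (P (1 / Q x) - exp (- (1 / (1 / Q x))) * (1 / Q x) powr c)"
        by (simp only: right_diff_distrib)
      then have "\<bar>(\<Sum>i\<le>N. a i * riesz (c - real i) y x) - exp (- Q x)\<bar> =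
         \<bar>Q x powr c\<bar> * \<bar>exp (- (1 / (1 / Q x))) * (1 / Q x) powr c - P (1 / Q x)\<bar>"
        by (simp only: abs_mult abs_minus_commute)
      also have "\<dots> \<le> B * (e / B)"
        using B(2)[OF x] P(2)[of "1 / Q x"] x B(1) by (intro mult_mono) auto
      also have "\<dots> = e" using B by simp
      finally show "\<bar>(\<Sum>i\<le>N. a i * riesz (c - real i) y x) - exp (- ((x - y) \<bullet> (x - y)))\<bar> \<le> e"
        by (simp add: Q_def)
    qed
  qed
qed

inductive exp_sum :: "(real^'n::finite \<Rightarrow> real) \<Rightarrow> bool" where
  exp: "(\<And>i. 0 \<le> y $ i) \<Longrightarrow> exp_sum (\<lambda>x. a * exp (2 * (x \<bullet> y)))"
| add: "exp_sum f \<Longrightarrow> exp_sum g \<Longrightarrow> exp_sum (\<lambda>x. f x + g x)"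

lemma exp_sum_mult_exp:
  assumes "exp_sum g" "\<And>i. 0 \<le> y $ i"
  shows "exp_sum (\<lambda>x. a * exp (2 * (x \<bullet> y)) * g x)"
  using assms
proof (induction g rule: exp_sum.induct)
  case (exp z b)
  have "exp_sum (\<lambda>x. (a * b) * exp (2 * (x \<bullet> (y + z))))"
    by (intro exp_sum.exp) (use exp in simp)
  moreover have "(\<lambda>x. (a * b) * exp (2 * (x \<bullet> (y + z)))) = (\<lambda>x. a * exp (2 * (x \<bullet> y)) * (b * exp (2 * (x \<bullet> z))))"
    by (simp add: inner_add_right distrib_left exp_add mult_ac fun_eq_iff)
  ultimately show ?case by simp
next
  case (add f g)
  then show ?case using exp_sum.add by (simp add: distrib_left)
qed

lemma exp_sum_mult:
  assumes "exp_sum f" "exp_sum g" shows "exp_sum (\<lambda>x. f x * g x)"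
  using assms
proof (induction f rule: exp_sum.induct)
  case (exp y a)
  then show ?case by (intro exp_sum_mult_exp)
next
  case (add f h)
  then show ?case using exp_sum.add by (simp add: distrib_right)
qed

text \<open>
  The orthant of admissible frequencies contains the origin, giving constants, is closed under
  addition, giving products, and contains the coordinate directions, which separate points.
\<close>
lemma exp_sum_dense:
  fixes K :: "(real^'n::finite) set"
  assumes "compact K" "continuous_on K f" "0 < e"
  shows "\<exists>g. exp_sum g \<and> (\<forall>x\<in>K. \<bar>f x - g x\<bar> < e)"
proof (rule Stone_Weierstrass_HOL[OF assms(1) _ _ _ _ _ assms(2,3)])
  show "exp_sum (\<lambda>x::real^'n. c)" for c using exp_sum.exp[of 0 c] by simp
  show "continuous_on K g" if "exp_sum g" for g
    using that by induction (auto intro!: continuous_intros)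
  show "exp_sum (\<lambda>x. f x + g x)" if "exp_sum f \<and> exp_sum g" for f g :: "real^'n \<Rightarrow> real"
    using that exp_sum.add by blast
  show "exp_sum (\<lambda>x. f x * g x)" if "exp_sum f \<and> exp_sum g" for f g :: "real^'n \<Rightarrow> real"
    using that exp_sum_mult by blast
  show "\<exists>f. exp_sum f \<and> f x \<noteq> f y" if xy: "x \<in> K \<and> y \<in> K \<and> x \<noteq> y" for x y
  proof -
    obtain i where i: "x $ i \<noteq> y $ i" using xy by (auto simp: vec_eq_iff)
    have "exp_sum (\<lambda>x::real^'n. 1 * exp (2 * (x \<bullet> axis i 1)))" by (rule exp_sum.exp) (simp add: axis_def)
    then show ?thesis using i by (intro exI[of _ "\<lambda>x. 1 * exp (2 * (x \<bullet> axis i 1))"]) (simp add: inner_axis)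
  qed
qed

text \<open>
  The frequencies \<open>y\<close> in the orthant are shifted by a vector \<open>y0\<close> far out
  in the same orthant, so that all Gaussian centres \<open>y0 + y\<close> lie outside the ball. The
  common factor \<open>W\<close> that remains has no zeros and can be divided out.
\<close>
lemma riesz_kernels_dense:
  fixes K :: "(real^'n::finite) set"
  assumes U: "unif_closed_subspace K V" and K: "K \<subseteq> cball 0 \<rho>"
    and V: "\<And>y. \<rho> < norm y \<Longrightarrow> riesz c y \<in> V"
    and c: "2 * c < - real CARD('n)" and f: "continuous_on K f"
  shows "f \<in> V"
proof -
  interpret unif_closed_subspace K V by (rule U)
  \<comment> \<open>adding a vector of the orthant to \<open>y0\<close> only enlarges the coordinates, so it stays outside the ball\<close>
  define y0 :: "real^'n" where "y0 = (\<chi> i. \<bar>\<rho>\<bar> + 1)"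
  have far: "\<rho> < norm (y0 + y)" if "\<And>i. 0 \<le> y $ i" for y
  proof -
    have "\<bar>\<rho>\<bar> + 1 \<le> \<bar>(y0 + y) $ undefined\<bar>" using that[of undefined] by (simp add: y0_def)
    also have "\<dots> \<le> norm (y0 + y)" by (rule component_le_norm_cart)
    finally show ?thesis by linarith
  qed
  define Y :: "(real^'n) set" where "Y = - cball 0 \<rho>"
  have Y: "open Y" "K \<inter> Y = {}" "\<And>y. y \<in> Y \<Longrightarrow> riesz c y \<in> V"
    using K V by (auto simp: Y_def)
  define W where "W x = exp (- (x \<bullet> x) + 2 * (x \<bullet> y0))" for x :: "real^'n"
  have W: "W x * exp (2 * (x \<bullet> y)) = exp ((y0 + y) \<bullet> (y0 + y)) * exp (- ((x - (y0 + y)) \<bullet> (x - (y0 + y))))" for x y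
    by (simp add: W_def exp_add[symmetric] inner_diff inner_add inner_commute algebra_simps)
  have mem: "(\<lambda>x. W x * g x) \<in> V" if "exp_sum g" for g
    using that
  proof induction
    case (exp y a)
    have "y0 + y \<in> Y" using far[OF exp] by (simp add: Y_def)
    then have "(\<lambda>x. (a * exp ((y0 + y) \<bullet> (y0 + y))) * exp (- ((x - (y0 + y)) \<bullet> (x - (y0 + y))))) \<in> V"
      by (intro scale_mem gaussian_mem[OF U Y c])
    moreover have "(\<lambda>x. (a * exp ((y0 + y) \<bullet> (y0 + y))) * exp (- ((x - (y0 + y)) \<bullet> (x - (y0 + y)))))
        = (\<lambda>x. W x * (a * exp (2 * (x \<bullet> y))))"
    proof
      fix x show "(a * exp ((y0 + y) \<bullet> (y0 + y))) * exp (- ((x - (y0 + y)) \<bullet> (x - (y0 + y)))) = W x * (a * exp (2 * (x \<bullet> y)))"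
        using W[of x y] by (metis mult.assoc mult.left_commute)
    qed
    ultimately show ?case by simp
  next
    case (add f g)
    then show ?case using add_mem by (simp add: distrib_left)
  qed
  have cW: "continuous_on K W" unfolding W_def by (intro continuous_intros)
  have Wpos: "0 < W x" for x by (simp add: W_def)
  have "bounded (W ` K)" by (intro compact_imp_bounded compact_continuous_image compact_K cW)
  then obtain B where B: "B > 0" "\<And>x. x \<in> K \<Longrightarrow> \<bar>W x\<bar> \<le> B" unfolding bounded_pos by auto
  show ?thesis
  proof (rule limit_mem)
    fix e :: real assume e: "e > 0"
    have "continuous_on K (\<lambda>x. f x / W x)"
      using f cW Wpos by (intro continuous_intros) (auto simp: less_imp_neq[symmetric])
    then obtain g where g: "exp_sum g" "\<And>x. x \<in> K \<Longrightarrow> \<bar>f x / W x - g x\<bar> < e / B"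
      using exp_sum_dense[OF compact_K, of "\<lambda>x. f x / W x" "e / B"] e B by auto
    show "\<exists>h\<in>V. \<forall>x\<in>K. \<bar>h x - f x\<bar> \<le> e"
    proof (intro bexI[OF _ mem[OF g(1)]] ballI)
      fix x assume x: "x \<in> K"
      have "W x * g x - f x = - (W x * (f x / W x - g x))"
        using Wpos[of x] by (simp add: right_diff_distrib)
      then have "\<bar>W x * g x - f x\<bar> = \<bar>W x\<bar> * \<bar>f x / W x - g x\<bar>"
        by (simp only: abs_minus abs_mult)
      also have "\<dots> \<le> B * (e / B)" using B(2)[OF x] g(2)[OF x] B(1) by (intro mult_mono) auto
      finally show "\<bar>W x * g x - f x\<bar> \<le> e" using B by simp
    qed
  qed
qed

section \<open>Potentials of exterior densities\<close>

lemma riesz_norm: "riesz (- p / 2) y x = 1 / norm (x - y) powr p"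
proof (cases "x = y")
  case False
  have "((norm (x - y))\<^sup>2) powr (- p / 2) = norm (x - y) powr (- p)"
    using False by (simp add: powr_powr flip: powr_numeral)
  then show ?thesis by (simp add: riesz_def dot_square_norm powr_minus_divide)
qed (simp add: riesz_def)

abbreviation potential :: "real \<Rightarrow> ('a::euclidean_space \<Rightarrow> real) \<Rightarrow> 'a \<Rightarrow> real" where
  "potential p v x \<equiv> LINT y|lebesgue. v y / norm (x - y) powr p"

lemma integrable_far_potential:
  fixes v :: "'a::euclidean_space \<Rightarrow> real"
  assumes v: "integrable lebesgue v" "\<And>y. norm y < 2 \<Longrightarrow> v y = 0" and x: "norm x \<le> 1" and p: "0 \<le> p"
  shows "integrable lebesgue (\<lambda>y. v y / norm (x - y) powr p)"
    and "\<bar>v y / norm (x - y) powr p\<bar> \<le> \<bar>v y\<bar>"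
proof -
  show *: "\<bar>v y / norm (x - y) powr p\<bar> \<le> \<bar>v y\<bar>" for y
  proof (cases "norm y < 2")
    case False
    have "norm y \<le> norm x + norm (x - y)" using norm_triangle_sub[of y x] by (simp add: norm_minus_commute)
    then have "1 \<le> norm (x - y)" using False x by linarith
    then have "1 \<le> norm (x - y) powr p" using p by (rule ge_one_powr_ge_zero)
    then have "\<bar>v y\<bar> / norm (x - y) powr p \<le> \<bar>v y\<bar> / 1" by (intro divide_left_mono) auto
    then show ?thesis by (simp add: abs_div)
  qed (simp add: v)
  have "(\<lambda>y. norm (x - y) powr p) \<in> borel_measurable lborel" by measurable
  then have [measurable]: "(\<lambda>y. norm (x - y) powr p) \<in> borel_measurable lebesgue"
    by (rule measurable_completion)
  have [measurable]: "v \<in> borel_measurable lebesgue" using v by auto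
  show "integrable lebesgue (\<lambda>y. v y / norm (x - y) powr p)"
    by (rule Bochner_Integration.integrable_bound[OF v(1)]) (use * in auto)
qed

lemma continuous_on_far_potential:
  fixes v :: "'a::euclidean_space \<Rightarrow> real"
  assumes v: "integrable lebesgue v" "\<And>y. norm y < 2 \<Longrightarrow> v y = 0" and p: "0 \<le> p"
  shows "continuous_on (cball 0 1) (potential p v)"
proof (rule continuous_on_parametric_integral[where g = "\<lambda>y. \<bar>v y\<bar>"])
  fix y :: 'a
  show "continuous_on (cball 0 1) (\<lambda>x. v y / norm (x - y) powr p)"
  proof (cases "norm y < 2")
    case False
    then show ?thesis by (intro continuous_intros) auto
  qed (simp add: v)
qed (use integrable_far_potential[OF v _ p] v in auto)

abbreviation far_approximable :: "real \<Rightarrow> ('a::euclidean_space \<Rightarrow> real) \<Rightarrow> real \<Rightarrow> bool" where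
  "far_approximable p g e \<equiv> \<exists>v R. integrable lebesgue v \<and> (\<forall>y. norm y < 2 \<or> R < norm y \<longrightarrow> v y = 0) \<and>
     (\<forall>x\<in>cball 0 1. \<bar>potential p v x - g x\<bar> \<le> e)"

text \<open>
  The uniform closure is built into the definition, so that the set is a closed subspace and the
  density criterion for kernels applies to it. The densities keep distance \<open>1\<close> from the
  closed unit ball, where the kernel is therefore at most \<open>1\<close>.
\<close>
definition far_potentials :: "real \<Rightarrow> ('a::euclidean_space \<Rightarrow> real) set" where
  "far_potentials p = {g. \<forall>e>0. far_approximable p g e}"

lemma far_potentialsE:
  fixes g :: "'a::euclidean_space \<Rightarrow> real"
  assumes "g \<in> far_potentials p" "0 < e"
  obtains v R where "integrable lebesgue v" "\<And>y. norm y < 2 \<or> R < norm y \<Longrightarrow> v y = 0"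
    "\<And>x. x \<in> cball 0 1 \<Longrightarrow> \<bar>potential p v x - g x\<bar> \<le> e"
proof -
  have "far_approximable p g e"
    using assms by (simp add: far_potentials_def)
  then obtain v R where *: "integrable lebesgue v" "\<forall>y. norm y < 2 \<or> R < norm y \<longrightarrow> v y = 0"
    "\<forall>x\<in>cball 0 1. \<bar>potential p v x - g x\<bar> \<le> e"
    by blast
  show ?thesis by (rule that[of v R]) (use * in auto)
qed

lemma unif_closed_subspace_far_potentials:
  assumes p: "0 \<le> p"
  shows "unif_closed_subspace (cball 0 1) (far_potentials p :: ('a::euclidean_space \<Rightarrow> real) set)"
proof
  fix f g :: "'a \<Rightarrow> real" assume f: "f \<in> far_potentials p" and g: "g \<in> far_potentials p"
  show "(\<lambda>x. f x + g x) \<in> far_potentials p"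
    unfolding far_potentials_def
  proof (intro CollectI allI impI)
    fix e :: real assume "0 < e"
    then have e: "0 < e / 2" by simp
    obtain v1 R1 where 1: "integrable lebesgue v1" "\<And>y. norm y < 2 \<or> R1 < norm y \<Longrightarrow> v1 y = 0"
      "\<And>x. x \<in> cball 0 1 \<Longrightarrow> \<bar>potential p v1 x - f x\<bar> \<le> e / 2"
      by (rule far_potentialsE[OF f e]) (rule that)
    obtain v2 R2 where 2: "integrable lebesgue v2" "\<And>y. norm y < 2 \<or> R2 < norm y \<Longrightarrow> v2 y = 0"
      "\<And>x. x \<in> cball 0 1 \<Longrightarrow> \<bar>potential p v2 x - g x\<bar> \<le> e / 2"
      by (rule far_potentialsE[OF g e]) (rule that)
    have "\<bar>potential p (\<lambda>y. v1 y + v2 y) x - (f x + g x)\<bar> \<le> e" if "x \<in> cball 0 1" for x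
    proof -
      have x: "norm x \<le> 1" using that by simp
      have "potential p (\<lambda>y. v1 y + v2 y) x
          = potential p v1 x + potential p v2 x"
        unfolding add_divide_distrib
        by (intro Bochner_Integration.integral_add integrable_far_potential x p) (use 1 2 in auto)
      then show ?thesis using 1(3)[OF that] 2(3)[OF that] by linarith
    qed
    then show "far_approximable p (\<lambda>x. f x + g x) e"
      using 1 2 by (intro exI[of _ "\<lambda>y. v1 y + v2 y"] exI[of _ "max R1 R2"]) auto
  qed
next
  fix f :: "'a \<Rightarrow> real" and c :: real assume f: "f \<in> far_potentials p"
  show "(\<lambda>x. c * f x) \<in> far_potentials p"
    unfolding far_potentials_def
  proof (intro CollectI allI impI)
    fix e :: real assume e: "0 < e"
    then have e': "0 < e / (\<bar>c\<bar> + 1)" by simp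
    obtain v R where v: "integrable lebesgue v" "\<And>y. norm y < 2 \<or> R < norm y \<Longrightarrow> v y = 0"
      "\<And>x. x \<in> cball 0 1 \<Longrightarrow> \<bar>potential p v x - f x\<bar> \<le> e / (\<bar>c\<bar> + 1)"
      by (rule far_potentialsE[OF f e']) (rule that)
    have "\<bar>potential p (\<lambda>y. c * v y) x - c * f x\<bar> \<le> e" if "x \<in> cball 0 1" for x
    proof -
      have "potential p (\<lambda>y. c * v y) x - c * f x
          = c * (potential p v x - f x)"
        by (simp add: right_diff_distrib flip: times_divide_eq_right)
      then have "\<bar>potential p (\<lambda>y. c * v y) x - c * f x\<bar>
          = \<bar>c\<bar> * \<bar>potential p v x - f x\<bar>" by (simp only: abs_mult)
      also have "\<dots> \<le> (\<bar>c\<bar> + 1) * (e / (\<bar>c\<bar> + 1))" using v(3)[OF that] by (intro mult_mono) auto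
      finally show ?thesis by simp
    qed
    then show "far_approximable p (\<lambda>x. c * f x) e"
      using v by (intro exI[of _ "\<lambda>y. c * v y"] exI[of _ R]) auto
  qed
next
  fix g :: "'a \<Rightarrow> real"
  assume lim: "\<And>e. 0 < e \<Longrightarrow> \<exists>f\<in>far_potentials p. \<forall>x\<in>cball 0 1. \<bar>f x - g x\<bar> \<le> e"
  show "g \<in> far_potentials p"
    unfolding far_potentials_def
  proof (intro CollectI allI impI)
    fix e :: real assume "0 < e"
    then have e: "0 < e / 2" by simp
    obtain f where f: "f \<in> far_potentials p" "\<And>x. x \<in> cball 0 1 \<Longrightarrow> \<bar>f x - g x\<bar> \<le> e / 2"
      using lim[OF e] by blast
    obtain v R where v: "integrable lebesgue v" "\<And>y. norm y < 2 \<or> R < norm y \<Longrightarrow> v y = 0"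
      "\<And>x. x \<in> cball 0 1 \<Longrightarrow> \<bar>potential p v x - f x\<bar> \<le> e / 2"
      by (rule far_potentialsE[OF f(1) e]) (rule that)
    have "\<bar>potential p v x - g x\<bar> \<le> e" if "x \<in> cball 0 1" for x
      using v(3)[OF that] f(2)[OF that] by linarith
    then show "far_approximable p g e"
      using v by (intro exI[of _ v] exI[of _ R]) auto
  qed
qed simp

text \<open>
  A point mass at \<open>y0\<close> is replaced by the uniform density on a small ball around it;
  the kernel is uniformly continuous there.
\<close>
lemma kernel_in_far_potentials:
  fixes y0 :: "'a::euclidean_space"
  assumes p: "0 \<le> p" and y0: "2 < norm y0"
  shows "(\<lambda>x. 1 / norm (x - y0) powr p) \<in> far_potentials p"
  unfolding far_potentials_def
proof (intro CollectI allI impI)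
  fix e :: real assume e: "0 < e"
  define r where "r = (norm y0 - 2) / 2"
  have r: "r > 0" using y0 by (simp add: r_def)
  have away: "2 \<le> norm y" if "y \<in> cball y0 r" for y
  proof -
    have "norm y0 \<le> norm y + dist y0 y" using norm_triangle_sub[of y0 y] by (simp add: dist_norm)
    then show ?thesis using that y0 by (simp add: r_def field_simps)
  qed
  have "continuous_on (cball 0 1 \<times> cball y0 r) (\<lambda>(x, y). 1 / norm (x - y) powr p)"
    unfolding split_def using away by (intro continuous_intros) force+
  then have "uniformly_continuous_on (cball 0 1 \<times> cball y0 r) (\<lambda>(x, y). 1 / norm (x - y) powr p)"
    by (intro compact_uniformly_continuous compact_Times) auto
  then obtain d where d: "d > 0"
    "\<And>u v. u \<in> cball 0 1 \<times> cball y0 r \<Longrightarrow> v \<in> cball 0 1 \<times> cball y0 r \<Longrightarrow> dist v u < d \<Longrightarrow>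
      dist (case v of (x, y) \<Rightarrow> 1 / norm (x - y) powr p) (case u of (x, y) \<Rightarrow> 1 / norm (x - y) powr p) < e"
    unfolding uniformly_continuous_on_def using e by metis
  define \<delta> where "\<delta> = min d r"
  have \<delta>: "0 < \<delta>" "\<delta> \<le> d" "\<delta> \<le> r" using d r by (auto simp: \<delta>_def)
  define m where "m = measure lebesgue (ball y0 \<delta>)"
  have m: "m > 0" using content_ball_pos[OF \<delta>(1), of y0] by (simp add: m_def)
  have close: "\<bar>1 / norm (x - y) powr p - 1 / norm (x - y0) powr p\<bar> \<le> e" if "x \<in> cball 0 1" "y \<in> ball y0 \<delta>" for x y
    using d(2)[of "(x, y0)" "(x, y)"] that \<delta> r by (simp add: dist_Pair_Pair dist_real_def dist_commute)
  define v where "v y = indicator (ball y0 \<delta>) y / m" for y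
  have ind: "integrable lebesgue (indicator (ball y0 \<delta>) :: 'a \<Rightarrow> real)"
    using lmeasurable_ball[of y0 \<delta>] by (simp add: fmeasurable_def integrable_indicator_iff)
  have v: "integrable lebesgue v" unfolding v_def[abs_def] using ind by (intro integrable_divide) auto
  have v0: "v y = 0" if "norm y < 2" for y
    using away[of y] that \<delta> by (auto simp: v_def indicator_def)
  note v = v v0
  have "\<bar>potential p v x - 1 / norm (x - y0) powr p\<bar> \<le> e" if x: "x \<in> cball 0 1" for x
  proof -
    have "(LINT y|lebesgue. indicator (ball y0 \<delta>) y) = m" by (simp add: m_def)
    then have one: "(LINT y|lebesgue. v y) = 1" using m by (simp add: v_def[abs_def])
    have int: "integrable lebesgue (\<lambda>y. v y / norm (x - y) powr p)"
      by (rule integrable_far_potential[OF v _ p]) (use x in auto)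
    have int2: "integrable lebesgue (\<lambda>y. v y * (1 / norm (x - y0) powr p))" using v by simp
    have "potential p v x - 1 / norm (x - y0) powr p
        = potential p v x - (LINT y|lebesgue. v y * (1 / norm (x - y0) powr p))"
      using one by simp
    also have "\<dots> = (LINT y|lebesgue. v y / norm (x - y) powr p - v y * (1 / norm (x - y0) powr p))"
      by (rule Bochner_Integration.integral_diff[OF int int2, symmetric])
    finally have "\<bar>potential p v x - 1 / norm (x - y0) powr p\<bar>
        = \<bar>LINT y|lebesgue. v y / norm (x - y) powr p - v y * (1 / norm (x - y0) powr p)\<bar>" by simp
    also have "\<dots> \<le> (LINT y|lebesgue. \<bar>v y / norm (x - y) powr p - v y * (1 / norm (x - y0) powr p)\<bar>)"
      by (rule integral_abs_bound)
    also have "\<dots> \<le> (LINT y|lebesgue. v y * e)"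
    proof (rule integral_mono)
      show "integrable lebesgue (\<lambda>y. \<bar>v y / norm (x - y) powr p - v y * (1 / norm (x - y0) powr p)\<bar>)"
        by (intro integrable_abs Bochner_Integration.integrable_diff int int2)
      show "integrable lebesgue (\<lambda>y. v y * e)" using v by simp
      fix y
      have "v y / norm (x - y) powr p - v y * (1 / norm (x - y0) powr p) = v y * (1 / norm (x - y) powr p - 1 / norm (x - y0) powr p)"
        by (simp add: right_diff_distrib)
      moreover have "0 \<le> v y" using m by (simp add: v_def)
      ultimately have "\<bar>v y / norm (x - y) powr p - v y * (1 / norm (x - y0) powr p)\<bar>
          = v y * \<bar>1 / norm (x - y) powr p - 1 / norm (x - y0) powr p\<bar>" by (simp only: abs_mult abs_of_nonneg)
      also have "\<dots> \<le> v y * e"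
      proof (cases "y \<in> ball y0 \<delta>")
        case True
        then show ?thesis using close[OF x True] \<open>0 \<le> v y\<close> by (intro mult_left_mono)
      qed (simp add: v_def)
      finally show "\<bar>v y / norm (x - y) powr p - v y * (1 / norm (x - y0) powr p)\<bar> \<le> v y * e" .
    qed
    also have "\<dots> = e" using one by simp
    finally show ?thesis .
  qed
  moreover have "v y = 0" if "norm y < 2 \<or> norm y0 + r < norm y" for y
  proof -
    have "norm y \<le> norm y0 + dist y0 y" using norm_triangle_sub[of y y0] by (simp add: dist_norm norm_minus_commute)
    then show ?thesis using that v(2) \<delta> by (auto simp: v_def)
  qed
  ultimately show "far_approximable p (\<lambda>x. 1 / norm (x - y0) powr p) e"
    using v(1) by (intro exI[of _ v] exI[of _ "norm y0 + r"]) auto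
qed

lemma far_potentials_dense:
  fixes g :: "real^'n::finite \<Rightarrow> real"
  assumes p: "real CARD('n) < p" and g: "continuous_on (cball 0 1) g" and e: "0 < e"
  obtains v R where "integrable lebesgue v" "\<And>y. norm y < 2 \<or> R < norm y \<Longrightarrow> v y = 0"
    "\<And>x. x \<in> cball 0 1 \<Longrightarrow> \<bar>potential p v x - g x\<bar> \<le> e"
proof -
  have p0: "0 \<le> p" using p by (meson of_nat_0_le_iff order.strict_implies_order order_trans)
  have "g \<in> far_potentials p"
  proof (rule riesz_kernels_dense[where \<rho> = 2 and c = "- p / 2", OF unif_closed_subspace_far_potentials[OF p0]])
    show "riesz (- p / 2) y \<in> far_potentials p" if "2 < norm y" for y :: "real^'n"
    proof -
      have "riesz (- p / 2) y = (\<lambda>x. 1 / norm (x - y) powr p)" by (rule ext) (rule riesz_norm)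
      then show ?thesis using kernel_in_far_potentials[OF p0 that] by simp
    qed
  qed (use p g in auto)
  then show ?thesis by (rule far_potentialsE[OF _ e]) (rule that)
qed

section \<open>Expansion of the kernel at infinity\<close>

lemma poly_deg_less_zero: "poly_deg_less k (\<lambda>x. 0)"
  unfolding poly_deg_less_def by (intro exI[of _ "\<lambda>_. 0"]) simp

lemma poly_deg_less_add:
  assumes "poly_deg_less k P" "poly_deg_less k Q"
  shows "poly_deg_less k (\<lambda>x. P x + Q x)"
proof -
  obtain c d where "\<And>x. P x = (\<Sum>\<alpha> | sum \<alpha> UNIV < k. c \<alpha> * (\<Prod>i\<in>UNIV. (x $ i) ^ \<alpha> i))"
    "\<And>x. Q x = (\<Sum>\<alpha> | sum \<alpha> UNIV < k. d \<alpha> * (\<Prod>i\<in>UNIV. (x $ i) ^ \<alpha> i))"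
    using assms unfolding poly_deg_less_def by blast
  then show ?thesis unfolding poly_deg_less_def
    by (intro exI[of _ "\<lambda>\<alpha>. c \<alpha> + d \<alpha>"]) (simp add: distrib_right sum.distrib)
qed

lemma poly_deg_less_scale:
  assumes "poly_deg_less k P" shows "poly_deg_less k (\<lambda>x. a * P x)"
proof -
  obtain c where "\<And>x. P x = (\<Sum>\<alpha> | sum \<alpha> UNIV < k. c \<alpha> * (\<Prod>i\<in>UNIV. (x $ i) ^ \<alpha> i))"
    using assms unfolding poly_deg_less_def by blast
  then show ?thesis unfolding poly_deg_less_def
    by (intro exI[of _ "\<lambda>\<alpha>. a * c \<alpha>"]) (simp add: sum_distrib_left mult.assoc)
qed

lemma poly_deg_less_mono:
  fixes P :: "real^'n::finite \<Rightarrow> real"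
  assumes "poly_deg_less k P" "k \<le> l" shows "poly_deg_less l P"
proof -
  obtain c where c: "\<And>x. P x = (\<Sum>\<alpha> | sum \<alpha> UNIV < k. c \<alpha> * (\<Prod>i\<in>UNIV. (x $ i) ^ \<alpha> i))"
    using assms unfolding poly_deg_less_def by blast
  have *: "P x = (\<Sum>\<alpha> | sum \<alpha> UNIV < l. (if sum \<alpha> UNIV < k then c \<alpha> else 0) * (\<Prod>i\<in>UNIV. (x $ i) ^ \<alpha> i))" for x
    unfolding c by (rule sum.mono_neutral_cong_left) (use assms(2) finite_exponents in auto)
  show ?thesis unfolding poly_deg_less_def by (rule exI, rule allI, rule *)
qed

lemma poly_deg_less_const: "poly_deg_less (Suc 0) (\<lambda>x::real^'n::finite. a)"
proof -
  have "{\<alpha> :: 'n \<Rightarrow> nat. sum \<alpha> UNIV < Suc 0} = {\<lambda>_. 0}" by (auto simp: fun_eq_iff)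
  then show ?thesis unfolding poly_deg_less_def by (intro exI[of _ "\<lambda>_. a"]) simp
qed

text \<open>
  The coefficients are shifted by one in the exponent of the coordinate \<open>j\<close>.
\<close>
lemma poly_deg_less_coordinate_mult:
  fixes P :: "real^'n::finite \<Rightarrow> real"
  assumes "poly_deg_less k P" shows "poly_deg_less (Suc k) (\<lambda>x. x $ j * P x)"
proof -
  obtain c where c: "\<And>x. P x = (\<Sum>\<alpha> | sum \<alpha> UNIV < k. c \<alpha> * (\<Prod>i\<in>UNIV. (x $ i) ^ \<alpha> i))"
    using assms unfolding poly_deg_less_def by blast
  have sum_upd: "sum (\<alpha>(j := b)) UNIV = sum \<alpha> UNIV - \<alpha> j + b" for \<alpha> :: "'n \<Rightarrow> nat" and b
  proof -
    have "sum (\<alpha>(j := b)) UNIV = b + sum \<alpha> (UNIV - {j})"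
      by (subst sum.remove[of UNIV j]) auto
    moreover have "sum \<alpha> UNIV = \<alpha> j + sum \<alpha> (UNIV - {j})" by (rule sum.remove) auto
    ultimately show ?thesis by simp
  qed
  have le: "\<alpha> j \<le> sum \<alpha> UNIV" for \<alpha> :: "'n \<Rightarrow> nat" by (rule member_le_sum) auto
  have mono: "x $ j * (\<Prod>i\<in>UNIV. (x $ i) ^ \<alpha> i) = (\<Prod>i\<in>UNIV. (x $ i) ^ (\<alpha>(j := Suc (\<alpha> j))) i)" for x :: "real^'n" and \<alpha>
  proof -
    have "(\<Prod>i\<in>UNIV. (x $ i) ^ (\<alpha>(j := Suc (\<alpha> j))) i) = (x $ j) ^ Suc (\<alpha> j) * (\<Prod>i\<in>UNIV - {j}. (x $ i) ^ \<alpha> i)"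
      by (subst prod.remove[of UNIV j]) auto
    moreover have "(\<Prod>i\<in>UNIV. (x $ i) ^ \<alpha> i) = (x $ j) ^ \<alpha> j * (\<Prod>i\<in>UNIV - {j}. (x $ i) ^ \<alpha> i)"
      by (rule prod.remove) auto
    ultimately show ?thesis by simp
  qed
  \<comment> \<open>monomials of the product without the factor \<open>x $ j\<close> get the coefficient \<open>0\<close>\<close>
  define c' where "c' \<beta> = (if \<beta> j = 0 then 0 else c (\<beta>(j := \<beta> j - 1)))" for \<beta>
  have "x $ j * P x = (\<Sum>\<beta> | sum \<beta> UNIV < Suc k. c' \<beta> * (\<Prod>i\<in>UNIV. (x $ i) ^ \<beta> i))" for x
  proof -
    have "x $ j * P x = (\<Sum>\<alpha> | sum \<alpha> UNIV < k. c \<alpha> * (\<Prod>i\<in>UNIV. (x $ i) ^ (\<alpha>(j := Suc (\<alpha> j))) i))"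
      unfolding c sum_distrib_left mono[symmetric] by (simp add: mult.left_commute)
    also have "\<dots> = (\<Sum>\<beta> | sum \<beta> UNIV < Suc k \<and> \<beta> j \<noteq> 0. c' \<beta> * (\<Prod>i\<in>UNIV. (x $ i) ^ \<beta> i))"
    proof (rule sum.reindex_bij_witness[where i = "\<lambda>\<beta>. \<beta>(j := \<beta> j - 1)" and j = "\<lambda>\<alpha>. \<alpha>(j := Suc (\<alpha> j))"])
      fix \<beta> :: "'n \<Rightarrow> nat" assume "\<beta> \<in> {\<beta>. sum \<beta> UNIV < Suc k \<and> \<beta> j \<noteq> 0}"
      then have "sum (\<beta>(j := \<beta> j - 1)) UNIV < k" unfolding sum_upd using le[of \<beta>] by auto
      then show "\<beta>(j := \<beta> j - 1) \<in> {\<alpha>. sum \<alpha> UNIV < k}" by (simp only: mem_Collect_eq simp_thms)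
    next
      fix \<alpha> :: "'n \<Rightarrow> nat" assume "\<alpha> \<in> {\<alpha>. sum \<alpha> UNIV < k}"
      then have "sum (\<alpha>(j := Suc (\<alpha> j))) UNIV < Suc k \<and> (\<alpha>(j := Suc (\<alpha> j))) j \<noteq> 0"
        unfolding sum_upd using le[of \<alpha>] by auto
      then show "\<alpha>(j := Suc (\<alpha> j)) \<in> {\<beta>. sum \<beta> UNIV < Suc k \<and> \<beta> j \<noteq> 0}" by (simp only: mem_Collect_eq simp_thms)
    qed (auto simp: c'_def)
    also have "\<dots> = (\<Sum>\<beta> | sum \<beta> UNIV < Suc k. c' \<beta> * (\<Prod>i\<in>UNIV. (x $ i) ^ \<beta> i))"
      by (rule sum.mono_neutral_left) (use finite_exponents[of "Suc k"] in \<open>auto simp: c'_def\<close>)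
    finally show ?thesis .
  qed
  then show ?thesis unfolding poly_deg_less_def by blast
qed

text \<open>
  Sums of products of a polynomial in \<open>x\<close> and a function of \<open>y\<close> that is
  bounded off the unit ball: the form in which integration over \<open>y\<close> visibly yields a
  polynomial of bounded degree.
\<close>
inductive separable_kernel :: "nat \<Rightarrow> (real^'n::finite \<Rightarrow> real^'n \<Rightarrow> real) \<Rightarrow> bool" for k where
  prod: "poly_deg_less k P \<Longrightarrow> a \<in> borel_measurable borel \<Longrightarrow> (\<And>y. 1 \<le> norm y \<Longrightarrow> \<bar>a y\<bar> \<le> B) \<Longrightarrow>
    separable_kernel k (\<lambda>x y. a y * P x)"
| add: "separable_kernel k S \<Longrightarrow> separable_kernel k T \<Longrightarrow> separable_kernel k (\<lambda>x y. S x y + T x y)"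

lemma separable_kernel_mono:
  assumes "separable_kernel k T" "k \<le> l" shows "separable_kernel l T"
  using assms(1) by induction (auto intro: separable_kernel.intros poly_deg_less_mono[OF _ assms(2)])

lemma separable_kernel_zero: "separable_kernel k (\<lambda>x y. 0)"
  using separable_kernel.prod[OF poly_deg_less_zero, of "\<lambda>_. 0" 0] by simp

lemma separable_kernel_sum:
  "finite I \<Longrightarrow> (\<And>i. i \<in> I \<Longrightarrow> separable_kernel k (T i)) \<Longrightarrow> separable_kernel k (\<lambda>x y. \<Sum>i\<in>I. T i x y)"
  by (induction I rule: finite_induct) (auto simp: separable_kernel_zero intro: separable_kernel.add)

lemma separable_kernel_weight:
  assumes "separable_kernel k T" "b \<in> borel_measurable borel" "\<And>y. 1 \<le> norm y \<Longrightarrow> \<bar>b y\<bar> \<le> C"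
  shows "separable_kernel k (\<lambda>x y. b y * T x y)"
  using assms(1)
proof induction
  case (prod P a B)
  have "separable_kernel k (\<lambda>x y. (b y * a y) * P x)"
  proof (rule separable_kernel.prod[where B = "C * B"])
    show "\<bar>b y * a y\<bar> \<le> C * B" if "1 \<le> norm y" for y
      unfolding abs_mult using assms(3)[OF that] prod(3)[OF that] by (intro mult_mono) auto
  qed (use prod assms(2) in auto)
  then show ?case by (simp add: mult.assoc)
next
  case (add S T)
  then show ?case using separable_kernel.add by (simp add: distrib_left)
qed

lemma separable_kernel_coordinate:
  assumes "separable_kernel k T"
  shows "separable_kernel (Suc k) (\<lambda>x y. x $ i * T x y)"
  using assms
proof induction
  case (prod P a B)
  have "separable_kernel (Suc k) (\<lambda>x y. a y * (x $ i * P x))"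
    by (rule separable_kernel.prod[OF poly_deg_less_coordinate_mult[OF prod(1)] prod(2,3)])
  then show ?case by (simp add: mult.left_commute)
next
  case (add S T)
  then show ?case using separable_kernel.add by (simp add: distrib_left)
qed

lemma separable_kernel_inner:
  assumes "separable_kernel k T"
  shows "separable_kernel (Suc k) (\<lambda>x y. (x \<bullet> y / (norm y)\<^sup>2) * T x y)"
proof -
  have "separable_kernel (Suc k) (\<lambda>x y. \<Sum>i\<in>UNIV. (y $ i / (norm y)\<^sup>2) * (x $ i * T x y))"
  proof (intro separable_kernel_sum separable_kernel_weight separable_kernel_coordinate assms)
    fix i and y :: "real^'a" assume y: "1 \<le> norm y"
    have "\<bar>y $ i\<bar> \<le> (norm y)\<^sup>2" using component_le_norm_cart[of y i] y by (smt (verit) self_le_power pos2)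
    then show "\<bar>y $ i / (norm y)\<^sup>2\<bar> \<le> 1" using y by (simp add: divide_le_eq)
  qed auto
  moreover have "(\<Sum>i\<in>UNIV. (y $ i / (norm y)\<^sup>2) * (x $ i * T x y)) = (x \<bullet> y / (norm y)\<^sup>2) * T x y" for x y
    unfolding inner_vec_def inner_real_def sum_divide_distrib sum_distrib_right
    by (intro sum.cong refl) (simp add: mult_ac)
  ultimately show ?thesis by simp
qed

lemma separable_kernel_norm:
  assumes "separable_kernel k T"
  shows "separable_kernel (Suc (Suc k)) (\<lambda>x y. ((norm x)\<^sup>2 / (norm y)\<^sup>2) * T x y)"
proof -
  have "separable_kernel (Suc (Suc k)) (\<lambda>x y. \<Sum>i\<in>UNIV. (1 / (norm y)\<^sup>2) * (x $ i * (x $ i * T x y)))"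
  proof (intro separable_kernel_sum separable_kernel_weight separable_kernel_coordinate assms)
    fix y :: "real^'a" assume "1 \<le> norm y"
    then show "\<bar>1 / (norm y)\<^sup>2\<bar> \<le> 1" by (simp add: divide_le_eq one_le_power)
  qed auto
  moreover have "(\<Sum>i\<in>UNIV. (1 / (norm y)\<^sup>2) * (x $ i * (x $ i * T x y))) = ((norm x)\<^sup>2 / (norm y)\<^sup>2) * T x y" for x y
  proof -
    have "(norm x)\<^sup>2 = (\<Sum>i\<in>UNIV. x $ i * x $ i)" by (simp add: power2_norm_eq_inner inner_vec_def)
    then have "((norm x)\<^sup>2 / (norm y)\<^sup>2) * T x y = (\<Sum>i\<in>UNIV. x $ i * x $ i / (norm y)\<^sup>2 * T x y)"
      by (simp only: sum_divide_distrib sum_distrib_right)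
    then show ?thesis by (simp add: mult_ac)
  qed
  ultimately show ?thesis by simp
qed

text \<open>
  This turns the Taylor part of the kernel into admissible polynomials. Integrability is proved
  along with it because the inductive step splits the integral.
\<close>
lemma separable_kernel_integral:
  fixes U :: "real^'n::finite \<Rightarrow> real"
  assumes T: "separable_kernel k T" and U: "integrable lebesgue U" "\<And>y. norm y < 1 \<Longrightarrow> U y = 0"
  shows "(\<forall>x. integrable lebesgue (\<lambda>y. U y * T x y)) \<and> poly_deg_less k (\<lambda>x. LINT y|lebesgue. U y * T x y)"
  using T
proof induction
  case (prod P a B)
  have [measurable]: "a \<in> borel_measurable lebesgue" "U \<in> borel_measurable lebesgue"
    using prod(2) U(1) by (auto intro: measurable_completion)
  have int: "integrable lebesgue (\<lambda>y. U y * a y)"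
  proof (rule Bochner_Integration.integrable_bound)
    show "integrable lebesgue (\<lambda>y. \<bar>B\<bar> * \<bar>U y\<bar>)" using U by simp
    have "\<bar>U y\<bar> * \<bar>a y\<bar> \<le> \<bar>U y\<bar> * \<bar>B\<bar>" for y
    proof (cases "norm y < 1")
      case False
      then show ?thesis using prod(3)[of y] by (intro mult_left_mono) auto
    qed (simp add: U)
    then show "AE y in lebesgue. norm (U y * a y) \<le> norm (\<bar>B\<bar> * \<bar>U y\<bar>)" by (simp add: abs_mult mult.commute)
  qed measurable
  have "poly_deg_less k (\<lambda>x. (LINT y|lebesgue. U y * a y) * P x)" by (rule poly_deg_less_scale[OF prod(1)])
  then show ?case using int by (simp flip: mult.assoc)
next
  case (add S T)
  then show ?case by (auto simp: distrib_left intro!: poly_deg_less_add)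
qed

lemma separable_kernel_measurable:
  assumes "separable_kernel k T" shows "T x \<in> borel_measurable borel"
  using assms by induction auto

lemma binomial_remainder:
  fixes a :: real
  obtains C where "0 \<le> C" "\<And>t. \<bar>t\<bar> \<le> 1/2 \<Longrightarrow> \<bar>(1 + t) powr a - (\<Sum>i<k. (a gchoose i) * t ^ i)\<bar> \<le> C * \<bar>t\<bar> ^ k"
proof
  have abs_sm: "summable (\<lambda>n. \<bar>a gchoose n\<bar> * (1/2) ^ n)"
  proof -
    have "summable (\<lambda>n. norm ((a gchoose n) * (1/2) ^ n))"
      by (rule powser_insidea[of _ "3/4"]) (use gen_binomial_real[of "3/4" a] in \<open>auto simp: sums_iff\<close>)
    then show ?thesis by (simp add: abs_mult)
  qed
  define C where "C = (\<Sum>n. \<bar>a gchoose (n + k)\<bar> * (1/2) ^ n)"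
  have sm: "summable (\<lambda>n. \<bar>a gchoose (n + k)\<bar> * (1/2) ^ n)"
  proof -
    have "summable (\<lambda>n. 2 ^ k * (\<bar>a gchoose (n + k)\<bar> * (1/2) ^ (n + k)))"
      using abs_sm summable_iff_shift[of "\<lambda>n. \<bar>a gchoose n\<bar> * (1/2) ^ n" k] by (intro summable_mult) simp
    then show ?thesis by (simp add: power_add field_simps)
  qed
  show "0 \<le> C" unfolding C_def by (rule suminf_nonneg[OF sm]) auto
  fix t :: real assume t: "\<bar>t\<bar> \<le> 1/2"
  have s: "(\<lambda>n. (a gchoose n) * t ^ n) sums (1 + t) powr a" by (rule gen_binomial_real) (use t in auto)
  have "(1 + t) powr a - (\<Sum>i<k. (a gchoose i) * t ^ i) = (\<Sum>n. (a gchoose (n + k)) * t ^ (n + k))"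
    using suminf_minus_initial_segment[OF sums_summable[OF s], of k] sums_unique[OF s] by simp
  also have "norm \<dots> \<le> (\<Sum>n. \<bar>t\<bar> ^ k * (\<bar>a gchoose (n + k)\<bar> * (1/2) ^ n))"
  proof -
    have le: "norm ((a gchoose (n + k)) * t ^ (n + k)) \<le> \<bar>t\<bar> ^ k * (\<bar>a gchoose (n + k)\<bar> * (1/2) ^ n)" for n
    proof -
      have "\<bar>t\<bar> ^ n \<le> (1/2) ^ n" using t by (intro power_mono) auto
      then have "\<bar>t\<bar> ^ k * (\<bar>a gchoose (n + k)\<bar> * \<bar>t\<bar> ^ n) \<le> \<bar>t\<bar> ^ k * (\<bar>a gchoose (n + k)\<bar> * (1/2) ^ n)"
        by (intro mult_left_mono) auto
      then show ?thesis by (simp add: abs_mult power_abs power_add mult_ac)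
    qed
    show ?thesis by (rule norm_suminf_le[OF le summable_mult[OF sm]])
  qed
  also have "\<dots> = \<bar>t\<bar> ^ k * C" unfolding C_def by (rule suminf_mult[OF sm])
  finally have "norm ((1 + t) powr a - (\<Sum>i<k. (a gchoose i) * t ^ i)) \<le> \<bar>t\<bar> ^ k * C" .
  then show "\<bar>(1 + t) powr a - (\<Sum>i<k. (a gchoose i) * t ^ i)\<bar> \<le> C * \<bar>t\<bar> ^ k" by (simp add: mult.commute)
qed

text \<open>
  The binomial expansion of the kernel in \<open>\<tau> = (|x|\<^sup>2 - 2 * (x \<bullet> y)) /
  |y|\<^sup>2\<close>, from which the terms of degree at least \<open>k\<close> in \<open>x\<close>
  are dropped: a term with \<open>j\<close> factors \<open>|x|\<^sup>2\<close> and \<open>i -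
  j\<close> factors \<open>x \<bullet> y\<close> has degree \<open>i + j\<close>.
\<close>
definition taylor_kernel :: "nat \<Rightarrow> real \<Rightarrow> real^'n::finite \<Rightarrow> real^'n \<Rightarrow> real" where
  "taylor_kernel k p x y = (\<Sum>i<k. (- p / 2 gchoose i) * (\<Sum>j\<in>{j. j \<le> i \<and> i + j < k}.
     real (i choose j) * (-2) ^ (i - j) * (((norm x)\<^sup>2 / (norm y)\<^sup>2) ^ j * ((x \<bullet> y / (norm y)\<^sup>2) ^ (i - j) * (1 / norm y powr p)))))"

lemma separable_taylor_kernel:
  fixes p :: real
  assumes "0 \<le> p"
  shows "separable_kernel k (taylor_kernel k p :: real^'n::finite \<Rightarrow> real^'n \<Rightarrow> real)"
proof -
  have base: "separable_kernel (Suc 0) (\<lambda>(x::real^'n) y. 1 / norm y powr p)"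
  proof -
    have "separable_kernel (Suc 0) (\<lambda>(x::real^'n) y. (1 / norm y powr p) * 1)"
    proof (rule separable_kernel.prod[OF poly_deg_less_const])
      show "\<bar>1 / norm y powr p\<bar> \<le> 1" if "1 \<le> norm y" for y :: "real^'n"
        using ge_one_powr_ge_zero[OF that assms] by (simp add: divide_le_eq_1)
    qed auto
    then show ?thesis by simp
  qed
  have inner: "separable_kernel (Suc l) (\<lambda>(x::real^'n) y. (x \<bullet> y / (norm y)\<^sup>2) ^ l * (1 / norm y powr p))" for l
  proof (induction l)
    case (Suc l)
    then show ?case using separable_kernel_inner[OF Suc] by (simp add: mult.assoc)
  qed (use base in simp)
  have both: "separable_kernel (Suc l + 2 * j) (\<lambda>(x::real^'n) y. ((norm x)\<^sup>2 / (norm y)\<^sup>2) ^ j * ((x \<bullet> y / (norm y)\<^sup>2) ^ l * (1 / norm y powr p)))" for l j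
  proof (induction j)
    case (Suc j)
    then show ?case using separable_kernel_norm[OF Suc] by (simp add: mult.assoc)
  qed (use inner in simp)
  have const: "separable_kernel k (\<lambda>x y. c * T x y)" if "separable_kernel k T" for c and T :: "real^'n \<Rightarrow> real^'n \<Rightarrow> real"
    by (rule separable_kernel_weight[OF that, of "\<lambda>_. c" "\<bar>c\<bar>"]) auto
  show ?thesis
    unfolding taylor_kernel_def[abs_def]
    by (intro separable_kernel_sum const separable_kernel_mono[OF both]) auto
qed

abbreviation taylor_remainder :: "nat \<Rightarrow> real \<Rightarrow> real^'n::finite \<Rightarrow> real^'n \<Rightarrow> real" where
  "taylor_remainder k p x y \<equiv> 1 / norm (x - y) powr p - taylor_kernel k p x y"

text \<open>
  With \<open>\<tau> = (|x|\<^sup>2 - 2 * (x \<bullet> y)) / |y|\<^sup>2\<close> the kernel is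
  \<open>(1 + \<tau>) powr (- p / 2) / |y|\<^sup>p\<close>, and \<open>|\<tau>| \<le> 3 / |y| \<le>
  1 / 2\<close>. The binomial series cut at order \<open>k\<close> leaves
  \<open>O(|\<tau>|\<^sup>k)\<close>. The powers \<open>\<tau>\<^sup>i\<close> with \<open>i <
  k\<close> still contain terms of degree \<open>k\<close> or more in \<open>x\<close>; a term of
  degree \<open>i + j\<close> in \<open>x\<close> has size
  \<open>O(|y|\<^sup>-\<^sup>i\<^sup>-\<^sup>j)\<close>, so these belong to the remainder as well.
\<close>
lemma taylor_kernel_remainder:
  fixes p :: real
  assumes p: "0 \<le> p"
  obtains C where "0 \<le> C" "\<And>x y :: real^'n::finite. norm x \<le> 1 \<Longrightarrow> 6 \<le> norm y \<Longrightarrow>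
    \<bar>taylor_remainder k p x y\<bar> \<le> C / norm y powr (p + real k)"
proof -
  obtain C1 where C1: "0 \<le> C1"
    "\<And>t. \<bar>t\<bar> \<le> 1/2 \<Longrightarrow> \<bar>(1 + t) powr (- p / 2) - (\<Sum>i<k. (- p / 2 gchoose i) * t ^ i)\<bar> \<le> C1 * \<bar>t\<bar> ^ k"
    by (rule binomial_remainder[where a = "- p / 2" and k = k]) (rule that)
  define C2 where "C2 = (\<Sum>i<k. \<bar>- p / 2 gchoose i\<bar> * (\<Sum>j\<in>{j. j \<le> i \<and> k \<le> i + j}. real (i choose j) * 2 ^ (i - j)))"
  have C2: "0 \<le> C2" unfolding C2_def by (intro sum_nonneg mult_nonneg_nonneg) auto
  show ?thesis
  proof (rule that[of "C1 * 3 ^ k + C2"])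
    show "0 \<le> C1 * 3 ^ k + C2" using C1 C2 by simp
    fix x y :: "real^'n" assume x: "norm x \<le> 1" and y: "6 \<le> norm y"
    define \<rho> where "\<rho> = 1 / norm y"
    have \<rho>: "0 < \<rho>" "\<rho> \<le> 1 / 6" using y by (auto simp: \<rho>_def divide_simps)
    define A where "A = (norm x)\<^sup>2 / (norm y)\<^sup>2"
    define b where "b = x \<bullet> y / (norm y)\<^sup>2"
    define \<tau> where "\<tau> = A + -2 * b"
    have A: "0 \<le> A" "A \<le> \<rho>\<^sup>2"
      using x y by (auto simp: A_def \<rho>_def power_divide power_le_one intro!: divide_right_mono)
    have b: "\<bar>b\<bar> \<le> \<rho>"
    proof -
      have "\<bar>x \<bullet> y\<bar> \<le> norm x * norm y" by (rule Cauchy_Schwarz_ineq2)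
      also have "\<dots> \<le> 1 * norm y" using x by (intro mult_right_mono) auto
      finally have "\<bar>x \<bullet> y\<bar> / (norm y)\<^sup>2 \<le> norm y / (norm y)\<^sup>2" by (intro divide_right_mono) auto
      moreover have "y \<noteq> 0" using y by auto
      ultimately show ?thesis by (simp add: b_def \<rho>_def power2_eq_square)
    qed
    have \<tau>: "\<bar>\<tau>\<bar> \<le> 3 * \<rho>"
    proof -
      have "\<rho>\<^sup>2 \<le> \<rho> * 1" unfolding power2_eq_square using \<rho> by (intro mult_left_mono) auto
      then have "A \<le> \<rho>" using A by linarith
      then show ?thesis using A b unfolding \<tau>_def by linarith
    qed
    then have \<tau>2: "\<bar>\<tau>\<bar> \<le> 1 / 2" using \<rho> by linarith
    have nz: "norm y > 0" using y by linarith
    have "(norm (x - y))\<^sup>2 = (norm y)\<^sup>2 * (1 + \<tau>)"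
      using nz by (simp add: \<tau>_def A_def b_def power2_norm_eq_inner inner_diff inner_commute field_simps)
    moreover have "norm (x - y) > 0" using x y by auto
    ultimately have kernel: "1 / norm (x - y) powr p = (1 + \<tau>) powr (- p / 2) * (1 / norm y powr p)"
    proof -
      assume sq: "(norm (x - y))\<^sup>2 = (norm y)\<^sup>2 * (1 + \<tau>)" and pos: "norm (x - y) > 0"
      have half: "1 / r powr p = (r\<^sup>2) powr (- p / 2)" if "r > 0" for r :: real
        using that by (simp add: powr_minus_divide powr_powr flip: powr_numeral)
      have "1 / norm (x - y) powr p = ((norm y)\<^sup>2 * (1 + \<tau>)) powr (- p / 2)"
        using half[OF pos] sq by simp
      also have "\<dots> = (1 + \<tau>) powr (- p / 2) * (1 / norm y powr p)"
        using half[OF nz] \<tau>2 by (subst powr_mult) auto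
      finally show ?thesis .
    qed
    let ?P = "\<Sum>i<k. (- p / 2 gchoose i) * \<tau> ^ i"
    \<comment> \<open>the terms of the cut binomial series that have degree at least \<open>k\<close> in \<open>x\<close>\<close>
    let ?S = "\<Sum>i<k. (- p / 2 gchoose i) * (\<Sum>j\<in>{j. j \<le> i \<and> k \<le> i + j}. real (i choose j) * (-2) ^ (i - j) * (A ^ j * b ^ (i - j)))"
    have split: "?P * (1 / norm y powr p) - taylor_kernel k p x y
       = ?S
         * (1 / norm y powr p)"
    proof -
      have "\<tau> ^ i = (\<Sum>j\<in>{j. j \<le> i \<and> i + j < k}. real (i choose j) * (-2) ^ (i - j) * (A ^ j * b ^ (i - j)))
          + (\<Sum>j\<in>{j. j \<le> i \<and> k \<le> i + j}. real (i choose j) * (-2) ^ (i - j) * (A ^ j * b ^ (i - j)))" for i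
      proof -
        have "\<tau> ^ i = (\<Sum>j\<le>i. real (i choose j) * A ^ j * (-2 * b) ^ (i - j))"
          unfolding \<tau>_def by (rule binomial_ring)
        also have "\<dots> = (\<Sum>j\<le>i. real (i choose j) * (-2) ^ (i - j) * (A ^ j * b ^ (i - j)))"
          by (intro sum.cong refl) (simp only: power_mult_distrib mult_ac)
        also have "{..i} = {j. j \<le> i \<and> i + j < k} \<union> {j. j \<le> i \<and> k \<le> i + j}" by auto
        finally show ?thesis by (subst (asm) sum.union_disjoint) auto
      qed
      moreover have "taylor_kernel k p x y = (\<Sum>i<k. (- p / 2 gchoose i) * (\<Sum>j\<in>{j. j \<le> i \<and> i + j < k}.
          real (i choose j) * (-2) ^ (i - j) * (A ^ j * b ^ (i - j)))) * (1 / norm y powr p)"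
        unfolding taylor_kernel_def A_def[symmetric] b_def[symmetric]
        by (simp only: sum_distrib_right mult.assoc)
      ultimately show ?thesis by (simp only: distrib_left sum.distrib distrib_right add_diff_cancel_left')
    qed
    have tail: "\<bar>?S\<bar>
        \<le> C2 * \<rho> ^ k"
    proof -
      have "\<bar>real (i choose j) * (-2) ^ (i - j) * (A ^ j * b ^ (i - j))\<bar> \<le> real (i choose j) * 2 ^ (i - j) * \<rho> ^ k"
        if ij: "j \<le> i" "k \<le> i + j" for i j
      proof -
        have "A ^ j * \<bar>b\<bar> ^ (i - j) \<le> (\<rho>\<^sup>2) ^ j * \<rho> ^ (i - j)"
          using A b \<rho> by (intro mult_mono power_mono) auto
        also have "\<dots> = \<rho> ^ (i + j)" using ij by (simp add: add.commute flip: power_mult power_add)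
        also have "\<dots> \<le> \<rho> ^ k" using ij \<rho> by (intro power_decreasing) auto
        finally have "A ^ j * \<bar>b\<bar> ^ (i - j) \<le> \<rho> ^ k" .
        then have "real (i choose j) * 2 ^ (i - j) * (A ^ j * \<bar>b\<bar> ^ (i - j)) \<le> real (i choose j) * 2 ^ (i - j) * \<rho> ^ k"
          by (intro mult_left_mono) auto
        then show ?thesis using A by (simp add: abs_mult power_abs)
      qed
      then have "\<bar>?S\<bar>
        \<le> (\<Sum>i<k. \<bar>- p / 2 gchoose i\<bar> * (\<Sum>j\<in>{j. j \<le> i \<and> k \<le> i + j}. real (i choose j) * 2 ^ (i - j) * \<rho> ^ k))"
        by (intro order_trans[OF sum_abs] sum_mono) (auto simp: abs_mult intro!: mult_left_mono order_trans[OF sum_abs] sum_mono)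
      also have "\<dots> = C2 * \<rho> ^ k" by (simp add: C2_def sum_distrib_left sum_distrib_right mult.assoc)
      finally show ?thesis .
    qed
    have main: "\<bar>(1 + \<tau>) powr (- p / 2) - ?P\<bar> \<le> C1 * 3 ^ k * \<rho> ^ k"
    proof -
      have "\<bar>\<tau>\<bar> ^ k \<le> (3 * \<rho>) ^ k" using \<tau> by (intro power_mono) auto
      then have "C1 * \<bar>\<tau>\<bar> ^ k \<le> C1 * (3 ^ k * \<rho> ^ k)" using C1(1) by (intro mult_left_mono) (auto simp: power_mult_distrib)
      then show ?thesis using C1(2)[OF \<tau>2] by (simp add: mult.assoc)
    qed
    have pos: "0 < 1 / norm y powr p" using nz by simp
    have "taylor_remainder k p x y
      = (((1 + \<tau>) powr (- p / 2) - ?P) +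
        ?S)
        * (1 / norm y powr p)"
      unfolding kernel distrib_right split[symmetric] left_diff_distrib by simp
    then have "\<bar>taylor_remainder k p x y\<bar> = \<bar>((1 + \<tau>) powr (- p / 2) - ?P) +
        ?S\<bar>
        * (1 / norm y powr p)"
      by (simp only: abs_mult abs_of_pos[OF pos])
    also have "\<dots> \<le> (C1 * 3 ^ k * \<rho> ^ k + C2 * \<rho> ^ k) * (1 / norm y powr p)"
      using main tail pos by (intro mult_right_mono order_trans[OF abs_triangle_ineq] add_mono) auto
    also have "\<dots> = (C1 * 3 ^ k + C2) / norm y powr (p + real k)"
      using nz by (simp add: \<rho>_def powr_add powr_realpow power_one_over field_simps)
    finally show "\<bar>taylor_remainder k p x y\<bar> \<le> (C1 * 3 ^ k + C2) / norm y powr (p + real k)" .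
  qed
qed

text \<open>
  The truncations of \<open>U\<close> to balls of radius \<open>R\<close> have ordinary potentials,
  which may diverge as \<open>R\<close> grows. Subtracting the polynomial produced by the Taylor
  part of the kernel leaves integrals dominated by a multiple of \<open>|U y| /
  |y|\<^sup>p\<^sup>+\<^sup>k\<close>, which converge.
\<close>
lemma far_field_convergence:
  fixes U :: "real^'n::finite \<Rightarrow> real"
  assumes p: "0 \<le> p"
    and C: "\<And>x y :: real^'n. norm x \<le> 1 \<Longrightarrow> 6 \<le> norm y \<Longrightarrow>
      \<bar>taylor_remainder k p x y\<bar> \<le> C / norm y powr (p + real k)"
    and U: "U \<in> borel_measurable lebesgue" "\<And>y. norm y < 6 \<Longrightarrow> U y = 0"
      "integrable lebesgue (\<lambda>y. \<bar>U y\<bar> / norm y powr (p + real k))"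
  defines "T \<equiv> \<lambda>x. LINT y|lebesgue. U y * taylor_remainder k p x y"
  shows "integrable lebesgue (\<lambda>y. indicator (ball 0 R) y * U y)"
    and "poly_deg_less k (\<lambda>x. LINT y|lebesgue. (indicator (ball 0 R) y * U y) * taylor_kernel k p x y)"
    and "norm x \<le> 1 \<Longrightarrow> ((\<lambda>R. potential p (\<lambda>y. indicator (ball 0 R) y * U y) x
      - (LINT y|lebesgue. (indicator (ball 0 R) y * U y) * taylor_kernel k p x y)) \<longlongrightarrow> T x) at_top"
    and "norm x \<le> 1 \<Longrightarrow> \<bar>T x\<bar> \<le> C * (LINT y|lebesgue. \<bar>U y\<bar> / norm y powr (p + real k))"
proof -
  note U(1)[measurable]
  have [measurable]: "ball (0::real^'n) r \<in> sets lebesgue" for r by simp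
  have km [measurable]: "(\<lambda>y. norm (x - y) powr p) \<in> borel_measurable lebesgue" for x :: "real^'n"
    by (rule measurable_completion) simp
  have tm [measurable]: "taylor_kernel k p x \<in> borel_measurable lebesgue" for x :: "real^'n"
    by (rule measurable_completion) (simp add: separable_kernel_measurable[OF separable_taylor_kernel[OF p]])
  show int: "integrable lebesgue (\<lambda>y. indicator (ball 0 R) y * U y)" for R
  proof (rule Bochner_Integration.integrable_bound)
    show "integrable lebesgue (\<lambda>y. \<bar>R\<bar> powr (p + real k) * (\<bar>U y\<bar> / norm y powr (p + real k)))"
      using U(3) by (rule integrable_mult_right)
    have "\<bar>indicator (ball 0 R) y * U y\<bar> \<le> \<bar>R\<bar> powr (p + real k) * (\<bar>U y\<bar> / norm y powr (p + real k))" for y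
    proof (cases "norm y < R \<and> U y \<noteq> 0")
      case True
      then have y: "6 \<le> norm y" using U(2)[of y] by force
      have "norm y powr (p + real k) \<le> \<bar>R\<bar> powr (p + real k)" using True p by (intro powr_mono2) auto
      then have "\<bar>U y\<bar> * norm y powr (p + real k) \<le> \<bar>U y\<bar> * \<bar>R\<bar> powr (p + real k)" by (intro mult_left_mono) auto
      moreover have "0 < norm y powr (p + real k)" using y by auto
      ultimately show ?thesis using True by (simp add: pos_le_divide_eq mult.commute)
    qed (auto simp: indicator_def)
    then show "AE y in lebesgue. norm (indicator (ball 0 R) y * U y) \<le> norm (\<bar>R\<bar> powr (p + real k) * (\<bar>U y\<bar> / norm y powr (p + real k)))"
      by (intro AE_I2) (simp only: real_norm_def abs_mult abs_divide abs_abs abs_of_nonneg[OF powr_ge_zero])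
  qed measurable
  have small: "indicator (ball 0 R) y * U y = 0" if "norm y < 2" for R y using U(2)[of y] that by simp
  have small1: "indicator (ball 0 R) y * U y = 0" if "norm y < 1" for R y using U(2)[of y] that by simp
  note sep = separable_kernel_integral[OF separable_taylor_kernel[OF p, of k] int small1]
  show "poly_deg_less k (\<lambda>x. LINT y|lebesgue. (indicator (ball 0 R) y * U y) * taylor_kernel k p x y)"
    using sep[of R] by (rule conjunct2)
  have bound: "\<bar>U y * taylor_remainder k p x y\<bar> \<le> C * (\<bar>U y\<bar> / norm y powr (p + real k))"
    if "norm x \<le> 1" for x y
  proof (cases "norm y < 6")
    case False
    then have "\<bar>U y\<bar> * \<bar>taylor_remainder k p x y\<bar> \<le> \<bar>U y\<bar> * (C / norm y powr (p + real k))"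
      by (intro mult_left_mono C that) auto
    then show ?thesis by (simp add: abs_mult mult.commute)
  qed (simp add: U(2))
  have intC: "integrable lebesgue (\<lambda>y. C * (\<bar>U y\<bar> / norm y powr (p + real k)))"
    using U(3) by (rule integrable_mult_right)
  show "\<bar>T x\<bar> \<le> C * (LINT y|lebesgue. \<bar>U y\<bar> / norm y powr (p + real k))" if x: "norm x \<le> 1"
  proof -
    have "\<bar>T x\<bar> \<le> (LINT y|lebesgue. \<bar>U y * taylor_remainder k p x y\<bar>)"
      unfolding T_def by (rule integral_abs_bound)
    also have "\<dots> \<le> (LINT y|lebesgue. C * (\<bar>U y\<bar> / norm y powr (p + real k)))"
    proof (rule integral_mono[OF _ intC bound[OF x]])
      show "integrable lebesgue (\<lambda>y. \<bar>U y * taylor_remainder k p x y\<bar>)"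
      proof (rule Bochner_Integration.integrable_bound[OF intC])
        show "AE y in lebesgue. norm \<bar>U y * taylor_remainder k p x y\<bar> \<le> norm (C * (\<bar>U y\<bar> / norm y powr (p + real k)))"
          by (rule AE_I2) (use bound[OF x] in \<open>simp only: real_norm_def abs_abs order_trans[OF _ abs_ge_self]\<close>)
      qed measurable
    qed
    also have "\<dots> = C * (LINT y|lebesgue. \<bar>U y\<bar> / norm y powr (p + real k))" by (rule integral_mult_right_zero)
    finally show ?thesis .
  qed
  show "((\<lambda>R. potential p (\<lambda>y. indicator (ball 0 R) y * U y) x
      - (LINT y|lebesgue. (indicator (ball 0 R) y * U y) * taylor_kernel k p x y)) \<longlongrightarrow> T x) at_top"
    if x: "norm x \<le> 1"
  proof -
    have "((\<lambda>R. LINT y|lebesgue. indicator (ball 0 R) y * (U y * taylor_remainder k p x y)) \<longlongrightarrow> T x) at_top"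
      unfolding T_def
    proof (rule integral_dominated_convergence_at_top[OF _ _ intC])
      show "AE y in lebesgue. ((\<lambda>R. indicator (ball 0 R) y * (U y * taylor_remainder k p x y))
          \<longlongrightarrow> U y * taylor_remainder k p x y) at_top"
      proof (rule AE_I2)
        fix y
        have "\<forall>\<^sub>F R in at_top. indicator (ball 0 R) y * (U y * taylor_remainder k p x y)
            = U y * taylor_remainder k p x y"
          using eventually_gt_at_top[of "norm y"] by eventually_elim simp
        then show "((\<lambda>R. indicator (ball 0 R) y * (U y * taylor_remainder k p x y))
          \<longlongrightarrow> U y * taylor_remainder k p x y) at_top" by (rule tendsto_eventually)
      qed
      show "\<forall>\<^sub>F R in at_top. AE y in lebesgue. norm (indicator (ball 0 R) y * (U y * taylor_remainder k p x y))
          \<le> C * (\<bar>U y\<bar> / norm y powr (p + real k))"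
      proof (rule always_eventually, rule allI, rule AE_I2)
        fix R y
        have "norm (indicator (ball 0 R) y * (U y * taylor_remainder k p x y))
            \<le> \<bar>U y * taylor_remainder k p x y\<bar>"
          by (simp add: indicator_def)
        also have "\<dots> \<le> C * (\<bar>U y\<bar> / norm y powr (p + real k))" by (rule bound[OF x])
        finally show "norm (indicator (ball 0 R) y * (U y * taylor_remainder k p x y))
          \<le> C * (\<bar>U y\<bar> / norm y powr (p + real k))" .
      qed
    qed measurable
    moreover have "(LINT y|lebesgue. indicator (ball 0 R) y * (U y * taylor_remainder k p x y))
      = potential p (\<lambda>y. indicator (ball 0 R) y * U y) x
      - (LINT y|lebesgue. (indicator (ball 0 R) y * U y) * taylor_kernel k p x y)" for R
    proof -
      have "indicator (ball 0 R) y * (U y * taylor_remainder k p x y)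
        = (indicator (ball 0 R) y * U y) / norm (x - y) powr p - (indicator (ball 0 R) y * U y) * taylor_kernel k p x y" for y
        by (simp add: right_diff_distrib mult.assoc)
      moreover have "integrable lebesgue (\<lambda>y. (indicator (ball 0 R) y * U y) / norm (x - y) powr p)"
        by (rule integrable_far_potential[OF int small x p])
      moreover have "integrable lebesgue (\<lambda>y. (indicator (ball 0 R) y * U y) * taylor_kernel k p x y)"
        using sep[of R] by blast
      ultimately show ?thesis by (simp only: Bochner_Integration.integral_diff)
    qed
    ultimately show ?thesis by simp
  qed
qed

lemma poly_deg_less_continuous:
  assumes "poly_deg_less k P" shows "continuous_on S P"
proof -
  obtain c where c: "\<And>x. P x = (\<Sum>\<alpha> | sum \<alpha> UNIV < k. c \<alpha> * (\<Prod>i\<in>UNIV. (x $ i) ^ \<alpha> i))"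
    using assms unfolding poly_deg_less_def by blast
  have "P = (\<lambda>x. \<Sum>\<alpha> | sum \<alpha> UNIV < k. c \<alpha> * (\<Prod>i\<in>UNIV. (x $ i) ^ \<alpha> i))" by (rule ext) (rule c)
  then show ?thesis by (simp only:) (intro continuous_intros)
qed

section \<open>Approximation up to the boundary\<close>

lemma Ck_on_partials_diff:
  fixes f g :: "real^'n::finite \<Rightarrow> real"
  assumes S: "open S" and f: "Ck_on k S f" and g: "Ck_on k S g"
  shows "length \<alpha> \<le> k \<Longrightarrow> x \<in> S \<Longrightarrow> partials \<alpha> (\<lambda>y. f y - g y) x = partials \<alpha> f x - partials \<alpha> g x"
proof (induction \<alpha> arbitrary: x)
  case (Cons i \<alpha>)
  then have l: "length \<alpha> < k" by simp
  have "partial i (partials \<alpha> (\<lambda>y. f y - g y)) x = partial i (\<lambda>y. partials \<alpha> f y - partials \<alpha> g y) x"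
    by (rule partial_cong_open[OF S Cons.prems(2)]) (rule Cons.IH, use l in auto)
  also have "\<dots> = partials (i # \<alpha>) f x - partials (i # \<alpha>) g x"
    unfolding partial_def[of i "\<lambda>y. partials \<alpha> f y - partials \<alpha> g y"]
    by (intro DERIV_imp_deriv DERIV_diff Ck_on_partial_has_derivative[OF f l Cons.prems(2)] Ck_on_partial_has_derivative[OF g l Cons.prems(2)])
  finally show ?case by simp
qed simp

text \<open>
  The number of derivatives in the norm is distributed over the error beforehand.
\<close>
lemma Ck_norm_le:
  fixes f :: "real^'n::finite \<Rightarrow> real"
  assumes "\<And>\<alpha> x. length \<alpha> \<le> k \<Longrightarrow> x \<in> S \<Longrightarrow> \<bar>partials \<alpha> f x\<bar> \<le> \<delta> / card {\<alpha> :: 'n list. length \<alpha> \<le> k}"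
    and "0 \<le> \<delta>"
  shows "Ck_norm k S f \<le> ennreal \<delta>"
proof -
  let ?N = "card {\<alpha> :: 'n list. length \<alpha> \<le> k}"
  have N: "?N > 0" using finite_lists_le[of k, where 'n='n] by (auto simp: card_gt_0_iff intro: exI[of _ "[]"])
  have "Ck_norm k S f \<le> (\<Sum>\<alpha> :: 'n list | length \<alpha> \<le> k. ennreal (\<delta> / ?N))"
    unfolding Ck_norm_def by (intro sum_mono SUP_least ennreal_leI) (use assms in auto)
  also have "\<dots> = ennreal (of_nat ?N * (\<delta> / ?N))"
    unfolding sum_constant ennreal_of_nat_eq_real_of_nat
    by (rule ennreal_mult[symmetric]) (use assms(2) in auto)
  also have "\<dots> = ennreal \<delta>" using N by simp
  finally show ?thesis .
qed

lemma Ck_norm_cong_open: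
  assumes "open S" "\<And>y. y \<in> S \<Longrightarrow> f y = g y" shows "Ck_norm k S f = Ck_norm k S g"
  unfolding Ck_norm_def
  by (intro sum.cong refl SUP_cong) (use partials_cong_open[of S f g] assms in auto)

lemma real_polynomial_function_partial:
  fixes f :: "real^'n::finite \<Rightarrow> real"
  assumes "real_polynomial_function f"
  shows "\<exists>g. real_polynomial_function g \<and> (\<forall>x. ((\<lambda>t. f (x + t *\<^sub>R axis i 1)) has_real_derivative g x) (at 0))"
  using assms
proof induction
  case (linear f)
  interpret bounded_linear f by fact
  have "((\<lambda>t. f (x + t *\<^sub>R axis i 1)) has_real_derivative f (axis i 1)) (at 0)" for x
    unfolding add scaleR by (auto intro!: derivative_eq_intros)
  then show ?case by (intro exI[of _ "\<lambda>_. f (axis i 1)"]) auto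
next
  case (const c)
  show ?case by (intro exI[of _ "\<lambda>_. 0"]) auto
next
  case (add f g)
  then obtain f' g' where "real_polynomial_function f'" "\<And>x. ((\<lambda>t. f (x + t *\<^sub>R axis i 1)) has_real_derivative f' x) (at 0)"
    "real_polynomial_function g'" "\<And>x. ((\<lambda>t. g (x + t *\<^sub>R axis i 1)) has_real_derivative g' x) (at 0)"
    by blast
  then show ?case by (intro exI[of _ "\<lambda>x. f' x + g' x"]) (auto intro!: DERIV_add)
next
  case (mult f g)
  then obtain f' g' where *: "real_polynomial_function f'" "\<And>x. ((\<lambda>t. f (x + t *\<^sub>R axis i 1)) has_real_derivative f' x) (at 0)"
    "real_polynomial_function g'" "\<And>x. ((\<lambda>t. g (x + t *\<^sub>R axis i 1)) has_real_derivative g' x) (at 0)"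
    by blast
  have "((\<lambda>t. f (x + t *\<^sub>R axis i 1) * g (x + t *\<^sub>R axis i 1)) has_real_derivative f' x * g x + g' x * f x) (at 0)" for x
    using DERIV_mult[OF *(2)[of x] *(4)[of x]] by simp
  then show ?case using mult(1,2) * by (intro exI[of _ "\<lambda>x. f' x * g x + g' x * f x"]) auto
qed

lemma real_polynomial_function_partials:
  fixes f :: "real^'n::finite \<Rightarrow> real"
  assumes "real_polynomial_function f"
  shows "real_polynomial_function (partials \<alpha> f)"
proof (induction \<alpha>)
  case (Cons i \<alpha>)
  obtain g where g: "real_polynomial_function g"
    "\<And>x. ((\<lambda>t. partials \<alpha> f (x + t *\<^sub>R axis i 1)) has_real_derivative g x) (at 0)"
    using real_polynomial_function_partial[OF Cons, of i] by blast
  have "partials (i # \<alpha>) f = g" unfolding partials_Cons partial_def by (rule ext) (rule DERIV_imp_deriv[OF g(2)])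
  then show ?case using g(1) by simp
qed (simp add: assms)

lemma real_polynomial_function_Ck_on:
  fixes f :: "real^'n::finite \<Rightarrow> real"
  assumes "real_polynomial_function f" shows "Ck_on k S f"
  unfolding Ck_on_def
proof (intro conjI allI impI ballI)
  fix \<alpha> :: "'n list" and i x
  show "(\<lambda>t. partials \<alpha> f (x + t *\<^sub>R axis i 1)) field_differentiable at 0"
    using real_polynomial_function_partial[OF real_polynomial_function_partials[OF assms], of \<alpha> i]
    unfolding field_differentiable_def by blast
next
  fix \<alpha> :: "'n list"
  show "continuous_on S (partials \<alpha> f)"
    using real_polynomial_function_partials[OF assms, of \<alpha>]
    by (simp add: real_polynomial_function_eq continuous_on_polymonial_function)
qed

lemma partials_dilation:
  fixes u :: "real^'n::finite \<Rightarrow> real"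
  assumes u: "Ck_on k (ball 0 1) u" and r: "0 < r"
  shows "length \<alpha> \<le> k \<Longrightarrow> x \<in> ball 0 (1 / r) \<Longrightarrow> partials \<alpha> (\<lambda>x. u (r *\<^sub>R x)) x = r ^ length \<alpha> * partials \<alpha> u (r *\<^sub>R x)"
    and "length \<alpha> < k \<Longrightarrow> x \<in> ball 0 (1 / r) \<Longrightarrow>
      ((\<lambda>t. partials \<alpha> (\<lambda>x. u (r *\<^sub>R x)) (x + t *\<^sub>R axis i 1)) has_real_derivative
        r ^ Suc (length \<alpha>) * partials (i # \<alpha>) u (r *\<^sub>R x)) (at 0)"
proof -
  have rx: "r *\<^sub>R x \<in> ball 0 1" if "x \<in> ball 0 (1 / r)" for x :: "real^'n" using that r by (simp add: field_simps)
  have der: "((\<lambda>t. r ^ length \<alpha> * partials \<alpha> u (r *\<^sub>R (x + t *\<^sub>R axis i 1))) has_real_derivative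
      r ^ Suc (length \<alpha>) * partials (i # \<alpha>) u (r *\<^sub>R x)) (at 0)"
    if \<alpha>: "length \<alpha> < k" and x: "x \<in> ball 0 (1 / r)" for \<alpha> :: "'n list" and i x
  proof -
    have d: "((\<lambda>t. partials \<alpha> u (r *\<^sub>R x + t *\<^sub>R axis i 1)) has_real_derivative partials (i # \<alpha>) u (r *\<^sub>R x)) (at (r * 0))"
      using Ck_on_partial_has_derivative[OF u \<alpha> rx[OF x]] by simp
    have "((\<lambda>t. partials \<alpha> u (r *\<^sub>R x + (r * t) *\<^sub>R axis i 1)) has_real_derivative partials (i # \<alpha>) u (r *\<^sub>R x) * r) (at 0)"
      by (rule DERIV_chain2[where f = "\<lambda>t. partials \<alpha> u (r *\<^sub>R x + t *\<^sub>R axis i 1)" and g = "\<lambda>t. r * t", OF d]) (auto intro!: derivative_eq_intros)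
    from DERIV_cmult[OF this, of "r ^ length \<alpha>"] show ?thesis
      by (simp add: scaleR_add_right mult_ac)
  qed
  show val: "partials \<alpha> (\<lambda>x. u (r *\<^sub>R x)) x = r ^ length \<alpha> * partials \<alpha> u (r *\<^sub>R x)"
    if "length \<alpha> \<le> k" "x \<in> ball 0 (1 / r)" for \<alpha> x
    using that
  proof (induction \<alpha> arbitrary: x)
    case (Cons i \<alpha>)
    then have l: "length \<alpha> < k" by simp
    have "partials (i # \<alpha>) (\<lambda>x. u (r *\<^sub>R x)) x = partial i (\<lambda>x. r ^ length \<alpha> * partials \<alpha> u (r *\<^sub>R x)) x"
      unfolding partials_Cons by (rule partial_cong_open[OF open_ball Cons.prems(2)]) (rule Cons.IH, use l in auto)
    also have "\<dots> = r ^ length (i # \<alpha>) * partials (i # \<alpha>) u (r *\<^sub>R x)"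
      unfolding partial_def[of i "\<lambda>x. r ^ length \<alpha> * partials \<alpha> u (r *\<^sub>R x)"] length_Cons
      by (rule DERIV_imp_deriv[OF der[OF l Cons.prems(2)]])
    finally show ?case .
  qed simp
  show "((\<lambda>t. partials \<alpha> (\<lambda>x. u (r *\<^sub>R x)) (x + t *\<^sub>R axis i 1)) has_real_derivative
        r ^ Suc (length \<alpha>) * partials (i # \<alpha>) u (r *\<^sub>R x)) (at 0)"
    if \<alpha>: "length \<alpha> < k" and x: "x \<in> ball 0 (1 / r)"
  proof -
    have "((\<lambda>t. x + t *\<^sub>R axis i 1) \<longlongrightarrow> x + 0 *\<^sub>R axis i (1::real)) (nhds 0)"
      by (intro tendsto_intros filterlim_ident)
    then have "\<forall>\<^sub>F t in nhds 0. x + t *\<^sub>R axis i (1::real) \<in> ball 0 (1 / r)"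
      using x by (intro topological_tendstoD) auto
    then have "\<forall>\<^sub>F t in nhds 0. partials \<alpha> (\<lambda>x. u (r *\<^sub>R x)) (x + t *\<^sub>R axis i 1) = r ^ length \<alpha> * partials \<alpha> u (r *\<^sub>R (x + t *\<^sub>R axis i 1))"
      by eventually_elim (rule val, use \<alpha> in auto)
    from DERIV_cong_ev[OF refl this refl] der[OF \<alpha> x, of i] show ?thesis by (rule iffD2)
  qed
qed

lemma Ck_on_dilation:
  fixes u :: "real^'n::finite \<Rightarrow> real"
  assumes u: "Ck_on k (ball 0 1) u" and r: "0 < r"
  shows "Ck_on k (ball 0 (1 / r)) (\<lambda>x. u (r *\<^sub>R x))"
  unfolding Ck_on_def
proof (intro conjI allI impI ballI)
  fix \<alpha> :: "'n list" and i and x :: "real^'n" assume x: "x \<in> ball 0 (1 / r)" and \<alpha>: "length \<alpha> < k"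
  show "(\<lambda>t. partials \<alpha> (\<lambda>x. u (r *\<^sub>R x)) (x + t *\<^sub>R axis i 1)) field_differentiable at 0"
    unfolding field_differentiable_def by (rule exI, rule partials_dilation(2)[OF u r \<alpha> x])
next
  fix \<alpha> :: "'n list" assume \<alpha>: "length \<alpha> \<le> k"
  have sub: "(\<lambda>x. r *\<^sub>R x) ` ball 0 (1 / r) \<subseteq> ball (0::real^'n) 1" using r by (auto simp: field_simps)
  have "continuous_on (ball 0 1) (partials \<alpha> u)" using u \<alpha> by (simp add: Ck_on_def)
  then have "continuous_on (ball 0 (1 / r)) (\<lambda>x. partials \<alpha> u (r *\<^sub>R x))"
    by (rule continuous_on_compose2[OF _ _ sub]) (intro continuous_intros)
  then have cont: "continuous_on (ball 0 (1 / r)) (\<lambda>x. r ^ length \<alpha> * partials \<alpha> u (r *\<^sub>R x))"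
    by (rule continuous_on_mult[OF continuous_on_const])
  have "r ^ length \<alpha> * partials \<alpha> u (r *\<^sub>R x) = partials \<alpha> (\<lambda>x. u (r *\<^sub>R x)) x" if "x \<in> ball 0 (1 / r)" for x
    using partials_dilation(1)[OF u r \<alpha> that] by (rule sym)
  from continuous_on_eq[OF cont this]
  show "continuous_on (ball 0 (1 / r)) (partials \<alpha> (\<lambda>x. u (r *\<^sub>R x)))" .
qed

text \<open>
  For \<open>m \<ge> 1\<close> the dilation \<open>u (r *\<^sub>R x)\<close> with \<open>r <
  1\<close> close to \<open>1\<close> is defined on a larger ball and keeps the \<open>2 * m \<ge>
  2\<close> derivatives of \<open>u\<close>; its derivatives are close to those of \<open>u\<close>
  because these extend continuously to the closed ball. For \<open>m = 0\<close> only uniform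
  closeness is required, and \<open>u\<close> may lack the second derivatives needed for the
  fractional Laplacian, so a Weierstrass polynomial is taken instead.
\<close>
lemma C2_approximation_up_to_boundary:
  fixes u :: "real^'n::finite \<Rightarrow> real"
  assumes u: "Ck_closure (2 * m) (ball 0 1) u" and \<delta>: "0 < \<delta>"
  obtains \<rho> w where "1 < \<rho>" "Ck_on 2 (ball 0 \<rho>) w" "Ck_on m (ball 0 \<rho>) w" "Ck_norm m (ball 0 1) (\<lambda>x. w x - u x) \<le> ennreal \<delta>"
proof (cases "m = 0")
  case True
  have "continuous_on (cball 0 1) u" using u by (simp add: Ck_closure_def)
  from Stone_Weierstrass_real_polynomial_function[OF compact_cball this \<delta>]
  obtain q where q: "real_polynomial_function q" "\<And>x. x \<in> cball 0 1 \<Longrightarrow> \<bar>u x - q x\<bar> < \<delta>" by blast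
  show ?thesis
  proof (rule that[of 2 q])
    show "Ck_norm m (ball 0 1) (\<lambda>x. q x - u x) \<le> ennreal \<delta>"
    proof (rule Ck_norm_le)
      fix \<alpha> :: "'n list" and x :: "real^'n" assume "length \<alpha> \<le> m" "x \<in> ball 0 1"
      moreover have "{\<alpha> :: 'n list. length \<alpha> \<le> m} = {[]}" using True by auto
      ultimately show "\<bar>partials \<alpha> (\<lambda>x. q x - u x) x\<bar> \<le> \<delta> / card {\<alpha> :: 'n list. length \<alpha> \<le> m}"
        using q(2)[of x] True by (auto simp: abs_minus_commute)
    qed (use \<delta> in simp)
  qed (use q in \<open>auto intro: real_polynomial_function_Ck_on\<close>)
next
  case False
  have Cu: "Ck_on (2 * m) (ball 0 1) u" using u by (simp add: Ck_closure_def)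
  define N where "N = card {\<alpha> :: 'n list. length \<alpha> \<le> m}"
  have fin: "finite {\<alpha> :: 'n list. length \<alpha> \<le> m}" by (rule finite_lists_le)
  have N: "N > 0" using fin by (auto simp: N_def card_gt_0_iff intro: exI[of _ "[]"])
  have near1: "\<exists>d>0. \<forall>r x. 1 - d < r \<and> r < 1 \<and> 0 < r \<and> x \<in> ball 0 1 \<longrightarrow>
      \<bar>r ^ length \<alpha> * partials \<alpha> u (r *\<^sub>R x) - partials \<alpha> u x\<bar> \<le> \<delta> / N" if \<alpha>: "length \<alpha> \<le> m" for \<alpha>
  proof -
    have "length \<alpha> \<le> 2 * m" using \<alpha> by simp
    then have "\<exists>g. continuous_on (cball 0 1) g \<and> (\<forall>x\<in>ball 0 1. g x = partials \<alpha> u x)"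
      using u by (simp add: Ck_closure_def)
    then obtain g where g: "continuous_on (cball 0 1) g" "\<And>x. x \<in> ball 0 1 \<Longrightarrow> g x = partials \<alpha> u x"
      by blast
    have "continuous_on ({0..1} \<times> cball 0 1) (\<lambda>(r, x). r ^ length \<alpha> * g (r *\<^sub>R x))"
      unfolding split_def
    proof (intro continuous_on_mult continuous_on_power continuous_on_fst continuous_on_id continuous_on_compose2[OF g(1)])
      have "a * norm b \<le> 1" if "a \<le> 1" "norm b \<le> 1" for a and b :: "real^'n"
        by (rule mult_le_one) (use that in auto)
      then show "(\<lambda>x. fst x *\<^sub>R snd x) ` ({0..1} \<times> cball 0 1) \<subseteq> cball (0::real^'n) 1" by auto
    qed (intro continuous_intros)
    then have uc: "uniformly_continuous_on ({0..1} \<times> cball 0 1) (\<lambda>(r, x). r ^ length \<alpha> * g (r *\<^sub>R x))"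
      by (intro compact_uniformly_continuous compact_Times) auto
    have "\<delta> / N > 0" using \<delta> N by simp
    then have "\<exists>d>0. \<forall>v\<in>{0..1} \<times> cball 0 1. \<forall>v'\<in>{0..1} \<times> cball 0 1. dist v' v < d \<longrightarrow>
       dist (case v' of (r, x) \<Rightarrow> r ^ length \<alpha> * g (r *\<^sub>R x)) (case v of (r, x) \<Rightarrow> r ^ length \<alpha> * g (r *\<^sub>R x)) < \<delta> / N"
      by (rule uc[unfolded uniformly_continuous_on_def, rule_format])
    then obtain d where d: "d > 0 \<and> (\<forall>v\<in>{0..1} \<times> cball 0 1. \<forall>v'\<in>{0..1} \<times> cball 0 1. dist v' v < d \<longrightarrow>
       dist (case v' of (r, x) \<Rightarrow> r ^ length \<alpha> * g (r *\<^sub>R x)) (case v of (r, x) \<Rightarrow> r ^ length \<alpha> * g (r *\<^sub>R x)) < \<delta> / N)" ..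
    have "\<bar>r ^ length \<alpha> * partials \<alpha> u (r *\<^sub>R x) - partials \<alpha> u x\<bar> \<le> \<delta> / N"
      if r: "1 - d < r" "r < 1" "0 < r" and x: "x \<in> ball 0 1" for r x
    proof -
      have "r *\<^sub>R x \<in> ball 0 1" using r x mult_strict_mono'[of r 1 "norm x" 1] by simp
      then have "g (r *\<^sub>R x) = partials \<alpha> u (r *\<^sub>R x)" "g x = partials \<alpha> u x" using g(2) x by auto
      moreover have "dist (r ^ length \<alpha> * g (r *\<^sub>R x)) (1 ^ length \<alpha> * g (1 *\<^sub>R x)) < \<delta> / N"
        using conjunct2[OF d, rule_format, of "(1, x)" "(r, x)"] r x by (simp add: dist_Pair_Pair dist_real_def)
      ultimately show ?thesis by (simp add: dist_real_def)
    qed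
    then show ?thesis using conjunct1[OF d] by (intro exI[of _ d]) auto
  qed
  then have "\<forall>\<alpha>\<in>{\<alpha>. length \<alpha> \<le> m}. \<exists>d. d > 0 \<and> (\<forall>r x. 1 - d < r \<and> r < 1 \<and> 0 < r \<and> x \<in> ball 0 1 \<longrightarrow>
      \<bar>r ^ length \<alpha> * partials \<alpha> u (r *\<^sub>R x) - partials \<alpha> u x\<bar> \<le> \<delta> / N)"
    by simp
  from bchoice[OF this] obtain d where d': "\<forall>\<alpha>\<in>{\<alpha>. length \<alpha> \<le> m}. d \<alpha> > 0 \<and>
      (\<forall>r x. 1 - d \<alpha> < r \<and> r < 1 \<and> 0 < r \<and> x \<in> ball 0 1 \<longrightarrow>
      \<bar>r ^ length \<alpha> * partials \<alpha> u (r *\<^sub>R x) - partials \<alpha> u x\<bar> \<le> \<delta> / N)" ..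
  have d: "\<And>\<alpha>. length \<alpha> \<le> m \<Longrightarrow> d \<alpha> > 0"
    "\<And>\<alpha> r x. length \<alpha> \<le> m \<Longrightarrow> 1 - d \<alpha> < r \<Longrightarrow> r < 1 \<Longrightarrow> 0 < r \<Longrightarrow> x \<in> ball 0 1 \<Longrightarrow>
      \<bar>r ^ length \<alpha> * partials \<alpha> u (r *\<^sub>R x) - partials \<alpha> u x\<bar> \<le> \<delta> / N"
    using d' by simp_all
  \<comment> \<open>the entry \<open>1 / 2\<close> keeps the dilation factor \<open>r\<close> positive\<close>
  define D where "D = Min (insert (1/2) (d ` {\<alpha>. length \<alpha> \<le> m}))"
  have D1: "0 < D" using fin d(1) by (auto simp: D_def)
  have D2: "D \<le> 1 / 2" unfolding D_def by (rule Min_le) (use fin in auto)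
  have D3: "D \<le> d \<alpha>" if "length \<alpha> \<le> m" for \<alpha>
    unfolding D_def by (rule Min_le) (use fin that in auto)
  define r where "r = 1 - D / 2"
  have r: "0 < r" "r < 1" using D1 D2 by (auto simp: r_def)
  have rd: "1 - d \<alpha> < r" if "length \<alpha> \<le> m" for \<alpha>
    using D1 D3[OF that] by (simp add: r_def)
  have Cw: "Ck_on (2 * m) (ball 0 (1 / r)) (\<lambda>x. u (r *\<^sub>R x))" by (rule Ck_on_dilation[OF Cu r(1)])
  show ?thesis
  proof (rule that[of "1 / r" "\<lambda>x. u (r *\<^sub>R x)"])
    show "1 < 1 / r" using r by simp
    show "Ck_on 2 (ball 0 (1 / r)) (\<lambda>x. u (r *\<^sub>R x))"
      by (rule Ck_on_mono[OF Cw _ order_refl]) (use False in simp)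
    show "Ck_on m (ball 0 (1 / r)) (\<lambda>x. u (r *\<^sub>R x))"
      by (rule Ck_on_mono[OF Cw _ order_refl]) simp
    show "Ck_norm m (ball 0 1) (\<lambda>x. u (r *\<^sub>R x) - u x) \<le> ennreal \<delta>"
    proof (rule Ck_norm_le)
      fix \<alpha> :: "'n list" and x :: "real^'n" assume \<alpha>: "length \<alpha> \<le> m" and x: "x \<in> ball 0 1"
      have sub: "ball 0 1 \<subseteq> ball (0::real^'n) (1 / r)" using r by (intro subset_ball) simp
      have "partials \<alpha> (\<lambda>x. u (r *\<^sub>R x) - u x) x = partials \<alpha> (\<lambda>x. u (r *\<^sub>R x)) x - partials \<alpha> u x"
        by (rule Ck_on_partials_diff[OF open_ball Ck_on_mono[OF Cw order_refl sub] Cu _ x]) (use \<alpha> in simp)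
      also have "\<dots> = r ^ length \<alpha> * partials \<alpha> u (r *\<^sub>R x) - partials \<alpha> u x"
        using partials_dilation(1)[OF Cu r(1) _ subsetD[OF sub x], of \<alpha>] \<alpha> by simp
      finally show "\<bar>partials \<alpha> (\<lambda>x. u (r *\<^sub>R x) - u x) x\<bar> \<le> \<delta> / card {\<alpha> :: 'n list. length \<alpha> \<le> m}"
        using d(2)[OF \<alpha> rd[OF \<alpha>] r(2,1) x] by (simp add: N_def)
    qed (use \<delta> in simp)
  qed
qed

text \<open>
  The function is extended by its values at the nearest point of the ball and cut off linearly in
  the distance to the ball. Continuity outside the ball is all that the later dominated convergence
  arguments need.
\<close>
lemma compactly_supported_extension:
  fixes w :: "real^'n::finite \<Rightarrow> real"
  assumes w: "continuous_on (cball 0 \<rho>) w" and \<rho>: "0 < \<rho>"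
  obtains w0 B where "continuous_on UNIV w0" "\<And>x. x \<in> cball 0 \<rho> \<Longrightarrow> w0 x = w x"
    "\<And>x. \<bar>w0 x\<bar> \<le> B" "\<And>x. \<rho> + 1 \<le> norm x \<Longrightarrow> w0 x = 0"
proof -
  let ?c = "closest_point (cball (0::real^'n) \<rho>)" and ?d = "\<lambda>x::real^'n. infdist x (cball 0 \<rho>)"
  have ne: "cball (0::real^'n) \<rho> \<noteq> {}" using \<rho> by simp
  have c: "?c x \<in> cball 0 \<rho>" for x by (rule closest_point_in_set[OF closed_cball ne])
  define w0 where "w0 x = w (?c x) * max 0 (1 - ?d x)" for x
  have "bounded (w ` cball 0 \<rho>)" by (intro compact_imp_bounded compact_continuous_image w compact_cball)
  then obtain B where "\<forall>y\<in>w ` cball 0 \<rho>. norm y \<le> B" unfolding bounded_iff by blast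
  then have B: "\<bar>w x\<bar> \<le> B" if "x \<in> cball 0 \<rho>" for x using that by simp
  show ?thesis
  proof (rule that[of w0 B])
    show "continuous_on UNIV w0"
      unfolding w0_def
    proof (intro continuous_on_mult continuous_on_compose2[OF w] continuous_on_closest_point ne continuous_on_max
        continuous_on_const continuous_on_diff continuous_on_infdist continuous_on_id)
      show "?c ` UNIV \<subseteq> cball 0 \<rho>" using c by auto
    qed auto
    show "w0 x = w x" if "x \<in> cball 0 \<rho>" for x
      using that by (simp add: w0_def closest_point_self in_closed_iff_infdist_zero[OF closed_cball ne, symmetric])
    show "\<bar>w0 x\<bar> \<le> B" for x
    proof -
      have "\<bar>w (?c x)\<bar> * max 0 (1 - ?d x) \<le> B * 1"
        using B[OF c[of x]] infdist_nonneg[of x "cball 0 \<rho>"] by (intro mult_mono) auto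
      then show ?thesis by (simp add: w0_def abs_mult)
    qed
    show "w0 x = 0" if "\<rho> + 1 \<le> norm x" for x
    proof -
      obtain y where y: "y \<in> cball 0 \<rho>" "?d x = dist x y"
        using infdist_attains_inf[OF closed_cball ne, of x] by blast
      have "norm x \<le> norm y + dist x y" using norm_triangle_sub[of x y] by (simp add: dist_norm)
      then have "1 \<le> ?d x" using y that by auto
      then show ?thesis by (simp add: w0_def)
    qed
  qed
qed

section \<open>The approximating solution\<close>

lemma continuous_on_jet:
  fixes w :: "real^'n::finite \<Rightarrow> real" and F :: "('n + 'n list \<Rightarrow> real) \<Rightarrow> real"
  assumes w: "Ck_on m S w" and F: "Ck_coord m (jet_coords m) F"
  shows "continuous_on S (\<lambda>x. F (jet m w x))"
proof (rule continuous_on_compose2[where f = "jet m w" and s = S])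
  show "continuous_on (jet_coords m \<rightarrow>\<^sub>E UNIV) F"
    using F[unfolded Ck_coord_def, THEN conjunct2, rule_format, of "[]"] by simp
  show "continuous_on S (jet m w)"
  proof (rule continuous_on_coordinatewise_then_product)
    fix i :: "'n + 'n list"
    show "continuous_on S (\<lambda>x. jet m w x i)"
    proof (cases i)
      case (Inl j)
      have "jet m w x i = x $ j" for x using Inl by (auto simp: jet_def jet_coords_def)
      then show ?thesis by (simp add: continuous_intros)
    next
      case (Inr \<alpha>)
      have "jet m w x i = (if length \<alpha> \<le> m then partials \<alpha> w x else undefined)" for x
        using Inr by (auto simp: jet_def jet_coords_def)
      then show ?thesis using w by (cases "length \<alpha> \<le> m") (simp_all add: Ck_on_def)
    qed
  qed
  show "jet m w ` S \<subseteq> jet_coords m \<rightarrow>\<^sub>E UNIV" by (auto simp: jet_def)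
qed

lemma jet_cong_open:
  assumes "open S" "\<And>y. y \<in> S \<Longrightarrow> f y = g y" "x \<in> S"
  shows "jet m f x = jet m g x"
proof -
  have "partials \<alpha> f x = partials \<alpha> g x" for \<alpha> by (rule partials_cong_open[OF assms])
  then show ?thesis unfolding jet_def by simp
qed

lemma tail_integral_small:
  fixes h :: "'a::euclidean_space \<Rightarrow> real"
  assumes h: "integrable lebesgue h" and e: "0 < e"
  obtains R where "R0 \<le> R" "(LINT y|lebesgue. indicator (- ball 0 R) y * \<bar>h y\<bar>) < e"
proof -
  have [measurable]: "- ball (0::'a) r \<in> sets lebesgue" for r by simp
  have [measurable]: "h \<in> borel_measurable lebesgue" using h by auto
  have hint: "integrable lebesgue (\<lambda>y. \<bar>h y\<bar>)" using h by simp
  have "((\<lambda>R. LINT y|lebesgue. indicator (- ball 0 R) y * \<bar>h y\<bar>) \<longlongrightarrow> (LINT y|(lebesgue :: 'a measure). (0::real))) at_top"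
  proof (rule integral_dominated_convergence_at_top[OF _ _ hint])
    show "AE y in lebesgue. ((\<lambda>R. indicator (- ball 0 R) y * \<bar>h y\<bar>) \<longlongrightarrow> 0) at_top"
    proof (rule AE_I2)
      fix y
      have "\<forall>\<^sub>F R in at_top. indicator (- ball 0 R) y * \<bar>h y\<bar> = 0"
        using eventually_gt_at_top[of "norm y"] by eventually_elim simp
      then show "((\<lambda>R. indicator (- ball 0 R) y * \<bar>h y\<bar>) \<longlongrightarrow> 0) at_top" by (rule tendsto_eventually)
    qed
    show "\<forall>\<^sub>F R in at_top. AE y in lebesgue. norm (indicator (- ball 0 R) y * \<bar>h y\<bar>) \<le> \<bar>h y\<bar>"
      by (intro always_eventually allI AE_I2) (simp add: indicator_def)
  qed measurable
  then have "\<forall>\<^sub>F R in at_top. (LINT y|lebesgue. indicator (- ball 0 R) y * \<bar>h y\<bar>) < e"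
    using e by (intro order_tendstoD(2)[where y = "LINT y|(lebesgue :: 'a measure). (0::real)"]) auto
  then have "\<forall>\<^sub>F R in at_top. R0 \<le> R \<and> (LINT y|lebesgue. indicator (- ball 0 R) y * \<bar>h y\<bar>) < e"
    by (rule eventually_conj[OF eventually_ge_at_top])
  then obtain R where "R0 \<le> R \<and> (LINT y|lebesgue. indicator (- ball 0 R) y * \<bar>h y\<bar>) < e"
    using eventually_happens'[OF trivial_limit_at_top_linorder] by blast
  then show ?thesis using that by blast
qed

lemma C2_second_difference_uniform:
  fixes w :: "real^'n::finite \<Rightarrow> real"
  assumes \<rho>: "1 < \<rho>" and w: "Ck_on 2 (ball 0 \<rho>) w"
  obtains M d where "0 \<le> M" "0 < d" "d < 1"
    "\<And>x z. x \<in> cball 0 1 \<Longrightarrow> norm z < d \<Longrightarrow> \<bar>second_difference w x z\<bar> \<le> M * (norm z)\<^sup>2"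
proof -
  define d where "d = min ((\<rho> - 1) / 2) (1 / 2)"
  have d: "0 < d" "d < 1" using \<rho> by (auto simp: d_def)
  have "1 + d < \<rho>" using \<rho> by (auto simp: d_def min_def field_simps)
  then have "cball 0 (1 + d) \<subseteq> ball (0::real^'n) \<rho>" by auto
  then obtain M where M: "0 \<le> M" "\<And>x z. x + z \<in> ball 0 (1 + d) \<Longrightarrow> x - z \<in> ball 0 (1 + d) \<Longrightarrow>
      \<bar>second_difference w x z\<bar> \<le> M * (norm z)\<^sup>2"
    by (rule Ck_on_second_difference_compact[OF w]) (rule that)
  show ?thesis
  proof (rule that[OF M(1) d])
    fix x z :: "real^'n" assume "x \<in> cball 0 1" "norm z < d"
    then show "\<bar>second_difference w x z\<bar> \<le> M * (norm z)\<^sup>2"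
      using norm_triangle_ineq[of x z] norm_triangle_ineq4[of x z] by (intro M(2)) auto
  qed
qed

text \<open>
  The density argument approximates uniformly on the closed unit ball, so continuity is needed up to
  the boundary.
\<close>
lemma continuous_on_frac_laplacian:
  fixes w :: "real^'n::finite \<Rightarrow> real" and s :: real
  assumes s: "0 < s" "s < 1"
    and w: "continuous_on UNIV w" "\<And>x. \<bar>w x\<bar> \<le> B" "1 < \<rho>" "Ck_on 2 (ball 0 \<rho>) w"
  shows "continuous_on (cball 0 1)
    (\<lambda>x. LINT z|lborel. second_difference w x z / (2 * norm z powr (real CARD('n) + 2 * s)))"
proof -
  obtain M d where "0 \<le> M" "0 < d" "d < 1"
    "\<And>x z. x \<in> cball 0 1 \<Longrightarrow> norm z < d \<Longrightarrow> \<bar>second_difference w x z\<bar> \<le> M * (norm z)\<^sup>2"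
    by (rule C2_second_difference_uniform[OF w(3,4)]) (rule that)
  then show ?thesis by (intro continuous_on_second_difference_integral[OF s w(1,2), where M = M and d = d])
qed

lemma continuous_on_far_field_remainder:
  fixes U :: "real^'n::finite \<Rightarrow> real"
  assumes p: "0 \<le> p"
    and C: "\<And>x y :: real^'n. norm x \<le> 1 \<Longrightarrow> 6 \<le> norm y \<Longrightarrow>
      \<bar>taylor_remainder k p x y\<bar> \<le> C / norm y powr (p + real k)"
    and U: "U \<in> borel_measurable lebesgue" "\<And>y. norm y < 6 \<Longrightarrow> U y = 0"
      "integrable lebesgue (\<lambda>y. \<bar>U y\<bar> / norm y powr (p + real k))"
  shows "continuous_on (cball 0 1) (\<lambda>x. LINT y|lebesgue. U y * taylor_remainder k p x y)"
proof (rule continuous_on_parametric_integral[where g = "\<lambda>y. C * (\<bar>U y\<bar> / norm y powr (p + real k))"])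
  note U(1)[measurable]
  fix x :: "real^'n"
  have [measurable]: "(\<lambda>y. norm (x - y) powr p) \<in> borel_measurable lebesgue"
    by (rule measurable_completion) simp
  have [measurable]: "taylor_kernel k p x \<in> borel_measurable lebesgue"
    by (rule measurable_completion) (simp add: separable_kernel_measurable[OF separable_taylor_kernel[OF p]])
  show "(\<lambda>y. U y * taylor_remainder k p x y) \<in> borel_measurable lebesgue" by measurable
next
  fix x y :: "real^'n" assume x: "x \<in> cball 0 1"
  show "\<bar>U y * taylor_remainder k p x y\<bar> \<le> C * (\<bar>U y\<bar> / norm y powr (p + real k))"
  proof (cases "norm y < 6")
    case False
    then have "\<bar>U y\<bar> * \<bar>taylor_remainder k p x y\<bar> \<le> \<bar>U y\<bar> * (C / norm y powr (p + real k))"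
      using x by (intro mult_left_mono C) auto
    then show ?thesis by (simp add: abs_mult mult.commute)
  qed (simp add: U(2))
next
  fix y :: "real^'n"
  show "continuous_on (cball 0 1) (\<lambda>x. U y * taylor_remainder k p x y)"
  proof (cases "norm y < 6")
    case False
    then have "y \<noteq> 0" by auto
    with False show ?thesis unfolding taylor_kernel_def by (intro continuous_intros) auto
  qed (simp add: U(2))
qed (use U(3) in \<open>rule integrable_mult_right\<close>)

text \<open>
  The right-hand side \<open>f\<close> collects the three contributions: the second-difference
  integral \<open>L\<close> of the compactly supported piece, the potential \<open>N\<close> of the
  shell, and the renormalised potential \<open>T\<close> of the far field. For \<open>R > R0\<close>
  the truncation of \<open>u\<^sub>\<epsilon>\<close> only affects the far field \<open>U\<close>.
\<close>
lemma div_frac_laplacian_decomposition: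
  fixes w0 v U :: "real^'n::finite \<Rightarrow> real" and s :: real
  defines "p \<equiv> real CARD('n) + 2 * s"
  assumes s: "0 < s" "s < 1"
    and w0: "continuous_on UNIV w0" "\<And>x. \<bar>w0 x\<bar> \<le> B" "\<And>x. R0 \<le> norm x \<Longrightarrow> w0 x = 0"
      "1 < \<rho>" "Ck_on 2 (ball 0 \<rho>) w0"
    and v: "integrable lebesgue v" "\<And>y. norm y < 2 \<or> R0 \<le> norm y \<Longrightarrow> v y = 0"
    and R0: "6 \<le> R0"
    and U: "U \<in> borel_measurable lebesgue" "\<And>y. norm y < R0 \<Longrightarrow> U y = 0"
      "integrable lebesgue (\<lambda>y. \<bar>U y\<bar> / norm y powr (p + real k))"
    and C: "\<And>x y :: real^'n. norm x \<le> 1 \<Longrightarrow> 6 \<le> norm y \<Longrightarrow>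
      \<bar>taylor_remainder k p x y\<bar> \<le> C / norm y powr (p + real k)"
  defines "L \<equiv> \<lambda>x. LINT z|lborel. second_difference w0 x z / (2 * norm z powr p)"
    and "N \<equiv> \<lambda>x. LINT y|lebesgue. v y / norm (x - y) powr p"
    and "T \<equiv> \<lambda>x. LINT y|lebesgue. U y * taylor_remainder k p x y"
  assumes f: "\<And>x. x \<in> ball 0 1 \<Longrightarrow> f x = L x - N x - T x"
  shows "div_frac_laplacian s k (\<lambda>x. w0 x + v x + U x) f"
proof -
  have p0: "0 \<le> p" using s by (simp add: p_def)
  define uR where "uR R y = indicator (ball 0 R) y * U y" for R y
  define W where "W R y = w0 y + (v y + uR R y)" for R y
  define Q where "Q R x = (LINT y|lebesgue. uR R y * taylor_kernel k p x y)" for R x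
  define g where "g R x = L x - potential p (\<lambda>y. v y + uR R y) x" for R x
  have U6: "U y = 0" if "norm y < 6" for y using U(2) that R0 by simp
  note far = far_field_convergence[OF p0 C U(1) U6 U(3), folded T_def uR_def]
  have far3: "((\<lambda>R. potential p (uR R) x - Q R x) \<longlongrightarrow> T x) at_top" if "norm x \<le> 1" for x
    unfolding uR_def Q_def T_def by (rule far_field_convergence(3)[OF p0 C U(1) U6 U(3) that])
  have uR0: "uR R y = 0" if "norm y < 2" for R y using U6 that by (simp add: uR_def)
  have v0: "v y = 0" if "norm y < 2" for y using v(2) that by simp
  have vR: "integrable lebesgue (\<lambda>y. v y + uR R y)" for R using v(1) far(1) by (rule Bochner_Integration.integrable_add)
  have vR0: "v y + uR R y = 0" if "norm y < 2" for R y using uR0 v0 that by simp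
  have W_near: "W R y = w0 y" if "norm y < 2" for R y using vR0[OF that] by (simp add: W_def)
  have truncate: "(\<lambda>x. indicator (ball 0 R) x * (w0 x + v x + U x)) = W R" if "R0 < R" for R
  proof
    fix x show "indicator (ball 0 R) x * (w0 x + v x + U x) = W R x"
      using w0(3)[of x] v(2)[of x] that by (cases "norm x < R") (auto simp: W_def uR_def)
  qed
  obtain M d where M: "0 \<le> M" and d: "0 < d" "d < 1"
    and sd: "\<And>x z. x \<in> cball 0 1 \<Longrightarrow> norm z < d \<Longrightarrow> \<bar>second_difference w0 x z\<bar> \<le> M * (norm z)\<^sup>2"
    by (rule C2_second_difference_uniform[OF w0(4,5)]) (rule that)
  have w0m: "w0 \<in> borel_measurable borel" using w0(1) by (rule borel_measurable_continuous_onI)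
  have lap0: "has_frac_laplacian s w0 x (L x)" if "x \<in> cball 0 1" for x
    unfolding L_def p_def
    by (rule has_frac_laplacian_second_difference[OF s w0m w0(2) d(1) M]) (rule sd[OF that])
  have Lcont: "continuous_on (cball 0 1) L"
    unfolding L_def p_def by (rule continuous_on_frac_laplacian[OF s w0(1,2,4,5)])
  have lap: "has_frac_laplacian s (W R) x (g R x)" if "x \<in> cball 0 1" for R x
    unfolding W_def g_def p_def
  proof (rule has_frac_laplacian_add_integrable[OF lap0[OF that]])
    show "v x + uR R x = 0" using that by (intro vR0) auto
    show "integrable lebesgue (\<lambda>y. (v y + uR R y) / norm (x - y) powr (real CARD('n) + 2 * s))"
      unfolding p_def[symmetric] by (rule integrable_far_potential(1)[OF vR vR0 _ p0]) (use that in auto)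
  qed
  have visc: "visc_solution s (ball 0 1) (W R) (g R)" for R
  proof (rule visc_solution_of_classical[OF s])
    have "continuous_on (ball 0 1) w0" using w0(1) by (rule continuous_on_subset) simp
    then show "continuous_on (ball 0 1) (W R)" by (rule continuous_on_eq) (simp add: W_near)
    have "\<bar>W R x\<bar> \<le> B" if "x \<in> ball 0 1" for x using w0(2)[of x] that by (simp add: W_near)
    then show "bounded (W R ` ball 0 1)" unfolding bounded_iff by (intro exI[of _ B]) auto
    show "has_frac_laplacian s (W R) x (g R x)" if "x \<in> ball 0 1" for x using that by (intro lap) auto
    show "\<exists>M. \<exists>d>0. \<forall>z. norm z < d \<longrightarrow> \<bar>second_difference (W R) x z\<bar> \<le> M * (norm z)\<^sup>2"
      if x: "x \<in> ball 0 1" for x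
    proof -
      have x1: "x \<in> cball 0 1" using x by simp
      have "\<bar>second_difference (W R) x z\<bar> \<le> M * (norm z)\<^sup>2" if z: "norm z < d" for z
      proof -
        have "norm x < 2" "norm (x + z) < 2" "norm (x - z) < 2"
          using x1 z d norm_triangle_ineq[of x z] norm_triangle_ineq4[of x z] by auto
        then show ?thesis using sd[OF x1 z] by (simp add: W_near)
      qed
      then show ?thesis using d(1) by blast
    qed
  qed simp
  have Qpoly: "poly_deg_less k (Q R)" for R unfolding Q_def[abs_def] by (rule far(2))
  have meas: "(\<lambda>x. g R x + Q R x) \<in> borel_measurable (lebesgue_on (ball 0 1))" for R
  proof (rule continuous_imp_measurable_on_sets_lebesgue)
    have "continuous_on (cball 0 1) (\<lambda>x. g R x + Q R x)"
      unfolding g_def using continuous_on_far_potential[OF vR vR0 p0]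
      by (intro continuous_on_add continuous_on_diff Lcont poly_deg_less_continuous[OF Qpoly])
    then show "continuous_on (ball 0 1) (\<lambda>x. g R x + Q R x)" by (rule continuous_on_subset) simp
  qed simp
  have conv: "((\<lambda>R. g R x + Q R x) \<longlongrightarrow> f x) at_top" if x: "x \<in> ball 0 1" for x
  proof -
    have x1: "norm x \<le> 1" using x by simp
    have "g R x + Q R x = (L x - N x) - (potential p (uR R) x - Q R x)" for R
    proof -
      have "potential p (\<lambda>y. v y + uR R y) x = N x + potential p (uR R) x"
        unfolding N_def add_divide_distrib
        by (intro Bochner_Integration.integral_add integrable_far_potential(1)[OF v(1) v0 x1 p0]
            integrable_far_potential(1)[OF far(1) uR0 x1 p0])
      then show ?thesis by (simp add: g_def)
    qed
    moreover have "((\<lambda>R. (L x - N x) - (potential p (uR R) x - Q R x)) \<longlongrightarrow> (L x - N x) - T x) at_top"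
      by (rule tendsto_diff[OF tendsto_const far3[OF x1]])
    ultimately show ?thesis by (simp only: f[OF x])
  qed
  have growth: "(\<lambda>x. w0 x + v x + U x) \<in> growth_class s k"
    unfolding growth_class_def
  proof (intro CollectI conjI)
    have [measurable]: "w0 \<in> borel_measurable lebesgue" using w0m by (intro measurable_completion) simp
    have [measurable]: "v \<in> borel_measurable lebesgue" using v(1) by auto
    note U(1)[measurable]
    show m: "(\<lambda>x. w0 x + v x + U x) \<in> borel_measurable lebesgue" by measurable
    have "continuous_on (ball 0 1) w0" using w0(1) by (rule continuous_on_subset) simp
    then show "continuous_on (ball 0 1) (\<lambda>x. w0 x + v x + U x)"
      by (rule continuous_on_eq) (simp add: v0 U6)
    have "(\<lambda>x. norm x powr (p + real k)) \<in> borel_measurable (lborel :: (real^'n) measure)" by measurable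
    then have [measurable]: "(\<lambda>x::real^'n. norm x powr (p + real k)) \<in> borel_measurable lebesgue"
      by (rule measurable_completion)
    have w0int: "integrable lebesgue w0"
    proof (rule Bochner_Integration.integrable_bound)
      show "integrable lebesgue (\<lambda>x::real^'n. B * indicator (cball 0 R0) x)"
        using lmeasurable_cball[of "0 :: real^'n" R0] by (simp add: fmeasurable_def integrable_indicator_iff)
      have "\<bar>w0 x\<bar> \<le> \<bar>B * indicator (cball 0 R0) x\<bar>" for x
        using w0(2)[of x] w0(3)[of x] by (cases "norm x \<le> R0") auto
      then show "AE x in lebesgue. norm (w0 x) \<le> norm (B * indicator (cball 0 R0) x)" by simp
    qed measurable
    have "integrable lebesgue (\<lambda>x. \<bar>w0 x + v x + U x\<bar> / (1 + norm x powr (p + real k)))"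
    proof (rule Bochner_Integration.integrable_bound)
      show "integrable lebesgue (\<lambda>x. (\<bar>w0 x\<bar> + \<bar>v x\<bar>) + \<bar>U x\<bar> / norm x powr (p + real k))"
        by (intro Bochner_Integration.integrable_add integrable_abs w0int v(1) U(3))
      have "\<bar>w0 x + v x + U x\<bar> / (1 + norm x powr (p + real k)) \<le> (\<bar>w0 x\<bar> + \<bar>v x\<bar>) + \<bar>U x\<bar> / norm x powr (p + real k)" for x
      proof -
        let ?D = "1 + norm x powr (p + real k)"
        have D: "1 \<le> ?D" "0 < ?D" by (simp_all add: add_pos_nonneg)
        have "\<bar>w0 x + v x + U x\<bar> / ?D \<le> (\<bar>w0 x\<bar> + \<bar>v x\<bar>) / ?D + \<bar>U x\<bar> / ?D"
          unfolding add_divide_distrib[symmetric] using D by (intro divide_right_mono) auto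
        moreover have "(\<bar>w0 x\<bar> + \<bar>v x\<bar>) / ?D \<le> (\<bar>w0 x\<bar> + \<bar>v x\<bar>) / 1" using D by (intro divide_left_mono) auto
        moreover have "\<bar>U x\<bar> / ?D \<le> \<bar>U x\<bar> / norm x powr (p + real k)"
        proof (cases "x = 0")
          case True
          then show ?thesis using U6[of x] by simp
        next
          case False
          then show ?thesis using D by (intro divide_left_mono) auto
        qed
        ultimately show ?thesis by simp
      qed
      then show "AE x in lebesgue. norm (\<bar>w0 x + v x + U x\<bar> / (1 + norm x powr (p + real k)))
          \<le> norm ((\<bar>w0 x\<bar> + \<bar>v x\<bar>) + \<bar>U x\<bar> / norm x powr (p + real k))"
        by (intro AE_I2) (smt (verit) real_norm_def divide_nonneg_nonneg powr_ge_zero)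
    qed measurable
    then show "integrable lebesgue (\<lambda>x. \<bar>w0 x + v x + U x\<bar> / (1 + norm x powr (real CARD('n) + 2 * s + real k)))"
      by (simp add: p_def)
  qed
  have ev: "\<forall>\<^sub>F R in at_top. poly_deg_less k (\<lambda>x. - Q R x) \<and>
      (\<lambda>x. g R x + Q R x) \<in> borel_measurable (lebesgue_on (ball 0 1)) \<and>
      visc_solution s (ball 0 1) (\<lambda>x. indicator (ball 0 R) x * (w0 x + v x + U x)) (\<lambda>x. g R x + Q R x + - Q R x)"
    using eventually_gt_at_top[of R0]
  proof eventually_elim
    case (elim R)
    have "poly_deg_less k (\<lambda>x. - Q R x)" using poly_deg_less_scale[OF Qpoly, of "- 1" R] by simp
    moreover have "(\<lambda>x. g R x + Q R x + - Q R x) = g R" by auto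
    ultimately show ?case using visc[of R] meas[of R] truncate[OF elim] by simp
  qed
  show ?thesis
    unfolding div_frac_laplacian_def
    by (rule conjI[OF growth], rule exI[of _ "\<lambda>R x. - Q R x"], rule exI[of _ "\<lambda>R x. g R x + Q R x"])
      (intro conjI ev ballI conv)
qed

theorem theorem1p5:
  fixes s :: real and k m :: nat
    and u :: "real^'n::finite \<Rightarrow> real"
    and F :: "('n + 'n list \<Rightarrow> real) \<Rightarrow> real"
    and \<epsilon> :: real
  assumes "0 < s" "s < 1"
    and "u \<in> borel_measurable lebesgue"
    and "Ck_closure (2 * m) (ball 0 1) u"
    and "set_integrable lebesgue (- ball 0 1)
           (\<lambda>x. \<bar>u x\<bar> / norm x powr (real CARD('n) + 2 * s + real k))"
    and "Ck_coord m (jet_coords m) F"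
    and "\<epsilon> > 0"
  shows "\<exists>(u\<^sub>\<epsilon> :: real^'n \<Rightarrow> real) (\<eta>\<^sub>\<epsilon> :: real^'n \<Rightarrow> real) (R\<^sub>\<epsilon> :: real).
           R\<^sub>\<epsilon> > 1 \<and>
           u\<^sub>\<epsilon> \<in> borel_measurable lebesgue \<and>
           \<eta>\<^sub>\<epsilon> \<in> borel_measurable lebesgue \<and>
           Ck_on m (ball 0 1) u\<^sub>\<epsilon> \<and>
           div_frac_laplacian s k u\<^sub>\<epsilon> (\<lambda>x. F (jet m u\<^sub>\<epsilon> x) + \<eta>\<^sub>\<epsilon> x) \<and>
           Linf_norm (ball 0 1) \<eta>\<^sub>\<epsilon> \<le> ennreal \<epsilon> \<and>
           Ck_norm m (ball 0 1) (\<lambda>x. u\<^sub>\<epsilon> x - u x) \<le> ennreal \<epsilon> \<and>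
           (\<forall>x. x \<notin> ball 0 R\<^sub>\<epsilon> \<longrightarrow> u\<^sub>\<epsilon> x = u x)"
proof -
  note s = assms(1,2) and um [measurable] = assms(3) and uint = assms(5) and F = assms(6) and \<epsilon> = assms(7)
  define p where "p = real CARD('n) + 2 * s"
  have p: "0 \<le> p" "real CARD('n) < p" using s by (auto simp: p_def)
  obtain \<rho>' w where w: "1 < \<rho>'" "Ck_on 2 (ball 0 \<rho>') w" "Ck_on m (ball 0 \<rho>') w"
      "Ck_norm m (ball 0 1) (\<lambda>x. w x - u x) \<le> ennreal \<epsilon>"
    by (rule C2_approximation_up_to_boundary[OF assms(4) \<epsilon>]) (rule that)
  \<comment> \<open>at most \<open>3 / 2\<close>, so that the extended \<open>w0\<close> vanishes well inside the ball of radius \<open>R0 \<ge> 6\<close>\<close>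
  define \<rho> where "\<rho> = (1 + min \<rho>' 2) / 2"
  have \<rho>: "1 < \<rho>" "\<rho> < \<rho>'" "\<rho> \<le> 2" using w(1) by (auto simp: \<rho>_def min_def field_simps)
  have wcont: "continuous_on (cball 0 \<rho>) w"
  proof (rule continuous_on_subset)
    show "continuous_on (ball 0 \<rho>') w"
      using w(2)[unfolded Ck_on_def, THEN conjunct2, rule_format, of "[]"] by simp
  qed (use \<rho> in auto)
  obtain w0 B where w0: "continuous_on UNIV w0" "\<And>x. x \<in> cball 0 \<rho> \<Longrightarrow> w0 x = w x"
      "\<And>x. \<bar>w0 x\<bar> \<le> B" "\<And>x. \<rho> + 1 \<le> norm x \<Longrightarrow> w0 x = 0"
    by (rule compactly_supported_extension[OF wcont order.strict_trans[OF zero_less_one \<rho>(1)]]) (rule that)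
  have w_w0: "w x = w0 x" if "x \<in> ball 0 \<rho>" for x using w0(2)[of x] that by simp
  have sub: "ball (0::real^'n) \<rho> \<subseteq> ball 0 \<rho>'" using \<rho> by (intro subset_ball) simp
  have C2: "Ck_on 2 (ball 0 \<rho>) w0" by (rule Ck_on_cong_open[OF open_ball w_w0 Ck_on_mono[OF w(2) order_refl sub]])
  have Cm: "Ck_on m (ball 0 \<rho>) w0" by (rule Ck_on_cong_open[OF open_ball w_w0 Ck_on_mono[OF w(3) order_refl sub]])

  define L where "L x = (LINT z|lborel. second_difference w0 x z / (2 * norm z powr p))" for x
  define f where "f x = F (jet m w0 x)" for x
  have Lcont: "continuous_on (cball 0 1) L"
    unfolding L_def p_def by (rule continuous_on_frac_laplacian[OF s w0(1,3) \<rho>(1) C2])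
  have fcont: "continuous_on (ball 0 \<rho>) f" unfolding f_def by (rule continuous_on_jet[OF Cm F])
  have "continuous_on (cball 0 1) (\<lambda>x. L x - f x)"
    by (intro continuous_on_diff Lcont continuous_on_subset[OF fcont]) (use \<rho> in auto)
  moreover have "0 < \<epsilon> / 2" using \<epsilon> by simp
  ultimately obtain v R1 where v: "integrable lebesgue v" "\<And>y. norm y < 2 \<or> R1 < norm y \<Longrightarrow> v y = 0"
      "\<And>x. x \<in> cball 0 1 \<Longrightarrow> \<bar>potential p v x - (L x - f x)\<bar> \<le> \<epsilon> / 2"
    by (rule far_potentials_dense[OF p(2)]) (rule that)
  obtain C where C: "0 \<le> C" "\<And>x y :: real^'n. norm x \<le> 1 \<Longrightarrow> 6 \<le> norm y \<Longrightarrow>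
      \<bar>taylor_remainder k p x y\<bar> \<le> C / norm y powr (p + real k)"
    by (rule taylor_kernel_remainder[OF p(1)]) (rule that)
  define h where "h y = indicator (- ball 0 1) y * (\<bar>u y\<bar> / norm y powr (p + real k))" for y
  have h: "integrable lebesgue h" using uint by (simp add: h_def[abs_def] set_integrable_def p_def)
  \<comment> \<open>\<open>C + 1\<close> only avoids a division by \<open>0\<close>\<close>
  have "0 < \<epsilon> / (2 * (C + 1))" using \<epsilon> C(1) by simp
  then obtain R0 where R0: "max 6 (R1 + 1) \<le> R0"
      "(LINT y|lebesgue. indicator (- ball 0 R0) y * \<bar>h y\<bar>) < \<epsilon> / (2 * (C + 1))"
    by (rule tail_integral_small[OF h, where ?R0.0 = "max 6 (R1 + 1)"]) (rule that)
  have R6: "6 \<le> R0" "R1 < R0" using R0(1) by auto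
  define U where "U y = indicator (- ball 0 R0) y * u y" for y
  have [measurable]: "- ball (0::real^'n) r \<in> sets lebesgue" for r by simp
  have Um: "U \<in> borel_measurable lebesgue" unfolding U_def[abs_def] by measurable
  have U0: "U y = 0" if "norm y < R0" for y using that by (simp add: U_def)
  have Uh: "\<bar>U y\<bar> / norm y powr (p + real k) = indicator (- ball 0 R0) y * \<bar>h y\<bar>" for y
    using R6 by (auto simp: U_def h_def indicator_def)
  have Uint: "integrable lebesgue (\<lambda>y. \<bar>U y\<bar> / norm y powr (p + real k))"
    unfolding Uh by (rule integrable_mult_indicator[where 'b = real, unfolded real_scaleR_def]) (use h in auto)
  define N where "N x = potential p v x" for x
  define T where "T x = (LINT y|lebesgue. U y * taylor_remainder k p x y)" for x
  have U6: "U y = 0" if "norm y < 6" for y using U0 that R6 by simp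
  have T: "\<bar>T x\<bar> \<le> \<epsilon> / 2" if "norm x \<le> 1" for x
  proof -
    have "\<bar>T x\<bar> \<le> C * (LINT y|lebesgue. \<bar>U y\<bar> / norm y powr (p + real k))"
      unfolding T_def by (rule far_field_convergence(4)[OF p(1) C(2) Um U6 Uint that])
    also have "\<dots> \<le> (C + 1) * (\<epsilon> / (2 * (C + 1)))"
      unfolding Uh using C(1) R0(2) by (intro mult_mono) (auto intro!: Bochner_Integration.integral_nonneg)
    also have "\<dots> = \<epsilon> / 2"
    proof -
      have "c * (\<epsilon> / (2 * c)) = \<epsilon> / 2" if "0 < c" for c :: real using that by simp
      then show ?thesis using C(1) by (metis add_nonneg_pos zero_less_one)
    qed
    finally show ?thesis .
  qed
  define u' where "u' x = w0 x + v x + U x" for x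
  \<comment> \<open>the defect of the equation, cut off outside the unit ball to make it measurable on the whole space\<close>
  define \<eta> where "\<eta> x = (if x \<in> ball 0 1 then L x - N x - T x - f x else 0)" for x
  have u'_w0: "u' x = w0 x" if "norm x < 2" for x using that v(2)[of x] U6[of x] by (simp add: u'_def)
  have u'_jet: "jet m u' x = jet m w0 x" if "x \<in> ball 0 1" for x
    by (rule jet_cong_open[OF open_ball _ that]) (simp add: u'_w0)
  have w0far: "w0 x = 0" if "R0 \<le> norm x" for x using that R6 \<rho> by (intro w0(4)) simp
  have vfar: "v y = 0" if "norm y < 2 \<or> R0 \<le> norm y" for y using that R6 by (intro v(2)) auto
  have eqn: "F (jet m u' x) + \<eta> x = L x - N x - T x" if "x \<in> ball 0 1" for x
    unfolding u'_jet[OF that] using that by (simp add: \<eta>_def f_def)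
  have div: "div_frac_laplacian s k u' (\<lambda>x. F (jet m u' x) + \<eta> x)"
    unfolding u'_def[abs_def]
    by (rule div_frac_laplacian_decomposition[OF s w0(1,3) w0far \<rho>(1) C2 v(1) vfar R6(1) Um U0 Uint[unfolded p_def] C(2)[unfolded p_def]
          eqn[unfolded u'_def[abs_def] L_def N_def T_def p_def]])
  have \<eta>m: "\<eta> \<in> borel_measurable lebesgue"
  proof -
    have "continuous_on (cball 0 1) N" unfolding N_def by (rule continuous_on_far_potential[OF v(1) _ p(1)]) (use v(2) in auto)
    moreover have "continuous_on (cball 0 1) T" unfolding T_def by (rule continuous_on_far_field_remainder[OF p(1) C(2) Um U6 Uint])
    ultimately have "continuous_on (cball 0 1) (\<lambda>x. L x - N x - T x - f x)"
      by (intro continuous_on_diff Lcont continuous_on_subset[OF fcont]) (use \<rho> in auto)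
    then have "continuous_on (ball 0 1) (\<lambda>x. L x - N x - T x - f x)" by (rule continuous_on_subset) simp
    then have "(\<lambda>x. indicator (ball 0 1) x *\<^sub>R (L x - N x - T x - f x)) \<in> borel_measurable borel"
      by (rule borel_measurable_continuous_on_indicator[rotated]) simp
    moreover have "\<eta> = (\<lambda>x. indicator (ball 0 1) x *\<^sub>R (L x - N x - T x - f x))"
      by (auto simp: \<eta>_def fun_eq_iff indicator_def)
    ultimately show ?thesis by (intro measurable_completion) simp
  qed
  have \<eta>_le: "\<bar>\<eta> x\<bar> \<le> \<epsilon>" for x
  proof (cases "x \<in> ball 0 1")
    case True
    then have "\<bar>N x - (L x - f x)\<bar> \<le> \<epsilon> / 2" "\<bar>T x\<bar> \<le> \<epsilon> / 2"
      unfolding N_def by (intro v(3) T; simp)+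
    then have "\<bar>L x - N x - T x - f x\<bar> \<le> \<epsilon>" by linarith
    then show ?thesis using True by (simp add: \<eta>_def)
  qed (use \<epsilon> in \<open>simp add: \<eta>_def\<close>)
  have [measurable]: "w0 \<in> borel_measurable lebesgue" "v \<in> borel_measurable lebesgue" "U \<in> borel_measurable lebesgue"
    using borel_measurable_continuous_onI[OF w0(1)] v(1) Um by (auto intro: measurable_completion)
  show ?thesis
  proof (intro exI conjI allI impI)
    show "1 < R0" using R6 by simp
    show "u' \<in> borel_measurable lebesgue" unfolding u'_def[abs_def] by measurable
    show "\<eta> \<in> borel_measurable lebesgue" by (rule \<eta>m)
    have "Ck_on m (ball 0 1) w0" by (rule Ck_on_mono[OF Cm order_refl]) (use \<rho> in auto)
    then show "Ck_on m (ball 0 1) u'" by (rule Ck_on_cong_open[rotated 2]) (auto simp: u'_w0)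
    show "div_frac_laplacian s k u' (\<lambda>x. F (jet m u' x) + \<eta> x)" by (rule div)
    show "Linf_norm (ball 0 1) \<eta> \<le> ennreal \<epsilon>"
      unfolding Linf_norm_def
    proof (rule esssup_I)
      have "\<eta> \<in> borel_measurable (lebesgue_on (ball 0 1))" using \<eta>m by (rule measurable_restrict_space1)
      then show "(\<lambda>x. ennreal \<bar>\<eta> x\<bar>) \<in> borel_measurable (lebesgue_on (ball 0 1))" by measurable
      show "AE x in lebesgue_on (ball 0 1). ennreal \<bar>\<eta> x\<bar> \<le> ennreal \<epsilon>"
        by (intro AE_I2 ennreal_leI \<eta>_le)
    qed
    have "Ck_norm m (ball 0 1) (\<lambda>x. u' x - u x) = Ck_norm m (ball 0 1) (\<lambda>x. w x - u x)"
    proof (rule Ck_norm_cong_open[OF open_ball])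
      fix x :: "real^'n" assume "x \<in> ball 0 1"
      then show "u' x - u x = w x - u x" using u'_w0[of x] w_w0[of x] \<rho> by simp
    qed
    then show "Ck_norm m (ball 0 1) (\<lambda>x. u' x - u x) \<le> ennreal \<epsilon>" using w(4) by simp
    show "u' x = u x" if "x \<notin> ball 0 R0" for x
      using that w0far[of x] vfar[of x] by (simp add: u'_def U_def)
  qed
qed

end
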